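(* Let $\lambda\in\mathbb{Z}_+^n$, $\gamma\in\mathbb{Z}_+^m$, and let $T:\mathbb{R}^\lambda[x_1,\dots,x_n]\to\mathbb{R}^\gamma[x_1,\dots,x_m]$ be a linear operator of rank greater than $2$, mapping polynomials with non-negative coefficients to polynomials with non-negative coefficients, such that $T$ preserves real stability. Let $\alpha\in\mathbb{R}_+^n$ with $\alpha\le\lambda$ and $\beta\in\mathbb{R}_+^m$. Then for every real stable $p\in\mathbb{R}_+^\lambda[x_1,\dots,x_n]$ with $\alpha\in\mathrm{Newt}(p)$, $$\frac{\mathrm{Cap}_\beta(T(p))}{\mathrm{Cap}_\alpha(p)}\ \ge\ \frac{\alpha^\alpha(\lambda-\alpha)^{\lambda-\alpha}}{\lambda^\lambda}\,\mathrm{Cap}_{(\alpha,\beta)}\big(\mathrm{Symb}^\lambda(T)\big),$$ and this bound is tight for fixed $T,\alpha,\beta$: the infimum of the left-hand side over all real stable $p\in\mathbb{R}_+^\lambda[x_1,\dots,x_n]$ with $\alpha\in\mathrm{Newt}(p)$ equals the right-hand side.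
   Context: $\mathbb{R}_+$ and $\mathbb{Z}_+$ denote the non-negative reals and integers. $\mathbb{R}^\lambda[x_1,\dots,x_n]$ is the space of real polynomials of degree at most $\lambda_k$ in $x_k$ for each $k$; $\mathbb{R}_+^\lambda[x_1,\dots,x_n]$ is the subset of those with non-negative coefficients. A real polynomial is real stable if it is identically zero or does not vanish when all variables lie in the open upper half-plane. $T$ preserves real stability if $T(p)$ is real stable for every real stable $p\in\mathbb{R}^\lambda[x_1,\dots,x_n]$. The rank of $T$ is the dimension of its image. Multi-index notation: $x^\alpha=\prod_k x_k^{\alpha_k}$, $\alpha^\alpha=\prod_k\alpha_k^{\alpha_k}$, $(\lambda-\alpha)^{\lambda-\alpha}=\prod_k(\lambda_k-\alpha_k)^{\lambda_k-\alpha_k}$, $\lambda^\lambda=\prod_k\lambda_k^{\lambda_k}$, with $0^0=1$; $\alpha\le\lambda$ is entrywise; $\binom{\lambda}{\mu}=\prod_k\binom{\lambda_k}{\mu_k}$. The capacity of a polynomial $p$ with non-negative coefficients is $\mathrm{Cap}_\alpha(p)=\inf_{x_1,\dots,x_n>0}p(x)/x^\alpha$. $\mathrm{Newt}(p)$ is the convex hull of the set of exponents of monomials with non-zero coefficient in $p$; for $\alpha\in\mathrm{Newt}(p)$ one has $\mathrm{Cap}_\alpha(p)>0$. The symbol of $T$ is $\mathrm{Symb}^\lambda(T)(z,x)=\sum_{0\le\mu\le\lambda}\binom{\lambda}{\mu}z^\mu\,T(x^\mu)$, a polynomial in $z_1,\dots,z_n,x_1,\dots,x_m$, and $\mathrm{Cap}_{(\alpha,\beta)}(\mathrm{Symb}^\lambda(T))=\inf_{z>0,\,x>0}\mathrm{Symb}^\lambda(T)(z,x)/(z^\alpha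 x^\beta)$. *)

theory Defs
  imports "HOL-Analysis.Analysis" "HOL-Analysis.Finite_Function_Topology"
begin

text \<open>
  A real polynomial in variables indexed by a finite type \<open>'n\<close> is a finitely supported map from
  exponent vectors to coefficients. Its real vector space structure (used for linearity and for
  \<^const>\<open>dim\<close>) is the library instance from \<^theory>\<open>HOL-Analysis.Finite_Function_Topology\<close>.
\<close>

type_synonym 'n rpoly = "(nat, 'n) vec \<Rightarrow>\<^sub>0 real"

definition eval_poly :: "('n::finite) rpoly \<Rightarrow> 'a::real_field ^ 'n \<Rightarrow> 'a" where
  "eval_poly p x =
     (\<Sum>\<mu>\<in>Poly_Mapping.keys p. of_real (Poly_Mapping.lookup p \<mu>) * (\<Prod>k\<in>UNIV. x $ k ^ (\<mu> $ k)))"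

definition monomial :: "nat ^ 'n \<Rightarrow> ('n::finite) rpoly" where
  "monomial \<mu> = Poly_Mapping.single \<mu> 1"

definition polys_le :: "nat ^ 'n \<Rightarrow> ('n::finite) rpoly set" where
  "polys_le l = {p. \<forall>\<mu>\<in>Poly_Mapping.keys p. \<mu> \<le> l}"

definition nonneg_polys_le :: "nat ^ 'n \<Rightarrow> ('n::finite) rpoly set" where
  "nonneg_polys_le l = {p \<in> polys_le l. \<forall>\<mu>. 0 \<le> Poly_Mapping.lookup p \<mu>}"

definition real_stable :: "('n::finite) rpoly \<Rightarrow> bool" where
  "real_stable p \<longleftrightarrow>
     p = 0 \<or> (\<forall>z :: complex ^ 'n. (\<forall>k. 0 < Im (z $ k)) \<longrightarrow> eval_poly p z \<noteq> 0)"

text \<open>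
  Operators are total functions on polynomials of which only the restriction to a subspace matters;
  linearity is accordingly required on that subspace only.
\<close>

definition linear_between ::
    "'a::real_vector set \<Rightarrow> 'b::real_vector set \<Rightarrow> ('a \<Rightarrow> 'b) \<Rightarrow> bool" where
  "linear_between V W T \<longleftrightarrow>
     (\<forall>p\<in>V. T p \<in> W) \<and>
     (\<forall>p\<in>V. \<forall>q\<in>V. T (p + q) = T p + T q) \<and>
     (\<forall>c. \<forall>p\<in>V. T (c *\<^sub>R p) = c *\<^sub>R T p)"

definition preserves_nonneg ::
    "nat ^ 'n \<Rightarrow> nat ^ 'm \<Rightarrow> (('n::finite) rpoly \<Rightarrow> ('m::finite) rpoly) \<Rightarrow> bool" where
  "preserves_nonneg l g T \<longleftrightarrow> (\<forall>p\<in>nonneg_polys_le l. T p \<in> nonneg_polys_le g)"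

definition preserves_real_stability ::
    "nat ^ 'n \<Rightarrow> (('n::finite) rpoly \<Rightarrow> ('m::finite) rpoly) \<Rightarrow> bool" where
  "preserves_real_stability l T \<longleftrightarrow> (\<forall>p\<in>polys_le l. real_stable p \<longrightarrow> real_stable (T p))"

definition rank_on :: "'a::real_vector set \<Rightarrow> ('a \<Rightarrow> 'b::real_vector) \<Rightarrow> nat" where
  "rank_on V T = dim (T ` V)"

definition real_vec :: "nat ^ 'n \<Rightarrow> real ^ ('n::finite)" where
  "real_vec \<mu> = (\<chi> k. real (\<mu> $ k))"

text \<open>The multi-index power \<open>v^v\<close>; the case distinction is needed because \<open>0 powr 0 = 0\<close>.\<close>

definition self_power :: "real ^ ('n::finite) \<Rightarrow> real" where
  "self_power v = (\<Prod>k\<in>UNIV. if v $ k = 0 then 1 else v $ k powr v $ k)"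

definition multi_choose :: "nat ^ 'n \<Rightarrow> nat ^ ('n::finite) \<Rightarrow> nat" where
  "multi_choose l \<mu> = (\<Prod>k\<in>UNIV. (l $ k) choose (\<mu> $ k))"

text \<open>
  The infimum is over a nonempty set; it is bounded below (by 0) for polynomials with non-negative
  coefficients, the only ones to which the capacity is applied.
\<close>

definition Cap :: "real ^ 'n \<Rightarrow> ('n::finite) rpoly \<Rightarrow> real" where
  "Cap \<alpha> p =
     (INF x\<in>{x :: real ^ 'n. \<forall>k. 0 < x $ k}. eval_poly p x / (\<Prod>k\<in>UNIV. x $ k powr \<alpha> $ k))"

definition Newt :: "('n::finite) rpoly \<Rightarrow> (real ^ 'n) set" where
  "Newt p = convex hull (real_vec ` Poly_Mapping.keys p)"

text \<open>Concatenation \<open>(a, b)\<close> of vectors; \<open>Inl\<close> indexes the first block, \<open>Inr\<close> the second.\<close>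

definition vec_append :: "'a ^ 'n \<Rightarrow> 'a ^ 'm \<Rightarrow> 'a ^ ('n::finite + 'm::finite)" where
  "vec_append a b = (\<chi> i. case i of Inl k \<Rightarrow> a $ k | Inr k \<Rightarrow> b $ k)"

text \<open>
  The symbol as a polynomial in \<open>(z, x)\<close>, with \<open>z\<close> the variables indexed by \<open>Inl\<close> and \<open>x\<close> those
  indexed by \<open>Inr\<close>. The inner sum over \<open>\<nu>\<close> expands \<open>z^\<mu> T(x^\<mu>)\<close> into monomials; see
  \<open>eval_Symb\<close> below for the defining formula.
\<close>

definition Symb ::
    "nat ^ 'n \<Rightarrow> (('n::finite) rpoly \<Rightarrow> ('m::finite) rpoly) \<Rightarrow> ('n + 'm) rpoly" where
  "Symb l T =
     (\<Sum>\<mu>\<in>{..l}. \<Sum>\<nu>\<in>Poly_Mapping.keys (T (monomial \<mu>)).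
        Poly_Mapping.single (vec_append \<mu> \<nu>)
          (real (multi_choose l \<mu>) * Poly_Mapping.lookup (T (monomial \<mu>)) \<nu>))"

lemma finite_atMost_vec: "finite {..l :: nat ^ 'n::finite}"
proof -
  have "{..l} \<subseteq> vec_lambda ` (PiE UNIV (\<lambda>k. {..l $ k}))"
  proof
    fix x assume "x \<in> {..l}"
    then have "vec_nth x \<in> PiE UNIV (\<lambda>k. {..l $ k})" by (auto simp: less_eq_vec_def)
    then show "x \<in> vec_lambda ` (PiE UNIV (\<lambda>k. {..l $ k}))"
      by (metis image_eqI vec_nth_inverse)
  qed
  then show ?thesis by (rule finite_subset) (intro finite_imageI finite_PiE, auto)
qed

lemma eval_poly_superset:
  assumes "finite A" "Poly_Mapping.keys p \<subseteq> A"
  shows "eval_poly p x =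
    (\<Sum>\<mu>\<in>A. of_real (Poly_Mapping.lookup p \<mu>) * (\<Prod>k\<in>UNIV. x $ k ^ (\<mu> $ k)))"
  unfolding eval_poly_def
  by (rule sum.mono_neutral_left) (use assms in \<open>auto simp: in_keys_iff\<close>)

lemma eval_poly_zero: "eval_poly 0 x = 0"
  by (simp add: eval_poly_def)

lemma eval_poly_add: "eval_poly (p + q) x = eval_poly p x + eval_poly q x"
proof -
  let ?A = "Poly_Mapping.keys p \<union> Poly_Mapping.keys q"
  have "Poly_Mapping.keys (p + q) \<subseteq> ?A" by (rule Poly_Mapping.keys_add)
  then show ?thesis
    by (simp add: eval_poly_superset[of ?A] lookup_add algebra_simps sum.distrib)
qed

lemma eval_poly_sum: "eval_poly (sum f A) x = (\<Sum>a\<in>A. eval_poly (f a) x)"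
  by (induction A rule: infinite_finite_induct) (auto simp: eval_poly_zero eval_poly_add)

lemma eval_poly_single:
  "eval_poly (Poly_Mapping.single \<mu> c) x = of_real c * (\<Prod>k\<in>UNIV. x $ k ^ (\<mu> $ k))"
  by (simp add: eval_poly_superset[of "{\<mu>}"])

lemma prod_vec_append:
  fixes z :: "'a::comm_monoid_mult ^ 'n::finite" and x :: "'a ^ 'm::finite"
  shows "(\<Prod>i\<in>UNIV. vec_append z x $ i ^ (vec_append \<mu> \<nu> $ i)) =
    (\<Prod>k\<in>UNIV. z $ k ^ (\<mu> $ k)) * (\<Prod>k\<in>UNIV. x $ k ^ (\<nu> $ k))"
proof -
  have "(\<Prod>i\<in>(UNIV :: ('n + 'm) set). vec_append z x $ i ^ (vec_append \<mu> \<nu> $ i)) =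
    (\<Prod>i\<in>UNIV <+> UNIV. vec_append z x $ i ^ (vec_append \<mu> \<nu> $ i))"
    by simp
  also have "\<dots> = (\<Prod>k\<in>UNIV. z $ k ^ (\<mu> $ k)) * (\<Prod>k\<in>UNIV. x $ k ^ (\<nu> $ k))"
    by (subst prod.Plus) (simp_all add: vec_append_def)
  finally show ?thesis .
qed

lemma eval_Symb:
  "eval_poly (Symb l T) (vec_append z x) =
     (\<Sum>\<mu>\<in>{..l}. of_nat (multi_choose l \<mu>) * (\<Prod>k\<in>UNIV. z $ k ^ (\<mu> $ k)) *
        eval_poly (T (monomial \<mu>)) x)"
  by (simp add: Symb_def eval_poly_sum eval_poly_single prod_vec_append sum_distrib_left
      eval_poly_def[of "T (monomial _)"] mult_ac)

end

theory Submission
  imports Defs "HOL-Complex_Analysis.Great_Picard" "HOL-Computational_Algebra.Fundamental_Theorem_Algebra"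
begin

text \<open>
  Polarize: replace the variable \<open>x\<^sub>k\<close> of degree \<open>l\<^sub>k\<close> by \<open>l\<^sub>k\<close> variables of degree one. For a fixed
  positive point \<open>x\<close> the number \<open>T(p)(x)\<close> becomes \<open>\<Sum>\<^sub>S P\<^sub>S Q\<^sub>S\<close>, where \<open>P\<close> is the polarization of \<open>p\<close>,
  stable by the Grace-Walsh-Szego theorem, and \<open>Q\<close> is the polarized symbol at \<open>x\<close>. Contracting the
  variables of \<open>P\<close> and \<open>Q\<close> in pairs preserves stability (Lieb-Sokal), and each contraction loses at
  most a factor \<open>t\<^sup>t (1 - t)\<^sup>1\<^sup>-\<^sup>t\<close> of the capacity, because the four coefficients of a stable bilinear
  form satisfy the Rayleigh inequality. Capacities survive polarization by the inequality between
  elementary symmetric means and the geometric mean.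

  Stability of \<open>Q\<close> follows Borcea and Braenden. For \<open>w\<close> in the lower half-planes put
  \<open>h\<^sub>w = \<Prod> (1 + w\<^sub>k\<^sub>j x\<^sub>k)\<close>. Every real polynomial \<open>Re (\<zeta> h\<^sub>w)\<close> is an interior point of the set of real
  stable polynomials, so if \<open>T\<close> killed it, the whole image of \<open>T\<close> would be stable and, evaluation at a
  point of the upper half-planes being injective on it, of dimension at most two. Therefore
  \<open>\<bar>T h\<^sub>w\<bar>\<close> and \<open>\<bar>T h\<^sub>w\<^sub>'\<bar>\<close>, with \<open>w'\<close> the conjugate of \<open>w\<close>, never agree on the upper half-planes, by
  connectedness one of them is always the larger, and that one has no zeros. Hurwitz' theorem passes
  to real \<open>x\<close>.

  The bound is approached along \<open>\<Prod> (1 + z\<^sub>k x\<^sub>k) ^ l\<^sub>k\<close>, whose image is the symbol at \<open>z\<close>.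
\<close>

section \<open>The theorems of Laguerre and Grace-Walsh-Szego\<close>

text \<open>The squared distances differ by \<open>- 4 * Im y * Im r\<close>: the conjugate point
  lies on the side of \<open>r\<close>, hence is at least as near.\<close>

lemma norm_cnj_diff_le:
  assumes "Im y > 0" "Im r \<le> 0"
  shows "norm (cnj y - r) \<le> norm (y - r)"
proof -
  have "(norm (y - r))\<^sup>2 - (norm (cnj y - r))\<^sup>2 = - (4 * (Im y * Im r))"
    by (simp only: cmod_power2) (simp add: power2_eq_square algebra_simps)
  moreover have "Im y * Im r \<le> 0"
    using assms by (simp add: mult_nonneg_nonpos)
  ultimately have "(norm (cnj y - r))\<^sup>2 \<le> (norm (y - r))\<^sup>2"
    by linarith
  then show ?thesis
    by (simp add: power2_le_iff_abs_le)
qed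

lemma norm_cnj_diff_gt:
  assumes "Im y > 0" "Im r > 0"
  shows "norm (y - r) < norm (cnj y - r)"
proof -
  have "(norm (y - r))\<^sup>2 - (norm (cnj y - r))\<^sup>2 = - (4 * (Im y * Im r))"
    by (simp only: cmod_power2) (simp add: power2_eq_square algebra_simps)
  moreover have "Im y * Im r > 0"
    using assms by simp
  ultimately have "(norm (y - r))\<^sup>2 < (norm (cnj y - r))\<^sup>2"
    by linarith
  then show ?thesis
    by (simp add: power2_less_imp_less)
qed

lemma poly_linear_prod:
  fixes p :: "'a::field poly" and d :: nat
  assumes "p = smult c (\<Prod>i<d. [:- r i, 1:])"
  shows "poly p y = c * (\<Prod>i<d. y - r i)"
  using assms by (simp add: poly_prod)

text \<open>The logarithmic derivative of a split polynomial, multiplied out. In this form the zeros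
  enter the theorem of Laguerre.\<close>

lemma poly_pderiv_linear_prod:
  fixes p :: "'a::field_char_0 poly" and d :: nat
  assumes "p = smult c (\<Prod>i<d. [:- r i, 1:])" "\<And>i. i < d \<Longrightarrow> y \<noteq> r i"
  shows "poly (pderiv p) y = poly p y * (\<Sum>i<d. 1 / (y - r i))"
proof -
  have "pderiv p = smult c (\<Sum>i<d. \<Prod>j\<in>{..<d} - {i}. [:- r j, 1:])"
    unfolding assms(1) pderiv_smult pderiv_prod by (simp add: pderiv_pCons)
  then have "poly (pderiv p) y = c * (\<Sum>i<d. \<Prod>j\<in>{..<d} - {i}. y - r j)"
    by (simp add: poly_sum poly_prod)
  also have "(\<Sum>i<d. \<Prod>j\<in>{..<d} - {i}. y - r j) = (\<Sum>i<d. (\<Prod>j<d. y - r j) * (1 / (y - r i)))"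
  proof (rule sum.cong[OF refl])
    fix i assume i: "i \<in> {..<d}"
    then have "(\<Prod>j<d. y - r j) = (y - r i) * (\<Prod>j\<in>{..<d} - {i}. y - r j)"
      by (intro prod.remove) simp_all
    then show "(\<Prod>j\<in>{..<d} - {i}. y - r j) = (\<Prod>j<d. y - r j) * (1 / (y - r i))"
      using assms(2)[of i] i by simp
  qed
  finally show ?thesis
    by (simp add: poly_linear_prod[OF assms(1)] sum_distrib_left)
qed

text \<open>The Moebius map \<open>r \<mapsto> (cnj y - r) / (y - r)\<close> sends the closed lower half-plane into the closed
  unit disc and the open upper half-plane outside of it; a mean of points of the disc stays in it.\<close>

theorem Laguerre_half_plane:
  fixes p :: "complex poly"
  assumes "degree p \<le> N" "N > 0" and nz: "\<And>y. Im y > 0 \<Longrightarrow> poly p y \<noteq> 0"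
    and y: "Im y > 0" and \<zeta>: "Im \<zeta> > 0"
  shows "of_nat N * poly p y + (\<zeta> - y) * poly (pderiv p) y \<noteq> 0"
proof
  assume eq: "of_nat N * poly p y + (\<zeta> - y) * poly (pderiv p) y = 0"
  obtain r where p: "smult (lead_coeff p) (\<Prod>i<degree p. [:-r i, 1:]) = p"
    using complex_poly_decompose' by blast
  define d where "d = degree p"
  note pd = p[symmetric, folded d_def]
  have lc: "lead_coeff p \<noteq> 0"
    using nz[OF y] by auto
  have r: "Im (r i) \<le> 0" if "i < d" for i
  proof (rule ccontr)
    assume "\<not> Im (r i) \<le> 0"
    then have "poly p (r i) \<noteq> 0" by (intro nz) auto
    then show False
      using that by (subst (asm) poly_linear_prod[OF pd]) auto
  qed
  have yr: "y \<noteq> r i" if "i < d" for i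
    using r[OF that] y by auto
  define D where "D = (\<lambda>r. (cnj y - r) / (y - r))"
  \<comment> \<open>Since \<open>1 / (y - r)\<close> is affine in \<open>D r\<close>, an equation
    between sums of reciprocals becomes one between sums of values of \<open>D\<close>.\<close>
  have D: "1 / (y - r) = (1 - D r) / (2 * \<i> * Im y)" if "y \<noteq> r" for r
  proof -
    have "1 - D r = (2 * \<i> * Im y) / (y - r)"
      using that complex_diff_cnj[of y] by (simp add: D_def field_simps)
    then show ?thesis using y by simp
  qed
  have "poly p y * (of_nat N + (\<zeta> - y) * (\<Sum>i<d. 1 / (y - r i))) = 0"
    using eq poly_pderiv_linear_prod[OF pd yr] by (simp add: algebra_simps)
  then have eq2: "of_nat N + (\<zeta> - y) * (\<Sum>i<d. 1 / (y - r i)) = 0"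
    using nz[OF y] by simp
  have y\<zeta>: "y \<noteq> \<zeta>"
    using eq2 assms(2) by auto
  have "(\<Sum>i<d. 1 / (y - r i)) = of_nat N * (1 / (y - \<zeta>))"
    using eq2 y\<zeta> by (simp add: field_simps)
  then have "(\<Sum>i<d. (1 - D (r i)) / (2 * \<i> * Im y)) = of_nat N * ((1 - D \<zeta>) / (2 * \<i> * Im y))"
    using D[OF y\<zeta>] D yr by simp
  then have "(\<Sum>i<d. 1 - D (r i)) = of_nat N * (1 - D \<zeta>)"
    using y by (simp add: sum_divide_distrib[symmetric] field_simps)
  \<comment> \<open>The \<open>N - d\<close> missing zeros count as zeros at infinity, where
    \<open>D\<close> takes the value 1. So \<open>D \<zeta>\<close> is a mean of \<open>N\<close>
    points of the closed unit disc.\<close>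
  then have "of_nat N * D \<zeta> = (of_nat N - of_nat d) + (\<Sum>i<d. D (r i))"
    by (simp add: sum_subtractf algebra_simps)
  also have "norm \<dots> \<le> norm (of_nat N - of_nat d :: complex) + (\<Sum>i<d. norm (D (r i)))"
    by (intro norm_triangle_le add_left_mono norm_sum)
  also have "norm (of_nat N - of_nat d :: complex) = real N - real d"
    using assms(1) by (metis d_def norm_of_nat of_nat_diff)
  also have "(\<Sum>i<d. norm (D (r i))) \<le> (\<Sum>i<d. 1)"
  proof (rule sum_mono)
    fix i assume "i \<in> {..<d}"
    then have "norm (cnj y - r i) \<le> norm (y - r i)"
      using r y by (intro norm_cnj_diff_le) auto
    then show "norm (D (r i)) \<le> 1"
      by (auto simp: D_def norm_divide divide_simps)
  qed
  finally have "real N * norm (D \<zeta>) \<le> real N"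
    by (simp add: norm_mult)
  moreover have "norm (D \<zeta>) > 1"
    using norm_cnj_diff_gt[OF y \<zeta>] y\<zeta> by (simp add: D_def norm_divide)
  ultimately show False
    using assms(2) by simp
qed

text \<open>The top powers of \<open>y\<close> cancel in the polar derivative
  \<open>N * p + (\<zeta> - y) * p'\<close> with \<open>N = Suc n\<close>. Its explicit coefficients
  show the degree bound \<open>n\<close> that the induction over the variables requires.\<close>

lemma polar_derivative_coeffs:
  fixes u :: "nat \<Rightarrow> complex"
  shows "(\<Sum>k\<le>n. (of_nat (Suc n - k) * u k + of_nat (Suc k) * \<zeta> * u (Suc k)) * y ^ k) =
    of_nat (Suc n) * (\<Sum>k\<le>Suc n. u k * y ^ k)
     + (\<zeta> - y) * (\<Sum>k\<le>n. of_nat (Suc k) * u (Suc k) * y ^ k)"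
proof -
  have 1: "y * (\<Sum>k\<le>n. of_nat (Suc k) * u (Suc k) * y ^ k)
      = (\<Sum>k\<le>n. of_nat k * u k * y ^ k) + of_nat (Suc n) * u (Suc n) * y ^ Suc n"
    using sum.atMost_Suc_shift[of "\<lambda>k. of_nat k * u k * y ^ k" n]
    by (simp add: sum_distrib_left mult_ac)
  have "(\<Sum>k\<le>n. (of_nat (Suc n - k) * u k + of_nat (Suc k) * \<zeta> * u (Suc k)) * y ^ k) =
      (\<Sum>k\<le>n. of_nat (Suc n) * (u k * y ^ k) - of_nat k * u k * y ^ k
        + \<zeta> * (of_nat (Suc k) * u (Suc k) * y ^ k))"
    by (intro sum.cong) (auto simp: of_nat_diff algebra_simps)
  also have "\<dots> = of_nat (Suc n) * (\<Sum>k\<le>n. u k * y ^ k) - (\<Sum>k\<le>n. of_nat k * u k * y ^ k)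
        + \<zeta> * (\<Sum>k\<le>n. of_nat (Suc k) * u (Suc k) * y ^ k)"
    by (simp only: sum.distrib sum_subtractf sum_distrib_left)
  finally show ?thesis
    using 1 by (simp add: left_diff_distrib distrib_left del: of_nat_Suc)
qed

lemma pderiv_sum: "pderiv (sum f A) = (\<Sum>x\<in>A. pderiv (f x))"
  using higher_pderiv_sum[of 1 f A] by simp

text \<open>Induction on the variables. Fixing the argument \<open>\<zeta> j\<close> in the
  polarization of a polynomial of degree at most \<open>Suc n\<close> gives the polarization of its
  polar derivative at \<open>\<zeta> j\<close>, divided by \<open>Suc n\<close>; by Laguerre this
  has no zeros in the upper half-plane.\<close>

theorem Grace_Walsh_Szego:
  fixes u :: "nat \<Rightarrow> complex"
  assumes "finite J" "\<And>y. Im y > 0 \<Longrightarrow> (\<Sum>k\<le>card J. u k * y ^ k) \<noteq> 0"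
    and "\<And>j. j \<in> J \<Longrightarrow> Im (\<zeta> j) > 0"
  shows "(\<Sum>S\<in>Pow J. u (card S) / of_nat (card J choose card S) * (\<Prod>j\<in>S. \<zeta> j)) \<noteq> 0"
  using assms
proof (induction J arbitrary: u rule: finite_induct)
  case empty
  show ?case using empty(1)[of \<i>] by simp
next
  case (insert j J)
  define n where "n = card J"
  have cJ: "card (insert j J) = Suc n"
    using insert by (simp add: n_def)
  define u' where "u' = (\<lambda>k. (of_nat (Suc n - k) * u k + of_nat (Suc k) * \<zeta> j * u (Suc k)) / of_nat (Suc n))"
  have nz: "(\<Sum>k\<le>card J. u' k * y ^ k) \<noteq> 0" if y: "Im y > 0" for y
  proof -
    define p where "p = (\<Sum>k\<le>Suc n. monom (u k) k)"
    have pp: "poly p y = (\<Sum>k\<le>Suc n. u k * y ^ k)" for y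
      by (simp add: p_def poly_sum poly_monom)
    have "pderiv p = (\<Sum>k\<le>n. monom (of_nat (Suc k) * u (Suc k)) k)"
      by (simp add: p_def pderiv_sum pderiv_add pderiv_monom sum.atMost_Suc_shift del: sum.atMost_Suc)
    then have pd: "poly (pderiv p) y = (\<Sum>k\<le>n. of_nat (Suc k) * u (Suc k) * y ^ k)"
      by (simp add: poly_sum poly_monom)
    have "of_nat (Suc n) * poly p y + (\<zeta> j - y) * poly (pderiv p) y \<noteq> 0"
    proof (rule Laguerre_half_plane)
      show "degree p \<le> Suc n"
        unfolding p_def by (intro degree_sum_le) (auto intro: order.trans[OF degree_monom_le])
      show "\<And>y. Im y > 0 \<Longrightarrow> poly p y \<noteq> 0"
        unfolding pp using insert.prems(1) cJ by simp
    qed (use y insert.prems in auto)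
    then have "(\<Sum>k\<le>n. (of_nat (Suc n - k) * u k + of_nat (Suc k) * \<zeta> j * u (Suc k)) * y ^ k) \<noteq> 0"
      unfolding polar_derivative_coeffs pp pd .
    moreover have "(\<Sum>k\<le>card J. u' k * y ^ k) =
        (\<Sum>k\<le>n. (of_nat (Suc n - k) * u k + of_nat (Suc k) * \<zeta> j * u (Suc k)) * y ^ k) / of_nat (Suc n)"
      unfolding u'_def n_def[symmetric] sum_divide_distrib by (simp only: times_divide_eq_left)
    moreover have "of_nat (Suc n) \<noteq> (0 :: complex)"
      by (rule of_nat_neq_0)
    ultimately show ?thesis
      by (metis divide_eq_0_iff)
  qed
  have "(\<Sum>S\<in>Pow J. u' (card S) / of_nat (card J choose card S) * (\<Prod>j\<in>S. \<zeta> j)) \<noteq> 0"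
    using insert.prems(2) by (intro insert.IH nz) auto
  \<comment> \<open>The absorption identities for binomials split each term into the contributions
    of the subsets \<open>S\<close> and \<open>insert j S\<close>.\<close>
  also have "(\<Sum>S\<in>Pow J. u' (card S) / of_nat (card J choose card S) * (\<Prod>j\<in>S. \<zeta> j)) =
    (\<Sum>S\<in>Pow J. u (card S) / of_nat (Suc n choose card S) * (\<Prod>j\<in>S. \<zeta> j)
      + u (Suc (card S)) / of_nat (Suc n choose Suc (card S)) * (\<zeta> j * (\<Prod>j\<in>S. \<zeta> j)))"
  proof (rule sum.cong[OF refl])
    fix S assume "S \<in> Pow J"
    then have cS: "card S \<le> n"
      using insert.hyps(1) by (auto simp: n_def card_mono)
    define k where "k = card S"
    have k: "k \<le> n" using cS by (simp add: k_def)
    have b0: "(of_nat (n choose k) :: complex) \<noteq> 0" "(of_nat (Suc n choose k) :: complex) \<noteq> 0"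
      "(of_nat (Suc n choose Suc k) :: complex) \<noteq> 0" "(of_nat (Suc n) :: complex) \<noteq> 0"
      using k by (simp_all only: of_nat_eq_0_iff binomial_eq_0_iff not_less Suc_le_mono le_SucI)
    have fr: "a / c / d = 1 / b" if "a * b = c * d" "b \<noteq> 0" "c \<noteq> 0" "d \<noteq> 0" for a b c d :: complex
      using that by (simp add: field_simps)
    have "of_nat ((Suc n - k) * (Suc n choose k)) = (of_nat (Suc n * (n choose k)) :: complex)"
      using binomial_absorb_comp[of "Suc n" k] by simp
    then have e1: "of_nat (Suc n - k) / of_nat (Suc n) / of_nat (n choose k) = (1 / of_nat (Suc n choose k) :: complex)"
      unfolding of_nat_mult using b0 by (intro fr)
    have "of_nat (Suc k * (Suc n choose Suc k)) = (of_nat (Suc n * (n choose k)) :: complex)"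
      by (simp only: Suc_times_binomial)
    then have e2: "of_nat (Suc k) / of_nat (Suc n) / of_nat (n choose k) = (1 / of_nat (Suc n choose Suc k) :: complex)"
      unfolding of_nat_mult using b0 by (intro fr)
    have "u' k / of_nat (n choose k) = of_nat (Suc n - k) / of_nat (Suc n) / of_nat (n choose k) * u k
        + of_nat (Suc k) / of_nat (Suc n) / of_nat (n choose k) * (\<zeta> j * u (Suc k))"
      by (simp add: u'_def add_divide_distrib del: of_nat_Suc)
    also have "\<dots> = u k / of_nat (Suc n choose k) + u (Suc k) / of_nat (Suc n choose Suc k) * \<zeta> j"
      unfolding e1 e2 by simp
    finally show "u' (card S) / of_nat (card J choose card S) * (\<Prod>j\<in>S. \<zeta> j) =
       u (card S) / of_nat (Suc n choose card S) * (\<Prod>j\<in>S. \<zeta> j)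
      + u (Suc (card S)) / of_nat (Suc n choose Suc (card S)) * (\<zeta> j * (\<Prod>j\<in>S. \<zeta> j))"
      unfolding k_def[symmetric] n_def[symmetric]
      by (simp only: distrib_right) (simp add: mult_ac)
  qed
  also have "\<dots> = (\<Sum>S\<in>Pow (insert j J). u (card S) / of_nat (card (insert j J) choose card S) * (\<Prod>j\<in>S. \<zeta> j))"
  proof -
    have inj: "inj_on (insert j) (Pow J)"
      using insert.hyps by (auto simp: inj_on_def)
    have fin: "finite S" "j \<notin> S" if "S \<in> Pow J" for S
      using that insert.hyps by (auto intro: finite_subset)
    have "(\<Sum>S\<in>insert j ` Pow J. u (card S) / of_nat (Suc n choose card S) * (\<Prod>j\<in>S. \<zeta> j)) =
      (\<Sum>S\<in>Pow J. u (Suc (card S)) / of_nat (Suc n choose Suc (card S)) * (\<zeta> j * (\<Prod>j\<in>S. \<zeta> j)))"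
      by (subst sum.reindex[OF inj], rule sum.cong) (auto simp: fin simp del: binomial_Suc_Suc)
    then show ?thesis
      unfolding cJ Pow_insert using insert.hyps
      by (subst sum.union_disjoint) (auto simp: sum.distrib)
  qed
  finally show ?case .
qed

section \<open>Zeros in a half-plane and Hurwitz' theorem\<close>

text \<open>Every zero lies in the open lower half-plane and is closer to \<open>- \<i>\<close> than
  to \<open>\<i>\<close>. The product over the zeros compares strictly because there is at least
  one.\<close>

lemma nonroot_upper_imp_norm_gt:
  fixes G :: "complex poly"
  assumes nz: "\<And>t. Im t \<ge> 0 \<Longrightarrow> poly G t \<noteq> 0" and deg: "degree G > 0"
  shows "norm (poly G (- \<i>)) < norm (poly G \<i>)"
proof -
  obtain r where p: "smult (lead_coeff G) (\<Prod>i<degree G. [:-r i, 1:]) = G"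
    using complex_poly_decompose' by blast
  note pd = p[symmetric]
  have lc: "lead_coeff G \<noteq> 0"
    using nz[of \<i>] by auto
  have r: "Im (r i) < 0" if "i < degree G" for i
  proof (rule ccontr)
    assume "\<not> Im (r i) < 0"
    then have "poly G (r i) \<noteq> 0" by (intro nz) auto
    then show False
      using that by (subst (asm) poly_linear_prod[OF pd]) auto
  qed
  have lt: "norm (-\<i> - r i) < norm (\<i> - r i)" if "i < degree G" for i
  proof -
    have "norm (-\<i> - r i) = norm (cnj (\<i> - cnj (r i)))" by simp
    also have "\<dots> = norm (\<i> - cnj (r i))" by (rule complex_mod_cnj)
    also have "\<dots> < norm (cnj \<i> - cnj (r i))"
      using r[OF that] by (intro norm_cnj_diff_gt) auto
    also have "\<dots> = norm (\<i> - r i)"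
      by (metis complex_cnj_diff complex_mod_cnj)
    finally show ?thesis .
  qed
  have "(\<Prod>i<degree G. norm (-\<i> - r i)) < (\<Prod>i<degree G. norm (\<i> - r i))"
      proof (rule prod_mono_strict[of 0])
    show "0 < norm (\<i> - r i)" if "i \<in> {..<degree G}" for i
      using r[of i] that by auto
  qed (use lt deg in \<open>auto intro: less_imp_le\<close>)
  then show ?thesis
    using lc by (simp add: poly_linear_prod[OF pd] norm_mult prod_norm)
qed

text \<open>Hurwitz' theorem as propagation of a zero of the limit at \<open>e = 0\<close>. A
  non-constant limit of zero-free functions is zero-free, and a constant one with a zero vanishes
  everywhere.\<close>

lemma Hurwitz_family:
  fixes f :: "real \<Rightarrow> complex \<Rightarrow> complex"
  assumes S: "open S" "connected S"
    and cont: "continuous_on ({0..1} \<times> S) (\<lambda>(e, s). f e s)"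
    and hol: "\<And>e. \<lbrakk>0 \<le> e; e \<le> 1\<rbrakk> \<Longrightarrow> f e holomorphic_on S"
    and nz: "\<And>e s. \<lbrakk>0 < e; e \<le> 1; s \<in> S\<rbrakk> \<Longrightarrow> f e s \<noteq> 0"
    and st: "s \<in> S" "t \<in> S" "f 0 s = 0"
  shows "f 0 t = 0"
proof (rule ccontr)
  assume t: "f 0 t \<noteq> 0"
  define F where "F = (\<lambda>n::nat. f (inverse (Suc n)))"
  have le1: "inverse (real (Suc n)) \<le> 1" for n
    by (simp add: field_simps)
  have "f 0 s \<noteq> 0"
  proof (rule Hurwitz_no_zeros[OF S, where \<F> = F and g = "f 0"])
    show "F n holomorphic_on S" for n
      unfolding F_def by (intro hol) (use le1 in auto)
    show "f 0 holomorphic_on S" by (intro hol) auto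
    show "\<not> f 0 constant_on S"
    proof
      assume "f 0 constant_on S"
      then obtain k where "\<forall>x\<in>S. f 0 x = k"
        by (auto simp: constant_on_def)
      with st t show False by metis
    qed
    show "F n z \<noteq> 0" if "z \<in> S" for n z
      unfolding F_def by (intro nz) (use le1 that in auto)
    show "uniform_limit K F (f 0) sequentially" if K: "compact K" "K \<subseteq> S" for K
    proof (rule uniform_limitI)
      fix \<epsilon> :: real assume \<epsilon>: "\<epsilon> > 0"
      \<comment> \<open>Compactness turns joint continuity in \<open>(e, s)\<close> into uniform
        convergence on \<open>K\<close> as \<open>e\<close> tends to 0.\<close>
      have "uniformly_continuous_on ({0..1} \<times> K) (\<lambda>(e, s). f e s)"
        using K by (intro compact_uniformly_continuous continuous_on_subset[OF cont] compact_Times) auto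
      then obtain \<delta> where \<delta>: "\<delta> > 0"
        and d: "\<And>x x'. \<lbrakk>x \<in> {0..1} \<times> K; x' \<in> {0..1} \<times> K; dist x' x < \<delta>\<rbrakk> \<Longrightarrow>
           dist ((\<lambda>(e, s). f e s) x') ((\<lambda>(e, s). f e s) x) < \<epsilon>"
        unfolding uniformly_continuous_on_def using \<epsilon> by metis
      have "\<forall>\<^sub>F n in sequentially. inverse (real (Suc n)) < \<delta>"
        using LIMSEQ_inverse_real_of_nat \<delta> by (rule order_tendstoD(2))
      then show "\<forall>\<^sub>F n in sequentially. \<forall>x\<in>K. dist (F n x) (f 0 x) < \<epsilon>"
      proof (rule eventually_mono, intro ballI)
        fix n x assume n: "inverse (real (Suc n)) < \<delta>" and x: "x \<in> K"
        have "dist (inverse (real (Suc n)), x) (0, x) < \<delta>"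
          using n by (simp add: dist_prod_def dist_real_def)
        then show "dist (F n x) (f 0 x) < \<epsilon>"
          using d[of "(0, x)" "(inverse (real (Suc n)), x)"] le1[of n] x by (simp add: F_def)
      qed
    qed
  qed (use st in auto)
  with st show False by simp
qed

section \<open>Contraction of stable bilinear pairings\<close>

definition self_pow :: "real \<Rightarrow> real" where
  "self_pow v = (if v = 0 then 1 else v powr v)"

lemma self_pow_pos: "v \<ge> 0 \<Longrightarrow> self_pow v > 0"
  by (simp add: self_pow_def)

text \<open>A multiaffine polynomial in two copies of the variables. Contracting pair
  \<open>i\<close> keeps the coefficients in which \<open>y i\<close> and \<open>z i\<close> occur
  both or not at all; after all contractions the diagonal sum of \<open>c\<close> remains.\<close>

definition pairing_poly ::
    "'i set \<Rightarrow> ('i set \<Rightarrow> 'i set \<Rightarrow> real) \<Rightarrow> ('i \<Rightarrow> 'a::real_field) \<Rightarrow> ('i \<Rightarrow> 'a) \<Rightarrow> 'a" where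
  "pairing_poly I c y z =
     (\<Sum>S\<in>Pow I. \<Sum>U\<in>Pow I. of_real (c S U) * (\<Prod>i\<in>S. y i) * (\<Prod>i\<in>U. z i))"

text \<open>Taking \<open>z\<close> from the lower half-planes makes the contraction set \<open>z = 1/y\<close> without changing
  the signs of the coefficients.\<close>

definition opposite_stable :: "'i set \<Rightarrow> ('i set \<Rightarrow> 'i set \<Rightarrow> real) \<Rightarrow> bool" where
  "opposite_stable I c \<longleftrightarrow>
     (\<forall>y z :: 'i \<Rightarrow> complex. (\<forall>i\<in>I. Im (y i) > 0 \<and> Im (z i) < 0) \<longrightarrow> pairing_poly I c y z \<noteq> 0) \<or>
     (\<forall>y z :: 'i \<Rightarrow> complex. (\<forall>i\<in>I. Im (y i) > 0 \<and> Im (z i) < 0) \<longrightarrow> pairing_poly I c y z = 0)"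

lemma sum_Pow_insert:
  assumes "finite I" "i \<notin> I"
  shows "(\<Sum>S\<in>Pow (insert i I). f S) = (\<Sum>S\<in>Pow I. f S + f (insert i S))"
proof -
  have inj: "inj_on (insert i) (Pow I)"
    using assms by (auto simp: inj_on_def)
  show ?thesis
    unfolding Pow_insert using assms
    by (subst sum.union_disjoint) (auto simp: sum.distrib sum.reindex[OF inj])
qed

lemma prod_insert_subset:
  assumes "finite I" "i \<notin> I" "S \<in> Pow I"
  shows "(\<Prod>j\<in>insert i S. y j) = y i * (\<Prod>j\<in>S. y j)"
  using assms by (intro prod.insert) (auto intro: finite_subset)

lemma pairing_poly_insert:
  assumes "finite I" "i \<notin> I"
  shows "pairing_poly (insert i I) c y z = pairing_poly I c y z
     + y i * pairing_poly I (\<lambda>S U. c (insert i S) U) y z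
     + z i * pairing_poly I (\<lambda>S U. c S (insert i U)) y z
     + y i * z i * pairing_poly I (\<lambda>S U. c (insert i S) (insert i U)) y z"
proof -
  have "pairing_poly (insert i I) c y z =
    (\<Sum>S\<in>Pow I. \<Sum>U\<in>Pow I. of_real (c S U) * (\<Prod>i\<in>S. y i) * (\<Prod>i\<in>U. z i)
      + y i * (of_real (c (insert i S) U) * (\<Prod>i\<in>S. y i) * (\<Prod>i\<in>U. z i))
      + z i * (of_real (c S (insert i U)) * (\<Prod>i\<in>S. y i) * (\<Prod>i\<in>U. z i))
      + y i * z i * (of_real (c (insert i S) (insert i U)) * (\<Prod>i\<in>S. y i) * (\<Prod>i\<in>U. z i)))"
    unfolding pairing_poly_def sum_Pow_insert[OF assms] sum.distrib[symmetric]
    by (intro sum.cong refl) (simp add: prod_insert_subset[OF assms] mult_ac)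
  then show ?thesis
    by (simp only: pairing_poly_def sum.distrib sum_distrib_left)
qed

lemma pairing_poly_cong:
  assumes "\<And>i. i \<in> I \<Longrightarrow> y i = y' i" "\<And>i. i \<in> I \<Longrightarrow> z i = z' i"
  shows "pairing_poly I c y z = pairing_poly I c y' z'"
proof -
  have "(\<Prod>i\<in>S. y i) = (\<Prod>i\<in>S. y' i)" "(\<Prod>i\<in>S. z i) = (\<Prod>i\<in>S. z' i)" if "S \<in> Pow I" for S
    using that assms by (auto intro!: prod.cong)
  then show ?thesis by (simp add: pairing_poly_def)
qed

lemma pairing_poly_fun_upd:
  assumes "finite I" "i \<notin> I"
  shows "pairing_poly (insert i I) c (y(i := a)) (z(i := b)) = pairing_poly I c y z
     + a * pairing_poly I (\<lambda>S U. c (insert i S) U) y z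
     + b * pairing_poly I (\<lambda>S U. c S (insert i U)) y z
     + a * b * pairing_poly I (\<lambda>S U. c (insert i S) (insert i U)) y z"
proof -
  have "pairing_poly I c (y(i := a)) (z(i := b)) = pairing_poly I c y z" for c
    using assms by (intro pairing_poly_cong) auto
  then show ?thesis
    by (simp add: pairing_poly_insert[OF assms])
qed

lemma pairing_poly_add:
  "pairing_poly I (\<lambda>S U. c S U + d S U) y z = pairing_poly I c y z + pairing_poly I d y z"
  by (simp add: pairing_poly_def algebra_simps sum.distrib)

lemma pairing_poly_of_real:
  "pairing_poly I c (\<lambda>i. of_real (y i)) (\<lambda>i. of_real (z i)) = of_real (pairing_poly I c y z)"
  by (simp add: pairing_poly_def)

lemma pairing_poly_nonneg:
  fixes y z :: "'i \<Rightarrow> real"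
  assumes "\<And>S U. \<lbrakk>S \<subseteq> I; U \<subseteq> I\<rbrakk> \<Longrightarrow> c S U \<ge> 0" "\<And>i. i \<in> I \<Longrightarrow> y i > 0" "\<And>i. i \<in> I \<Longrightarrow> z i > 0"
  shows "pairing_poly I c y z \<ge> 0"
  unfolding pairing_poly_def using assms
  by (intro sum_nonneg mult_nonneg_nonneg prod_nonneg) (auto, (meson less_imp_le subsetD)+)

lemma holomorphic_on_pairing_poly [holomorphic_intros]:
  assumes "\<And>i. (\<lambda>s. y s i) holomorphic_on A" "\<And>i. (\<lambda>s. z s i) holomorphic_on A"
  shows "(\<lambda>s. pairing_poly I c (y s) (z s)) holomorphic_on A"
  unfolding pairing_poly_def using assms by (intro holomorphic_intros) auto

lemma continuous_on_pairing_poly [continuous_intros]: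
  fixes y z :: "'b::topological_space \<Rightarrow> 'i \<Rightarrow> 'a::real_normed_field"
  assumes "\<And>i. continuous_on A (\<lambda>s. y s i)" "\<And>i. continuous_on A (\<lambda>s. z s i)"
  shows "continuous_on A (\<lambda>s. pairing_poly I c (y s) (z s))"
  unfolding pairing_poly_def using assms by (intro continuous_intros) auto

text \<open>On the curve \<open>z = 1/y\<close> the condition \<open>d = -a\<close> reduces the bilinear form to \<open>b * y + c / y\<close>,
  which has a zero in the closed half-plane; the degenerate cases use the room left by \<open>\<epsilon>\<close>.\<close>

lemma bilinear_nonvanishing_imp_contraction_nonzero:
  fixes a b c d :: complex
  assumes \<epsilon>: "\<epsilon> > 0"
    and nz: "\<And>y z. \<lbrakk>Im y > - \<epsilon>; Im z < \<epsilon>\<rbrakk> \<Longrightarrow> a + y * b + z * c + y * z * d \<noteq> 0"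
  shows "a + d \<noteq> 0"
proof
  assume "a + d = 0"
  then have d: "d = - a" by (simp add: add_eq_0_iff)
  have a: "a \<noteq> 0" using nz[of 0 0] \<epsilon> by simp
  consider "b \<noteq> 0" "c \<noteq> 0" | "b = 0" "c = 0" | "b \<noteq> 0" "c = 0" | "b = 0" "c \<noteq> 0" by blast
  then show False
  proof cases
    case 1
    \<comment> \<open>The square root of \<open>- c / b\<close> in the closed upper half-plane, a
      zero of \<open>y * b + c / y\<close>.\<close>
    define y where "y = (if Im (csqrt (- c / b)) \<ge> 0 then csqrt (- c / b) else - csqrt (- c / b))"
    have y2: "y * y = - c / b"
      by (simp add: y_def flip: power2_eq_square)
    then have y0: "y \<noteq> 0" using 1 by auto
    have Imy: "Im y \<ge> 0" by (simp add: y_def)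
    have "Im (1 / y) \<le> 0"
      using Imy by (simp add: Im_divide divide_nonpos_nonneg)
    then have "a + y * b + (1 / y) * c + y * (1 / y) * d \<noteq> 0"
      using Imy \<epsilon> by (intro nz) auto
    moreover have "(y * b + (1 / y) * c) * y = b * (y * y) + c"
      using y0 by (simp add: algebra_simps)
    then have "y * b + (1 / y) * c = 0"
      using y2 y0 1 by simp
    ultimately show False using y0 d by (simp add: algebra_simps)
  next
    case 2
    show False using nz[of 1 1] \<epsilon> d 2 by simp
  next
    case 3
    \<comment> \<open>Solving \<open>a + y * b - a * y * z = 0\<close> gives
      \<open>z = b / a + 1 / y\<close>. For \<open>y = \<i> * \<delta>\<close> with small
      \<open>\<delta>\<close> the term \<open>1 / y\<close> pushes \<open>z\<close> below the real
      axis.\<close>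
    define \<delta> where "\<delta> = min (\<epsilon> / 2) (1 / (\<bar>Im (b / a)\<bar> + 1))"
    have \<delta>: "\<delta> > 0" "\<delta> < \<epsilon>" using \<epsilon> by (auto simp: \<delta>_def)
    have "\<bar>Im (b / a)\<bar> + 1 \<le> 1 / \<delta>"
      using \<delta>(1) by (simp add: \<delta>_def field_simps min_def split: if_splits)
    then have "Im (b / a - \<i> / \<delta>) < \<epsilon>" using \<epsilon> by simp
    moreover have "Im (\<i> * \<delta>) > - \<epsilon>" using \<delta> \<epsilon> by simp
    ultimately have "a + (\<i> * \<delta>) * b + (b / a - \<i> / \<delta>) * c + (\<i> * \<delta>) * (b / a - \<i> / \<delta>) * d \<noteq> 0"
      by (intro nz)
    then show False using 3 d a \<delta> by (simp add: field_simps)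
  next
    case 4
    \<comment> \<open>The mirror image: \<open>z = - \<i> * \<delta>\<close> and
      \<open>y = c / a + 1 / z\<close>.\<close>
    define \<delta> where "\<delta> = min (\<epsilon> / 2) (1 / (\<bar>Im (c / a)\<bar> + 1))"
    have \<delta>: "\<delta> > 0" "\<delta> < \<epsilon>" using \<epsilon> by (auto simp: \<delta>_def)
    have "\<bar>Im (c / a)\<bar> + 1 \<le> 1 / \<delta>"
      using \<delta>(1) by (simp add: \<delta>_def field_simps min_def split: if_splits)
    then have "Im (c / a + \<i> / \<delta>) > - \<epsilon>" using \<epsilon> by simp
    moreover have "Im (- \<i> * \<delta>) < \<epsilon>" using \<delta> \<epsilon> by simp
    ultimately have "a + (c / a + \<i> / \<delta>) * b + (- \<i> * \<delta>) * c + (c / a + \<i> / \<delta>) * (- \<i> * \<delta>) * d \<noteq> 0"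
      by (intro nz)
    then show False using 4 d a \<delta> by (simp add: field_simps)
  qed
qed

text \<open>Moving \<open>y i\<close> up and \<open>z i\<close> down by \<open>e\<close> gives a
  bilinear form that is non-zero slightly beyond the half-planes, as
  \<open>bilinear_nonvanishing_imp_contraction_nonzero\<close> demands. The expression is
  \<open>a + d\<close> of this shifted form; at \<open>e = 0\<close> it is the contraction.\<close>

lemma pairing_poly_contraction_nonzero:
  fixes y z :: "'i \<Rightarrow> complex"
  assumes I: "finite I" "i \<notin> I" and e: "e > 0"
    and nz: "\<And>y z :: 'i \<Rightarrow> complex. (\<forall>j\<in>insert i I. Im (y j) > 0 \<and> Im (z j) < 0)
      \<Longrightarrow> pairing_poly (insert i I) c y z \<noteq> 0"
    and yz: "\<forall>j\<in>I. Im (y j) > 0 \<and> Im (z j) < 0"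
  shows "pairing_poly I c y z
     + \<i> * of_real e * pairing_poly I (\<lambda>S U. c (insert i S) U) y z
     - \<i> * of_real e * pairing_poly I (\<lambda>S U. c S (insert i U)) y z
     + of_real e ^ 2 * pairing_poly I (\<lambda>S U. c (insert i S) (insert i U)) y z
     + pairing_poly I (\<lambda>S U. c (insert i S) (insert i U)) y z \<noteq> 0"
proof (rule bilinear_nonvanishing_imp_contraction_nonzero[OF e,
      where b = "pairing_poly I (\<lambda>S U. c (insert i S) U) y z
        - \<i> * of_real e * pairing_poly I (\<lambda>S U. c (insert i S) (insert i U)) y z"
      and c = "pairing_poly I (\<lambda>S U. c S (insert i U)) y z
        + \<i> * of_real e * pairing_poly I (\<lambda>S U. c (insert i S) (insert i U)) y z"])
  fix u v assume uv: "Im u > - e" "Im v < e"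
  have "pairing_poly (insert i I) c (y(i := u + \<i> * e)) (z(i := v - \<i> * e)) \<noteq> 0"
    using uv yz I by (intro nz) auto
  then show "pairing_poly I c y z
     + \<i> * of_real e * pairing_poly I (\<lambda>S U. c (insert i S) U) y z
     - \<i> * of_real e * pairing_poly I (\<lambda>S U. c S (insert i U)) y z
     + of_real e ^ 2 * pairing_poly I (\<lambda>S U. c (insert i S) (insert i U)) y z
     + u * (pairing_poly I (\<lambda>S U. c (insert i S) U) y z
        - \<i> * of_real e * pairing_poly I (\<lambda>S U. c (insert i S) (insert i U)) y z)
     + v * (pairing_poly I (\<lambda>S U. c S (insert i U)) y z
        + \<i> * of_real e * pairing_poly I (\<lambda>S U. c (insert i S) (insert i U)) y z)
     + u * v * pairing_poly I (\<lambda>S U. c (insert i S) (insert i U)) y z \<noteq> 0"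
    unfolding pairing_poly_fun_upd[OF I] by (simp add: algebra_simps power2_eq_square)
qed

text \<open>On the complex line through two points, stability becomes a one-variable matter; the
  parameters that stay inside the half-planes form a domain for Hurwitz' theorem.\<close>

lemma half_planes_line:
  fixes y0 y1 z0 z1 :: "'i \<Rightarrow> complex"
  assumes "finite I"
  defines "S \<equiv> {s. \<forall>j\<in>I. Im (y0 j + s * (y1 j - y0 j)) > 0 \<and> Im (z0 j + s * (z1 j - z0 j)) < 0}"
  shows "open S" "convex S"
proof -
  have S: "S = (\<Inter>j\<in>I. {s. Im (y0 j + s * (y1 j - y0 j)) > 0} \<inter> {s. Im (z0 j + s * (z1 j - z0 j)) < 0})"
    by (auto simp: S_def)
  have op: "open {s. Im (a + s * b) > 0}" "open {s. Im (a + s * b) < 0}" for a b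
    by (intro open_Collect_less continuous_intros)+
  then show "open S"
    unfolding S by (intro open_INT assms(1) ballI open_Int op)
  have lin: "linear (\<lambda>s. Im (s * b))" for b
    by (rule linearI) (auto simp: algebra_simps)
  have "{s. Im (a + s * b) > 0} = (\<lambda>s. Im (s * b)) -` {- Im a<..}"
    "{s. Im (a + s * b) < 0} = (\<lambda>s. Im (s * b)) -` {..<- Im a}" for a b
    by auto
  then have "convex {s. Im (a + s * b) > 0}" "convex {s. Im (a + s * b) < 0}" for a b
    using convex_linear_vimage[OF lin] by (simp_all only: convex_real_interval)
  then show "convex S"
    unfolding S by (intro convex_INT convex_Int)
qed

text \<open>The Lieb-Sokal step. The shifted contractions are zero-free for \<open>e > 0\<close>, so
  by Hurwitz a single zero of the limit spreads along complex lines to the whole region. An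
  identically vanishing polynomial contracts to an identically vanishing one.\<close>

lemma opposite_stable_contraction:
  assumes I: "finite I" "i \<notin> I" and st: "opposite_stable (insert i I) c"
  shows "opposite_stable I (\<lambda>S U. c S U + c (insert i S) (insert i U))"
proof (cases "\<forall>y z :: 'a \<Rightarrow> complex. (\<forall>j\<in>insert i I. Im (y j) > 0 \<and> Im (z j) < 0)
    \<longrightarrow> pairing_poly (insert i I) c y z \<noteq> 0")
  case True
  then have nz: "\<And>y z :: 'a \<Rightarrow> complex. (\<forall>j\<in>insert i I. Im (y j) > 0 \<and> Im (z j) < 0)
      \<Longrightarrow> pairing_poly (insert i I) c y z \<noteq> 0"
    by blast
  show ?thesis
  proof (cases "\<exists>y0 z0 :: 'a \<Rightarrow> complex. (\<forall>j\<in>I. Im (y0 j) > 0 \<and> Im (z0 j) < 0) \<and>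
      pairing_poly I (\<lambda>S U. c S U + c (insert i S) (insert i U)) y0 z0 = 0")
    case True
    then obtain y0 z0 :: "'a \<Rightarrow> complex" where 0: "\<forall>j\<in>I. Im (y0 j) > 0 \<and> Im (z0 j) < 0"
      "pairing_poly I (\<lambda>S U. c S U + c (insert i S) (insert i U)) y0 z0 = 0" by blast
    have "pairing_poly I (\<lambda>S U. c S U + c (insert i S) (insert i U)) y1 z1 = 0"
      if 1: "\<forall>j\<in>I. Im (y1 j) > 0 \<and> Im (z1 j) < 0" for y1 z1 :: "'a \<Rightarrow> complex"
    proof -
      define Y where "Y = (\<lambda>s j. y0 j + s * (y1 j - y0 j))"
      define Z where "Z = (\<lambda>s j. z0 j + s * (z1 j - z0 j))"
      define S where "S = {s. \<forall>j\<in>I. Im (y0 j + s * (y1 j - y0 j)) > 0 \<and> Im (z0 j + s * (z1 j - z0 j)) < 0}"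
      have S: "open S" "connected S"
        unfolding S_def using half_planes_line[OF I(1)] convex_connected by blast+
      \<comment> \<open>The parameters \<open>s = 0\<close> and \<open>s = 1\<close> correspond to
        \<open>(y0, z0)\<close> and \<open>(y1, z1)\<close>.\<close>
      define f where "f = (\<lambda>e s. pairing_poly I c (Y s) (Z s)
         + \<i> * of_real e * pairing_poly I (\<lambda>S U. c (insert i S) U) (Y s) (Z s)
         - \<i> * of_real e * pairing_poly I (\<lambda>S U. c S (insert i U)) (Y s) (Z s)
         + of_real e ^ 2 * pairing_poly I (\<lambda>S U. c (insert i S) (insert i U)) (Y s) (Z s)
         + pairing_poly I (\<lambda>S U. c (insert i S) (insert i U)) (Y s) (Z s))"
      have f0: "f 0 s = pairing_poly I (\<lambda>S U. c S U + c (insert i S) (insert i U)) (Y s) (Z s)" for s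
        by (simp add: f_def pairing_poly_add)
      have "f 0 1 = 0"
      proof (rule Hurwitz_family[OF S, of f 0])
        show "continuous_on ({0..1} \<times> S) (\<lambda>(e, s). f e s)"
          unfolding f_def Y_def Z_def case_prod_beta by (intro continuous_intros)
        show "f e holomorphic_on S" for e
          unfolding f_def Y_def Z_def by (intro holomorphic_intros)
        show "f e s \<noteq> 0" if "0 < e" "s \<in> S" for e s
          unfolding f_def
          by (rule pairing_poly_contraction_nonzero[OF I that(1) nz]) (use that in \<open>auto simp: S_def Y_def Z_def\<close>)
        show "f 0 0 = 0"
          unfolding f0 using 0 by (simp add: Y_def Z_def)
      qed (use 0 1 in \<open>auto simp: S_def\<close>)
      then show ?thesis
        unfolding f0 by (simp add: Y_def Z_def)
    qed
    then show ?thesis by (auto simp: opposite_stable_def)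
  qed (auto simp: opposite_stable_def)
next
  case False
  then have z: "\<And>y z :: 'a \<Rightarrow> complex. (\<forall>j\<in>insert i I. Im (y j) > 0 \<and> Im (z j) < 0)
      \<Longrightarrow> pairing_poly (insert i I) c y z = 0"
    using st unfolding opposite_stable_def by blast
  have "pairing_poly I (\<lambda>S U. c S U + c (insert i S) (insert i U)) y z = 0"
    if yz: "\<forall>j\<in>I. Im (y j) > 0 \<and> Im (z j) < 0" for y z :: "'a \<Rightarrow> complex"
  proof -
    define p where "p = pairing_poly I c y z"
    define q where "q = pairing_poly I (\<lambda>S U. c (insert i S) U) y z"
    define r where "r = pairing_poly I (\<lambda>S U. c S (insert i U)) y z"
    define t where "t = pairing_poly I (\<lambda>S U. c (insert i S) (insert i U)) y z"
    have *: "p + u * q + v * r + u * v * t = 0" if "Im u > 0" "Im v < 0" for u v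
      using z[of "y(i := u)" "z(i := v)"] that yz I
      unfolding pairing_poly_fun_upd[OF I] p_def q_def r_def t_def by auto
    have e: "p + \<i> * q - \<i> * r + t = 0" "p + 2 * \<i> * q - \<i> * r + 2 * t = 0"
      "p + \<i> * q - 2 * \<i> * r + 2 * t = 0" "p + 2 * \<i> * q - 2 * \<i> * r + 4 * t = 0"
      using *[of "\<i>" "-\<i>"] *[of "2 * \<i>" "-\<i>"] *[of "\<i>" "-2 * \<i>"] *[of "2 * \<i>" "-2 * \<i>"]
      by (simp_all add: algebra_simps)
    have "p + t = 4 * (p + \<i> * q - \<i> * r + t) - 2 * (p + 2 * \<i> * q - \<i> * r + 2 * t)
      - 2 * (p + \<i> * q - 2 * \<i> * r + 2 * t) + (p + 2 * \<i> * q - 2 * \<i> * r + 4 * t)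
      + (p + \<i> * q - \<i> * r + t) - (p + 2 * \<i> * q - \<i> * r + 2 * t)
      - (p + \<i> * q - 2 * \<i> * r + 2 * t) + (p + 2 * \<i> * q - 2 * \<i> * r + 4 * t)"
      by (simp add: algebra_simps)
    then have "p + t = 0" unfolding e by simp
    then show ?thesis by (simp add: pairing_poly_add p_def t_def)
  qed
  then show ?thesis by (auto simp: opposite_stable_def)
qed

text \<open>With \<open>y i = \<i>\<close> the polynomial is affine in \<open>z i\<close>, with zero
  \<open>v = - (a + \<i> * b) / (r + \<i> * d)\<close>. Stability forbids \<open>Im v < 0\<close>,
  which says \<open>Im ((a + \<i> * b) * cnj (r + \<i> * d)) \<le> 0\<close>. As the other arguments
  tend to the real axis this becomes \<open>b * r \<le> a * d\<close>.\<close>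

lemma opposite_stable_imp_rayleigh:
  fixes y z :: "'i \<Rightarrow> real"
  assumes I: "finite I" "i \<notin> I" and st: "opposite_stable (insert i I) c"
  shows "pairing_poly I (\<lambda>S U. c (insert i S) U) y z * pairing_poly I (\<lambda>S U. c S (insert i U)) y z
    \<le> pairing_poly I c y z * pairing_poly I (\<lambda>S U. c (insert i S) (insert i U)) y z"
proof -
  define Y where "Y = (\<lambda>e j. complex_of_real (y j) + \<i> * complex_of_real e)"
  define Z where "Z = (\<lambda>e j. complex_of_real (z j) - \<i> * complex_of_real e)"
  define a where "a = (\<lambda>e. pairing_poly I c (Y e) (Z e))"
  define b where "b = (\<lambda>e. pairing_poly I (\<lambda>S U. c (insert i S) U) (Y e) (Z e))"
  define r where "r = (\<lambda>e. pairing_poly I (\<lambda>S U. c S (insert i U)) (Y e) (Z e))"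
  define d where "d = (\<lambda>e. pairing_poly I (\<lambda>S U. c (insert i S) (insert i U)) (Y e) (Z e))"
  define g where "g = (\<lambda>e. Im ((a e + \<i> * b e) * cnj (r e + \<i> * d e)))"
  have pos: "g e \<le> 0" if e: "e > 0" for e
  proof (rule ccontr)
    assume g: "\<not> g e \<le> 0"
    have nz: "r e + \<i> * d e \<noteq> 0"
    proof
      assume "r e + \<i> * d e = 0"
      then have "g e = 0" by (simp only: g_def) simp
      with g show False by simp
    qed
    have ex: "pairing_poly (insert i I) c ((Y e)(i := \<i>)) ((Z e)(i := v)) =
        (a e + \<i> * b e) + v * (r e + \<i> * d e)" for v
      by (simp add: pairing_poly_fun_upd[OF I] a_def b_def r_def d_def algebra_simps)
    have reg: "\<forall>j\<in>insert i I. Im (((Y e)(i := \<i>)) j) > 0 \<and> Im (((Z e)(i := v)) j) < 0" if "Im v < 0" for v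
      using that e by (auto simp: Y_def Z_def)
    define v where "v = - (a e + \<i> * b e) / (r e + \<i> * d e)"
    have "v = - ((a e + \<i> * b e) * cnj (r e + \<i> * d e)) / of_real ((norm (r e + \<i> * d e))\<^sup>2)"
      unfolding v_def by (subst complex_div_cnj) (simp only: mult_minus_left of_real_power)
    then have "Im v = - g e / (norm (r e + \<i> * d e))\<^sup>2"
      unfolding g_def by (metis Im_divide_of_real uminus_complex.sel(2))
    then have v: "Im v < 0"
      using g nz by (simp add: divide_neg_pos)
    have "(a e + \<i> * b e) + v * (r e + \<i> * d e) = 0"
      using nz by (simp add: v_def)
    then have "pairing_poly (insert i I) c ((Y e)(i := \<i>)) ((Z e)(i := v)) = 0"
      by (simp only: ex)
    then have "\<not> (\<forall>y z :: 'i \<Rightarrow> complex. (\<forall>j\<in>insert i I. Im (y j) > 0 \<and> Im (z j) < 0)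
        \<longrightarrow> pairing_poly (insert i I) c y z \<noteq> 0)"
      using reg[OF v] by metis
    then have all: "\<forall>y z :: 'i \<Rightarrow> complex. (\<forall>j\<in>insert i I. Im (y j) > 0 \<and> Im (z j) < 0)
        \<longrightarrow> pairing_poly (insert i I) c y z = 0"
      using st by (simp only: opposite_stable_def simp_thms)
    have z: "(a e + \<i> * b e) + v * (r e + \<i> * d e) = 0" if "Im v < 0" for v
      unfolding ex[symmetric] using all[THEN spec, THEN spec, THEN mp, OF reg[OF that]] .
    \<comment> \<open>In the identically vanishing case the slope in \<open>v\<close>, which is
      \<open>r e + \<i> * d e\<close>, is 0 as well.\<close>
    have "\<i> * (r e + \<i> * d e) = ((a e + \<i> * b e) + (-\<i>) * (r e + \<i> * d e))
        - ((a e + \<i> * b e) + (-2*\<i>) * (r e + \<i> * d e))"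
      by (simp add: algebra_simps)
    also have "\<dots> = 0"
      using z[of "-\<i>"] z[of "-2*\<i>"] by simp
    finally have "r e + \<i> * d e = 0" by (simp only: mult_eq_0_iff complex_i_not_zero simp_thms)
    with nz show False by simp
  qed
  have "continuous_on UNIV g"
    unfolding g_def a_def b_def r_def d_def Y_def Z_def by (intro continuous_intros)
  then have "isCont g 0"
    by (simp add: continuous_on_eq_continuous_at)
  then have "(g \<longlongrightarrow> g 0) (at_right 0)"
    unfolding isCont_def by (rule tendsto_within_subset) simp
  moreover have "\<forall>\<^sub>F e in at_right 0. g e \<le> 0"
    using eventually_at_right_less[of 0] by (rule eventually_mono) (rule pos)
  ultimately have "g 0 \<le> 0"
    by (rule tendsto_upperbound) simp
  moreover have "a 0 = of_real (pairing_poly I c y z)"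
    "b 0 = of_real (pairing_poly I (\<lambda>S U. c (insert i S) U) y z)"
    "r 0 = of_real (pairing_poly I (\<lambda>S U. c S (insert i U)) y z)"
    "d 0 = of_real (pairing_poly I (\<lambda>S U. c (insert i S) (insert i U)) y z)"
    by (simp_all add: a_def b_def r_def d_def Y_def Z_def pairing_poly_of_real)
  ultimately show ?thesis
    by (simp add: g_def algebra_simps)
qed


section \<open>Capacity loss in the contraction of pairs\<close>

definition contraction_const :: "real \<Rightarrow> real" where
  "contraction_const t = self_pow t * self_pow (1 - t)"

lemma contraction_const_nonneg: "\<lbrakk>0 \<le> t; t \<le> 1\<rbrakk> \<Longrightarrow> contraction_const t \<ge> 0"
  by (simp add: contraction_const_def self_pow_def)

text \<open>Balancing \<open>y * b = z * c\<close> under \<open>y * z = s\<^sup>2\<close>, the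
  Rayleigh inequality bounds the form by the square of \<open>sqrt a + s * sqrt d\<close>. At the
  optimal \<open>s\<close> the hypothesis becomes a weighted geometric mean of
  \<open>a / (1 - t)\<close> and \<open>d / t\<close>, which Young's inequality bounds by
  \<open>a + d\<close>.\<close>

lemma bilinear_capacity_bound_interior:
  fixes a b c d :: real
  assumes pos: "a > 0" "b > 0" "c > 0" "d > 0" and ray: "b * c \<le> a * d"
    and t: "0 < t" "t < 1"
    and cap: "\<And>y z. \<lbrakk>y > 0; z > 0\<rbrakk> \<Longrightarrow> K * (y * z) powr t \<le> a + y * b + z * c + y * z * d"
  shows "K * contraction_const t \<le> a + d"
proof -
  \<comment> \<open>The critical point of
    \<open>(sqrt a + s * sqrt d)\<^sup>2 / s powr (2 * t)\<close>.\<close>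
  define s where "s = t * sqrt a / ((1 - t) * sqrt d)"
  have s: "s > 0" using pos t by (simp add: s_def)
  define y where "y = s * sqrt (c / b)"
  define z where "z = s * sqrt (b / c)"
  have yz0: "y > 0" "z > 0" using s pos by (auto simp: y_def z_def)
  have "sqrt (c / b) * sqrt (b / c) = 1"
    using pos by (simp flip: real_sqrt_mult)
  then have yz: "y * z = s\<^sup>2"
    by (simp add: y_def z_def power2_eq_square)
  have "sqrt (u / v) * v = sqrt (u * v)" if "v > 0" for u v
  proof -
    have "sqrt (u * v) = sqrt (u / v * v\<^sup>2)"
      using that by (simp add: power2_eq_square)
    also have "\<dots> = sqrt (u / v) * v"
      using that by (subst real_sqrt_mult) simp
    finally show ?thesis by simp
  qed
  then have "sqrt (c / b) * b = sqrt (b * c)" "sqrt (b / c) * c = sqrt (b * c)"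
    using pos by (simp_all add: mult.commute)
  then have "y * b + z * c = 2 * s * sqrt (b * c)"
    by (simp add: y_def z_def mult.assoc)
  also have "\<dots> \<le> 2 * s * sqrt (a * d)"
    using ray s by simp
  finally have bc: "y * b + z * c \<le> 2 * s * (sqrt a * sqrt d)"
    by (simp add: real_sqrt_mult)
  have sd: "s * sqrt d = t * sqrt a / (1 - t)"
    using pos t by (simp add: s_def)
  have "K * (s\<^sup>2) powr t \<le> a + y * b + z * c + y * z * d"
    using cap[OF yz0] by (simp add: yz)
  also have "\<dots> \<le> a + 2 * s * (sqrt a * sqrt d) + s\<^sup>2 * d"
    using bc by (simp add: yz)
  also have "\<dots> = (sqrt a + s * sqrt d)\<^sup>2"
    using pos by (simp add: power2_sum power_mult_distrib)
  also have "sqrt a + s * sqrt d = sqrt a / (1 - t)"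
    unfolding sd using t by (simp add: field_simps)
  also have "(sqrt a / (1 - t))\<^sup>2 = a / (1 - t)\<^sup>2"
    using pos by (simp add: power_divide)
  finally have K: "K * (s\<^sup>2) powr t \<le> a / (1 - t)\<^sup>2" .
  define A where "A = a / (1 - t)"
  define D where "D = d / t"
  have AD: "A > 0" "D > 0" using pos t by (auto simp: A_def D_def)
  have s2: "s\<^sup>2 = (t / (1 - t)) * (A / D)"
    using pos t by (simp add: s_def A_def D_def power_divide power_mult_distrib power2_eq_square field_simps)
  have "K * contraction_const t = K * (s\<^sup>2) powr t * (contraction_const t / (s\<^sup>2) powr t)"
    using s by simp
  also have "\<dots> \<le> a / (1 - t)\<^sup>2 * (contraction_const t / (s\<^sup>2) powr t)"
    using K t by (intro mult_right_mono) (auto simp: contraction_const_nonneg)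
  also have "\<dots> = A powr (1 - t) * D powr t"
  proof -
    have alg: "A / u * (x * (u / v) / (x / v * (p / q))) = A / p * q"
      if "u > 0" "x > 0" "v > 0" "p > 0" "q > 0" for u x v p q
      using that by (simp add: field_simps)
    have c: "contraction_const t = t powr t * (1 - t) powr (1 - t)"
      using t by (simp add: contraction_const_def self_pow_def)
    have s: "(s\<^sup>2) powr t = t powr t / (1 - t) powr t * (A powr t / D powr t)"
      unfolding s2 using t AD by (simp add: powr_mult powr_divide)
    have a: "a / (1 - t)\<^sup>2 = A / (1 - t)"
      by (simp add: A_def power2_eq_square)
    have A: "A powr (1 - t) = A / A powr t" "(1 - t) powr (1 - t) = (1 - t) / (1 - t) powr t"
      using AD t by (simp_all add: powr_diff)
    show ?thesis
      unfolding c s a A by (rule alg) (use t AD in auto)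
  qed
  also have "\<dots> \<le> (1 - t) * A + t * D"
    using t AD by (intro Youngs_inequality_0) auto
  also have "\<dots> = a + d"
    using t by (simp add: A_def D_def)
  finally show ?thesis .
qed

lemma bilinear_capacity_bound_zero:
  fixes a b c d :: real
  assumes nn: "a \<ge> 0" "b \<ge> 0" "c \<ge> 0" "d \<ge> 0"
    and cap: "\<And>y z. \<lbrakk>y > 0; z > 0\<rbrakk> \<Longrightarrow> K \<le> a + y * b + z * c + y * z * d"
  shows "K \<le> a"
proof -
  have "((\<lambda>e. a + e * b + e * c + e * e * d) \<longlongrightarrow> a + 0 * b + 0 * c + 0 * 0 * d) (at_right 0)"
    by (intro tendsto_intros)
  then have "((\<lambda>e. a + e * b + e * c + e * e * d) \<longlongrightarrow> a) (at_right 0)"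
    by simp
  moreover have "\<forall>\<^sub>F e in at_right 0. K \<le> a + e * b + e * c + e * e * d"
    using eventually_at_right_less[of 0] by (rule eventually_mono) (rule cap)
  ultimately show ?thesis
    by (rule tendsto_lowerbound) simp
qed

text \<open>The positive case is applied to \<open>a + \<epsilon>\<close>, \<open>d + \<epsilon>\<close> and \<open>b + \<delta>\<close>, \<open>c + \<delta>\<close> with \<open>\<delta>\<close> so small
  that the Rayleigh inequality survives.\<close>

lemma bilinear_capacity_bound:
  fixes a b c d :: real
  assumes nn: "a \<ge> 0" "b \<ge> 0" "c \<ge> 0" "d \<ge> 0" and ray: "b * c \<le> a * d"
    and t: "0 \<le> t" "t \<le> 1"
    and cap: "\<And>y z. \<lbrakk>y > 0; z > 0\<rbrakk> \<Longrightarrow> K * (y * z) powr t \<le> a + y * b + z * c + y * z * d"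
  shows "K * contraction_const t \<le> a + d"
proof -
  consider "t = 0" | "t = 1" | "0 < t" "t < 1" using t by linarith
  then show ?thesis
  proof cases
    case 1
    have "K \<le> a"
      using cap 1 by (intro bilinear_capacity_bound_zero[OF nn]) simp
    then show ?thesis using 1 nn by (simp add: contraction_const_def self_pow_def)
  next
    case 2
    \<comment> \<open>The substitution of \<open>1 / z\<close> for \<open>y\<close> and
      \<open>1 / y\<close> for \<open>z\<close> exchanges \<open>a\<close> and \<open>d\<close>,
      keeps \<open>b\<close> and \<open>c\<close> in place, and reduces to exponent 0.\<close>
    have "K \<le> d"
    proof (rule bilinear_capacity_bound_zero)
      fix y z :: real assume yz: "y > 0" "z > 0"
      have "K * (1 / z * (1 / y)) \<le> a + (1 / z) * b + (1 / y) * c + (1 / z) * (1 / y) * d"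
        using cap[of "1 / z" "1 / y"] yz 2 by simp
      then have "K * (1 / z * (1 / y)) * (y * z)
          \<le> (a + (1 / z) * b + (1 / y) * c + (1 / z) * (1 / y) * d) * (y * z)"
        using yz by (intro mult_right_mono) auto
      also have "\<dots> = d + y * b + z * c + y * z * a"
        using yz by (simp add: field_simps)
      finally show "K \<le> d + y * b + z * c + y * z * a"
        using yz by simp
    qed (use nn in auto)
    then show ?thesis using 2 nn by (simp add: contraction_const_def self_pow_def)
  next
    case 3
    have le: "K * contraction_const t \<le> a + d + 2 * e" if e: "0 < e" "e < 1" for e
    proof -
      define \<delta> where "\<delta> = e\<^sup>2 / (b + c + 1)"
      have \<delta>: "\<delta> > 0" using e nn by (simp add: \<delta>_def add_nonneg_pos)
      have "e\<^sup>2 \<le> 1" using e by (simp add: power_le_one)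
      then have "\<delta> \<le> 1" using e nn by (simp add: \<delta>_def divide_le_eq)
      then have "\<delta> * (b + c + \<delta>) \<le> \<delta> * (b + c + 1)"
        using \<delta> by (intro mult_left_mono) auto
      also have "\<dots> = e\<^sup>2" using nn by (simp add: \<delta>_def)
      finally have \<delta>e: "\<delta> * (b + c + \<delta>) \<le> e\<^sup>2" .
      have "K * contraction_const t \<le> (a + e) + (d + e)"
      proof (rule bilinear_capacity_bound_interior)
        have "(b + \<delta>) * (c + \<delta>) = b * c + \<delta> * (b + c + \<delta>)" by (simp add: algebra_simps)
        also have "\<dots> \<le> a * d + e\<^sup>2" using ray \<delta>e by simp
        also have "\<dots> \<le> a * d + e\<^sup>2 + e * (a + d)" using e nn by simp
        also have "\<dots> = (a + e) * (d + e)" by (simp add: algebra_simps power2_eq_square)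
        finally show "(b + \<delta>) * (c + \<delta>) \<le> (a + e) * (d + e)" .
        fix y z :: real assume yz: "y > 0" "z > 0"
        have "K * (y * z) powr t \<le> a + y * b + z * c + y * z * d"
          using cap[OF yz] .
        also have "\<dots> \<le> (a + e) + y * (b + \<delta>) + z * (c + \<delta>) + y * z * (d + e)"
          using e \<delta> yz by (intro add_mono mult_left_mono) auto
        finally show "K * (y * z) powr t \<le> (a + e) + y * (b + \<delta>) + z * (c + \<delta>) + y * z * (d + e)" .
      qed (use nn e \<delta> 3 in auto)
      then show ?thesis by simp
    qed
    have "((\<lambda>e. a + d + 2 * e) \<longlongrightarrow> a + d + 2 * 0) (at_right 0)"
      by (intro tendsto_intros)
    then have "((\<lambda>e. a + d + 2 * e) \<longlongrightarrow> a + d) (at_right 0)"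
      by simp
    moreover have "eventually (\<lambda>e. K * contraction_const t \<le> a + d + 2 * e) (at_right 0)"
      unfolding eventually_at_right_field using le by (intro exI[of _ 1]) auto
    ultimately show ?thesis
      by (rule tendsto_lowerbound) simp
  qed
qed

text \<open>Induction on the pairs. With the remaining variables fixed at positive values the
  polynomial is bilinear in the pair \<open>i\<close> and satisfies Rayleigh, so contracting the
  pair replaces \<open>K\<close> by \<open>K * contraction_const (t i)\<close> and keeps the
  hypotheses.\<close>

theorem pairing_capacity_bound:
  assumes "finite I" "\<And>S U. \<lbrakk>S \<subseteq> I; U \<subseteq> I\<rbrakk> \<Longrightarrow> c S U \<ge> 0" "opposite_stable I c"
    and "\<And>i. i \<in> I \<Longrightarrow> 0 \<le> t i \<and> t i \<le> 1"
    and "\<And>y z :: 'i \<Rightarrow> real. (\<And>i. i \<in> I \<Longrightarrow> y i > 0 \<and> z i > 0) \<Longrightarrow>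
      K * (\<Prod>i\<in>I. (y i * z i) powr t i) \<le> pairing_poly I c y z"
  shows "K * (\<Prod>i\<in>I. contraction_const (t i)) \<le> (\<Sum>S\<in>Pow I. c S S)"
  using assms
proof (induction I arbitrary: c K rule: finite_induct)
  case empty
  then show ?case by (simp add: pairing_poly_def)
next
  case (insert i I)
  let ?c = "\<lambda>S U. c S U + c (insert i S) (insert i U)"
  have "(K * contraction_const (t i)) * (\<Prod>i\<in>I. contraction_const (t i)) \<le> (\<Sum>S\<in>Pow I. ?c S S)"
  proof (rule insert.IH[of ?c])
    show "0 \<le> ?c S U" if "S \<subseteq> I" "U \<subseteq> I" for S U
      by (intro add_nonneg_nonneg insert.prems(1)) (use that in auto)
    show "opposite_stable I ?c"
      using insert.hyps insert.prems(2) by (rule opposite_stable_contraction)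
    fix y z :: "'i \<Rightarrow> real" assume yz: "\<And>j. j \<in> I \<Longrightarrow> y j > 0 \<and> z j > 0"
    let ?P = "\<Prod>j\<in>I. (y j * z j) powr t j"
    have "K * ?P * contraction_const (t i) \<le> pairing_poly I c y z
        + pairing_poly I (\<lambda>S U. c (insert i S) (insert i U)) y z"
    proof (rule bilinear_capacity_bound[where b = "pairing_poly I (\<lambda>S U. c (insert i S) U) y z"
          and c = "pairing_poly I (\<lambda>S U. c S (insert i U)) y z"])
      show "pairing_poly I (\<lambda>S U. c (insert i S) U) y z * pairing_poly I (\<lambda>S U. c S (insert i U)) y z
        \<le> pairing_poly I c y z * pairing_poly I (\<lambda>S U. c (insert i S) (insert i U)) y z"
        using insert.hyps insert.prems(2) by (rule opposite_stable_imp_rayleigh)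
      fix u v :: real assume uv: "u > 0" "v > 0"
      have "K * (\<Prod>j\<in>insert i I. ((y(i := u)) j * (z(i := v)) j) powr t j)
          \<le> pairing_poly (insert i I) c (y(i := u)) (z(i := v))"
        using uv yz by (intro insert.prems(4)) auto
      also have "(\<Prod>j\<in>insert i I. ((y(i := u)) j * (z(i := v)) j) powr t j) = (u * v) powr t i * ?P"
        using insert.hyps by (auto intro!: prod.cong)
      finally show "K * ?P * (u * v) powr t i \<le> pairing_poly I c y z
           + u * pairing_poly I (\<lambda>S U. c (insert i S) U) y z
           + v * pairing_poly I (\<lambda>S U. c S (insert i U)) y z
           + u * v * pairing_poly I (\<lambda>S U. c (insert i S) (insert i U)) y z"
        unfolding pairing_poly_fun_upd[OF insert.hyps(1,2)] by (simp add: mult_ac)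
    qed (use insert.prems(3) yz in \<open>auto intro!: pairing_poly_nonneg insert.prems(1)\<close>)
    then show "K * contraction_const (t i) * ?P \<le> pairing_poly I ?c y z"
      by (simp add: pairing_poly_add mult_ac)
  qed (use insert.prems(3) in auto)
  also have "\<dots> = (\<Sum>S\<in>Pow (insert i I). c S S)"
    by (rule sum_Pow_insert[OF insert.hyps(1,2), symmetric])
  finally show ?case
    using insert.hyps by (simp add: mult.assoc)
qed

section \<open>Polarization\<close>

lemma prod_sum_atMost_vec:
  fixes f :: "'n::finite \<Rightarrow> nat \<Rightarrow> 'a::comm_semiring_1"
  shows "(\<Prod>k\<in>UNIV. \<Sum>m\<le>l $ k. f k m) = (\<Sum>\<mu>\<in>{..l}. \<Prod>k\<in>UNIV. f k (\<mu> $ k))"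
proof -
  have "(\<Prod>k\<in>UNIV. \<Sum>m\<le>l $ k. f k m) = (\<Sum>g\<in>PiE UNIV (\<lambda>k. {..l $ k}). \<Prod>k\<in>UNIV. f k (g k))"
    by (rule prod_sum_PiE) auto
  also have "\<dots> = (\<Sum>\<mu>\<in>{..l}. \<Prod>k\<in>UNIV. f k (\<mu> $ k))"
    by (rule sum.reindex_bij_witness[where i = vec_nth and j = vec_lambda]) (auto simp: less_eq_vec_def)
  finally show ?thesis .
qed

definition esym :: "nat \<Rightarrow> nat \<Rightarrow> (nat \<Rightarrow> 'a::comm_semiring_1) \<Rightarrow> 'a" where
  "esym N m \<zeta> = (\<Sum>S | S \<subseteq> {..<N} \<and> card S = m. \<Prod>j\<in>S. \<zeta> j)"

lemma sum_Pow_by_card: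
  fixes u :: "nat \<Rightarrow> 'a::comm_semiring_1"
  shows "(\<Sum>S\<in>Pow {..<N}. u (card S) * (\<Prod>j\<in>S. \<zeta> j)) = (\<Sum>m\<le>N. u m * esym N m \<zeta>)"
proof -
  have "(\<Sum>S\<in>Pow {..<N}. u (card S) * (\<Prod>j\<in>S. \<zeta> j)) =
    (\<Sum>m\<le>N. \<Sum>S | S \<in> Pow {..<N} \<and> card S = m. u (card S) * (\<Prod>j\<in>S. \<zeta> j))"
    by (rule sum.group[symmetric]) (auto dest: card_mono[rotated])
  also have "\<dots> = (\<Sum>m\<le>N. u m * esym N m \<zeta>)"
    by (simp add: esym_def sum_distrib_left)
  finally show ?thesis .
qed

lemma prod_one_plus_eq_esym:
  fixes w :: "nat \<Rightarrow> 'a::comm_semiring_1"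
  shows "(\<Prod>j<N. 1 + w j * v) = (\<Sum>m\<le>N. esym N m w * v ^ m)"
proof -
  have "(\<Prod>j<N. w j * v + 1) = (\<Sum>S\<in>Pow {..<N}. (\<Prod>j\<in>S. w j * v) * (\<Prod>j\<in>{..<N} - S. 1))"
    by (rule prod_add) auto
  also have "\<dots> = (\<Sum>S\<in>Pow {..<N}. v ^ card S * (\<Prod>j\<in>S. w j))"
    by (simp add: prod.distrib mult_ac)
  also have "\<dots> = (\<Sum>m\<le>N. v ^ m * esym N m w)"
    by (rule sum_Pow_by_card)
  finally show ?thesis by (simp add: add.commute mult.commute)
qed

text \<open>The pair \<open>(k, j)\<close> names the \<open>j\<close>-th copy of the variable with
  index \<open>k\<close>.\<close>

definition polar_index :: "nat ^ 'n \<Rightarrow> ('n \<times> nat) set" where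
  "polar_index l = (SIGMA k:UNIV. {..<l $ k})"

text \<open>The exponent that the square-free monomial \<open>S\<close> acquires when the copies of
  each variable are identified.\<close>

definition mdeg :: "('n \<times> nat) set \<Rightarrow> nat ^ 'n::finite" where
  "mdeg S = (\<chi> k. card {j. (k, j) \<in> S})"

text \<open>The sum of all square-free monomials of multidegree \<open>\<mu>\<close>: the
  polarization of the monomial \<open>\<mu>\<close> before division by
  \<open>multi_choose l \<mu>\<close>.\<close>

definition mesym :: "nat ^ 'n::finite \<Rightarrow> nat ^ 'n \<Rightarrow> ('n \<times> nat \<Rightarrow> 'a::comm_semiring_1) \<Rightarrow> 'a" where
  "mesym l \<mu> w = (\<Prod>k\<in>UNIV. esym (l $ k) (\<mu> $ k) (\<lambda>j. w (k, j)))"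

lemma finite_polar_index: "finite (polar_index (l :: nat ^ 'n::finite))"
  by (simp add: polar_index_def)

text \<open>A set of copies is the same as its family of slices \<open>{j. (k, j) \<in> S}\<close>.
  Grouped by \<open>mdeg\<close>, the slices vary independently, so each inner sum factors over
  \<open>k\<close>.\<close>

lemma sum_polar_index:
  fixes G :: "nat ^ 'n::finite \<Rightarrow> 'a::comm_semiring_1"
  shows "(\<Sum>S\<in>Pow (polar_index l). G (mdeg S) * (\<Prod>k\<in>UNIV. \<phi> k {j. (k, j) \<in> S})) =
    (\<Sum>\<mu>\<in>{..l}. G \<mu> * (\<Prod>k\<in>UNIV. \<Sum>s | s \<subseteq> {..<l $ k} \<and> card s = \<mu> $ k. \<phi> k s))"
proof -
  have sub: "{j. (k, j) \<in> S} \<subseteq> {..<l $ k}" if "S \<subseteq> polar_index l" for S k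
    using that by (auto simp: polar_index_def)
  have "(\<Sum>S\<in>Pow (polar_index l). G (mdeg S) * (\<Prod>k\<in>UNIV. \<phi> k {j. (k, j) \<in> S})) =
    (\<Sum>\<mu>\<in>{..l}. \<Sum>S | S \<in> Pow (polar_index l) \<and> mdeg S = \<mu>. G (mdeg S) * (\<Prod>k\<in>UNIV. \<phi> k {j. (k, j) \<in> S}))"
  proof (rule sum.group[symmetric])
    show "mdeg ` Pow (polar_index l) \<subseteq> {..l}"
      using card_mono[OF _ sub] by (fastforce simp: mdeg_def less_eq_vec_def)
  qed (auto simp: finite_polar_index finite_atMost_vec)
  also have "\<dots> = (\<Sum>\<mu>\<in>{..l}. G \<mu> * (\<Sum>S | S \<in> Pow (polar_index l) \<and> mdeg S = \<mu>. \<Prod>k\<in>UNIV. \<phi> k {j. (k, j) \<in> S}))"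
    by (simp add: sum_distrib_left)
  also have "\<dots> = (\<Sum>\<mu>\<in>{..l}. G \<mu> * (\<Prod>k\<in>UNIV. \<Sum>s | s \<subseteq> {..<l $ k} \<and> card s = \<mu> $ k. \<phi> k s))"
  proof (intro sum.cong refl arg_cong2[where f = "(*)"])
    fix \<mu> assume "\<mu> \<in> {..l}"
    have "(\<Prod>k\<in>UNIV. \<Sum>s | s \<subseteq> {..<l $ k} \<and> card s = \<mu> $ k. \<phi> k s) =
      (\<Sum>g\<in>PiE UNIV (\<lambda>k. {s. s \<subseteq> {..<l $ k} \<and> card s = \<mu> $ k}). \<Prod>k\<in>UNIV. \<phi> k (g k))"
      by (rule prod_sum_PiE) (auto intro: finite_subset[OF _ finite_Pow_iff[THEN iffD2, OF finite_lessThan]])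
    also have "\<dots> = (\<Sum>S | S \<in> Pow (polar_index l) \<and> mdeg S = \<mu>. \<Prod>k\<in>UNIV. \<phi> k {j. (k, j) \<in> S})"
      by (rule sum.reindex_bij_witness[where i = "\<lambda>S k. {j. (k, j) \<in> S}" and j = "\<lambda>g. SIGMA k:UNIV. g k"])
         (use sub in \<open>auto simp: mdeg_def vec_eq_iff polar_index_def PiE_def\<close>)
    finally show "(\<Sum>S | S \<in> Pow (polar_index l) \<and> mdeg S = \<mu>. \<Prod>k\<in>UNIV. \<phi> k {j. (k, j) \<in> S}) =
      (\<Prod>k\<in>UNIV. \<Sum>s | s \<subseteq> {..<l $ k} \<and> card s = \<mu> $ k. \<phi> k s)" ..
  qed
  finally show ?thesis .
qed

lemma sum_polar_index_mesym:
  fixes G :: "nat ^ 'n::finite \<Rightarrow> 'a::comm_semiring_1"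
  shows "(\<Sum>S\<in>Pow (polar_index l). G (mdeg S) * (\<Prod>i\<in>S. \<zeta> i)) = (\<Sum>\<mu>\<in>{..l}. G \<mu> * mesym l \<mu> \<zeta>)"
proof -
  have "(\<Prod>i\<in>S. \<zeta> i) = (\<Prod>k\<in>UNIV. \<Prod>j\<in>{j. (k, j) \<in> S}. \<zeta> (k, j))" if "S \<in> Pow (polar_index l)" for S
  proof -
    have fin: "finite {j. (k, j) \<in> S}" for k
      using that by (auto intro!: finite_subset[OF _ finite_lessThan[of "l $ k"]] simp: polar_index_def)
    have "(\<Prod>i\<in>S. \<zeta> i) = (\<Prod>i\<in>(SIGMA k:UNIV. {j. (k, j) \<in> S}). \<zeta> i)"
      by (intro prod.cong refl) auto
    also have "\<dots> = (\<Prod>k\<in>UNIV. \<Prod>j\<in>{j. (k, j) \<in> S}. \<zeta> (k, j))"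
      by (subst prod.Sigma) (auto simp: fin)
    finally show ?thesis .
  qed
  then have "(\<Sum>S\<in>Pow (polar_index l). G (mdeg S) * (\<Prod>i\<in>S. \<zeta> i)) =
    (\<Sum>S\<in>Pow (polar_index l). G (mdeg S) * (\<Prod>k\<in>UNIV. \<Prod>j\<in>{j. (k, j) \<in> S}. \<zeta> (k, j)))"
    by simp
  also have "\<dots> = (\<Sum>\<mu>\<in>{..l}. G \<mu> * mesym l \<mu> \<zeta>)"
    unfolding sum_polar_index[where \<phi> = "\<lambda>k s. \<Prod>j\<in>s. \<zeta> (k, j)"] mesym_def esym_def ..
  finally show ?thesis .
qed

lemma esym_one: "esym N m (\<lambda>_. 1) = of_nat (N choose m)"
  using n_subsets[of "{..<N}" m] by (simp add: esym_def)

lemma mesym_one: "mesym l \<mu> (\<lambda>_. 1) = of_nat (multi_choose l \<mu>)"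
  by (simp add: mesym_def esym_one multi_choose_def)

text \<open>The products on the left are the test polynomials whose images under \<open>T\<close>
  form the polarized symbol.\<close>

lemma prod_one_plus_eq_mesym:
  fixes w :: "'n::finite \<times> nat \<Rightarrow> 'a::comm_semiring_1"
  shows "(\<Prod>k\<in>UNIV. \<Prod>j<l $ k. 1 + w (k, j) * y k) =
    (\<Sum>\<mu>\<in>{..l}. mesym l \<mu> w * (\<Prod>k\<in>UNIV. y k ^ (\<mu> $ k)))"
  by (simp add: prod_one_plus_eq_esym prod_sum_atMost_vec mesym_def prod.distrib)

lemma multi_choose_pos: "\<mu> \<le> l \<Longrightarrow> multi_choose l \<mu> > 0"
  by (auto simp: multi_choose_def less_eq_vec_def intro!: prod_pos)

text \<open>The variables are polarized one at a time. \<open>K\<close> collects those already done,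
  each contributing normalised elementary symmetric factors \<open>E\<close>; for the next one the
  other values are frozen and \<open>Grace_Walsh_Szego\<close> applies.\<close>

theorem polarization_nonzero:
  fixes c :: "nat ^ 'n::finite \<Rightarrow> complex"
  assumes nz: "\<And>y :: 'n \<Rightarrow> complex. (\<And>k. Im (y k) > 0) \<Longrightarrow>
      (\<Sum>\<mu>\<in>{..l}. c \<mu> * (\<Prod>k\<in>UNIV. y k ^ (\<mu> $ k))) \<noteq> 0"
    and \<zeta>: "\<And>i. i \<in> polar_index l \<Longrightarrow> Im (\<zeta> i) > 0"
  shows "(\<Sum>\<mu>\<in>{..l}. c \<mu> / of_nat (multi_choose l \<mu>) * mesym l \<mu> \<zeta>) \<noteq> 0"
proof -
  define E where "E = (\<lambda>k m. esym (l $ k) m (\<lambda>j. \<zeta> (k, j)) / of_nat (l $ k choose m))"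
  have "(\<Sum>\<mu>\<in>{..l}. c \<mu> * (\<Prod>k\<in>K. E k (\<mu> $ k)) * (\<Prod>k\<in>- K. y k ^ (\<mu> $ k))) \<noteq> 0"
    if "finite K" "\<And>k. Im (y k) > 0" for K and y :: "'n \<Rightarrow> complex"
    using that
  proof (induction K arbitrary: y rule: finite_induct)
    case empty
    then show ?case using nz by (simp add: Compl_empty_eq)
  next
    case (insert k K)
    \<comment> \<open>The coefficients with respect to the variable \<open>k\<close>, all other
      variables being fixed.\<close>
    define u where "u = (\<lambda>m. \<Sum>\<mu> | \<mu> \<in> {..l} \<and> \<mu> $ k = m.
        c \<mu> * (\<Prod>k\<in>K. E k (\<mu> $ k)) * (\<Prod>j\<in>- insert k K. y j ^ (\<mu> $ j)))"
    have group: "(\<Sum>m\<le>l $ k. u m * v m) = (\<Sum>\<mu>\<in>{..l}.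
        c \<mu> * (\<Prod>k\<in>K. E k (\<mu> $ k)) * (\<Prod>j\<in>- insert k K. y j ^ (\<mu> $ j)) * v (\<mu> $ k))" for v
    proof -
      have "(\<Sum>\<mu>\<in>{..l}. c \<mu> * (\<Prod>k\<in>K. E k (\<mu> $ k)) * (\<Prod>j\<in>- insert k K. y j ^ (\<mu> $ j)) * v (\<mu> $ k))
        = (\<Sum>m\<le>l $ k. \<Sum>\<mu> | \<mu> \<in> {..l} \<and> \<mu> $ k = m.
           c \<mu> * (\<Prod>k\<in>K. E k (\<mu> $ k)) * (\<Prod>j\<in>- insert k K. y j ^ (\<mu> $ j)) * v (\<mu> $ k))"
        by (rule sum.group[symmetric]) (auto simp: finite_atMost_vec less_eq_vec_def)
      then show ?thesis
        by (simp add: u_def sum_distrib_right)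
    qed
    have K: "- K = insert k (- insert k K)" using insert.hyps by auto
    have "(\<Sum>m\<le>card {..<l $ k}. u m * v ^ m) \<noteq> 0" if v: "Im v > 0" for v
    proof -
      have "(\<Sum>\<mu>\<in>{..l}. c \<mu> * (\<Prod>k\<in>K. E k (\<mu> $ k)) * (\<Prod>j\<in>- K. (y(k := v)) j ^ (\<mu> $ j))) \<noteq> 0"
        using insert.prems v by (intro insert.IH) auto
      moreover have "(\<Prod>j\<in>- K. (y(k := v)) j ^ (\<mu> $ j)) = (\<Prod>j\<in>- insert k K. y j ^ (\<mu> $ j)) * v ^ (\<mu> $ k)" for \<mu>
      proof -
        have "(\<Prod>j\<in>- insert k K. (y(k := v)) j ^ (\<mu> $ j)) = (\<Prod>j\<in>- insert k K. y j ^ (\<mu> $ j))"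
          by (intro prod.cong) auto
        then show ?thesis unfolding K by simp
      qed
      ultimately show ?thesis by (simp add: group mult.assoc)
    qed
    then have "(\<Sum>S\<in>Pow {..<l $ k}. u (card S) / of_nat (card {..<l $ k} choose card S) * (\<Prod>j\<in>S. \<zeta> (k, j))) \<noteq> 0"
      using \<zeta> by (intro Grace_Walsh_Szego) (auto simp: polar_index_def)
    also have "(\<Sum>S\<in>Pow {..<l $ k}. u (card S) / of_nat (card {..<l $ k} choose card S) * (\<Prod>j\<in>S. \<zeta> (k, j))) =
        (\<Sum>m\<le>l $ k. u m * E k m)"
      using sum_Pow_by_card[of "\<lambda>m. u m / of_nat (card {..<l $ k} choose m)" "\<lambda>j. \<zeta> (k, j)" "l $ k"]
      by (simp add: E_def)
    also have "\<dots> = (\<Sum>\<mu>\<in>{..l}. c \<mu> * (\<Prod>k\<in>insert k K. E k (\<mu> $ k)) * (\<Prod>k\<in>- insert k K. y k ^ (\<mu> $ k)))"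
      unfolding group using insert.hyps by (simp add: mult_ac)
    finally show ?case .
  qed
  from this[of UNIV "\<lambda>_. \<i>"] have "(\<Sum>\<mu>\<in>{..l}. c \<mu> * (\<Prod>k\<in>UNIV. E k (\<mu> $ k))) \<noteq> 0"
    by simp
  then show ?thesis
    by (simp add: E_def mesym_def multi_choose_def prod_dividef)
qed

section \<open>Elementary symmetric means and the geometric mean\<close>

text \<open>Double counting: each index lies in \<open>N - 1 choose (m - 1)\<close> of the
  subsets.\<close>

lemma sum_subsets_card:
  fixes a :: "nat \<Rightarrow> real"
  assumes "0 < m" "m \<le> N"
  shows "(\<Sum>S | S \<subseteq> {..<N} \<and> card S = m. \<Sum>j\<in>S. a j) = real (N choose m) * (real m / real N * (\<Sum>j<N. a j))"
proof -
  let ?F = "{S. S \<subseteq> {..<N} \<and> card S = m}"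
  have fin: "finite ?F"
    by (rule finite_subset[of _ "Pow {..<N}"]) auto
  have cd: "card {S \<in> ?F. j \<in> S} = N - 1 choose (m - 1)" if j: "j < N" for j
  proof -
    have "bij_betw (insert j) {S. S \<subseteq> {..<N} - {j} \<and> card S = m - 1} {S \<in> ?F. j \<in> S}"
    proof (rule bij_betw_byWitness[where f' = "\<lambda>S. S - {j}"])
      show "insert j ` {S. S \<subseteq> {..<N} - {j} \<and> card S = m - 1} \<subseteq> {S \<in> ?F. j \<in> S}"
      proof clarsimp
        fix S assume S: "S \<subseteq> {..<N} - {j}" "card S = m - Suc 0"
        then have "finite S" "j \<notin> S" by (auto intro: finite_subset)
        then show "j < N \<and> S \<subseteq> {..<N} \<and> card (insert j S) = m"
          using S j assms by auto
      qed
      show "(\<lambda>S. S - {j}) ` {S \<in> ?F. j \<in> S} \<subseteq> {S. S \<subseteq> {..<N} - {j} \<and> card S = m - 1}"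
        by auto
    qed auto
    then have "card {S \<in> ?F. j \<in> S} = card {S. S \<subseteq> {..<N} - {j} \<and> card S = m - 1}"
      by (simp add: bij_betw_same_card)
    also have "\<dots> = N - 1 choose (m - 1)"
      using n_subsets[of "{..<N} - {j}" "m - 1"] j by simp
    finally show ?thesis .
  qed
  have "(\<Sum>S\<in>?F. \<Sum>j\<in>S. a j) = (\<Sum>S\<in>?F. \<Sum>j | j \<in> {..<N} \<and> j \<in> S. a j)"
    by (intro sum.cong refl) auto
  also have "\<dots> = (\<Sum>j<N. \<Sum>S | S \<in> ?F \<and> j \<in> S. a j)"
    using fin by (intro sum.swap_restrict) auto
  also have "\<dots> = (\<Sum>j<N. real (N - 1 choose (m - 1)) * a j)"
    using cd by (intro sum.cong refl) simp
  also have "\<dots> = real (N - 1 choose (m - 1)) * (\<Sum>j<N. a j)"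
    by (simp add: sum_distrib_left)
  also have "real (N - 1 choose (m - 1)) = real (N choose m) * (real m / real N)"
  proof -
    have "m * (N choose m) = N * (N - 1 choose (m - 1))"
      using assms by (intro times_binomial_minus1_eq) auto
    then have "real m * real (N choose m) = real N * real (N - 1 choose (m - 1))"
      by (metis of_nat_mult)
    then show ?thesis using assms by (simp add: field_simps)
  qed
  finally show ?thesis by (simp add: mult.assoc)
qed

text \<open>In logarithmic coordinates \<open>exp\<close> is replaced by its tangent at
  \<open>A\<close>, the average of the exponents over the \<open>m\<close>-element subsets; the
  linear terms then sum to 0.\<close>

lemma esym_ge_geometric_mean:
  fixes y :: "nat \<Rightarrow> real"
  assumes "\<And>j. j < N \<Longrightarrow> y j > 0" "m \<le> N"
  shows "esym N m y \<ge> real (N choose m) * ((\<Prod>j<N. y j) powr (1 / real N)) ^ m"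
proof (cases "m = 0")
  case True
  have "{S. S \<subseteq> {..<N} \<and> card S = 0} = {{}}"
    by (auto simp: card_eq_0_iff dest: finite_subset)
  then show ?thesis using True by (simp add: esym_def)
next
  case False
  let ?F = "{S. S \<subseteq> {..<N} \<and> card S = m}"
  define a where "a = (\<lambda>j. ln (y j))"
  have ya: "y j = exp (a j)" if "j < N" for j
    using assms(1)[OF that] by (simp add: a_def)
  define A where "A = real m / real N * (\<Sum>j<N. a j)"
  have cF: "card ?F = N choose m"
    using n_subsets[of "{..<N}" m] by simp
  have "(\<Prod>j<N. y j) = exp (\<Sum>j<N. a j)"
    by (simp add: ya exp_sum)
  then have "((\<Prod>j<N. y j) powr (1 / real N)) ^ m = exp A"
    by (simp add: powr_def A_def flip: exp_of_nat_mult)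
  moreover have "esym N m y = (\<Sum>S\<in>?F. exp (\<Sum>j\<in>S. a j))"
    unfolding esym_def
  proof (intro sum.cong refl)
    fix S assume S: "S \<in> ?F"
    then have "finite S" by (auto intro: finite_subset)
    moreover have "(\<Prod>j\<in>S. y j) = (\<Prod>j\<in>S. exp (a j))"
      using S by (intro prod.cong refl ya) auto
    ultimately show "(\<Prod>j\<in>S. y j) = exp (\<Sum>j\<in>S. a j)"
      by (simp add: exp_sum)
  qed
  moreover have "(\<Sum>S\<in>?F. exp (\<Sum>j\<in>S. a j)) \<ge> (\<Sum>S\<in>?F. exp A * (1 + ((\<Sum>j\<in>S. a j) - A)))"
  proof (rule sum_mono)
    fix S
    have "exp A * (1 + ((\<Sum>j\<in>S. a j) - A)) \<le> exp A * exp ((\<Sum>j\<in>S. a j) - A)"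
      by (intro mult_left_mono exp_ge_add_one_self) auto
    then show "exp A * (1 + ((\<Sum>j\<in>S. a j) - A)) \<le> exp (\<Sum>j\<in>S. a j)"
      by (simp flip: exp_add)
  qed
  moreover have "(\<Sum>S\<in>?F. exp A * (1 + ((\<Sum>j\<in>S. a j) - A))) =
      exp A * (real (card ?F) * (1 - A) + (\<Sum>S\<in>?F. \<Sum>j\<in>S. a j))"
    by (simp add: sum.distrib sum_subtractf algebra_simps flip: sum_distrib_left)
  moreover have "(\<Sum>S\<in>?F. \<Sum>j\<in>S. a j) = real (card ?F) * A"
    unfolding A_def cF using False assms(2) by (intro sum_subsets_card) auto
  ultimately show ?thesis
    unfolding cF by (simp add: algebra_simps)
qed

lemma mesym_ge_geometric_mean:
  fixes y :: "'n::finite \<times> nat \<Rightarrow> real"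
  assumes "\<And>i. i \<in> polar_index l \<Longrightarrow> y i > 0" "\<mu> \<le> l"
  shows "mesym l \<mu> y \<ge> real (multi_choose l \<mu>) *
    (\<Prod>k\<in>UNIV. ((\<Prod>j<l $ k. y (k, j)) powr (1 / real (l $ k))) ^ (\<mu> $ k))"
proof -
  have "(\<Prod>k\<in>UNIV. real (l $ k choose \<mu> $ k) * ((\<Prod>j<l $ k. y (k, j)) powr (1 / real (l $ k))) ^ (\<mu> $ k))
    \<le> mesym l \<mu> y"
    unfolding mesym_def using assms
    by (intro prod_mono conjI esym_ge_geometric_mean) (auto simp: polar_index_def less_eq_vec_def)
  then show ?thesis
    by (simp add: prod.distrib multi_choose_def)
qed

section \<open>Stability of the symbol\<close>

definition of_coeffs :: "nat ^ 'n \<Rightarrow> (nat ^ 'n \<Rightarrow> real) \<Rightarrow> ('n::finite) rpoly" where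
  "of_coeffs l c = (\<Sum>\<mu>\<in>{..l}. Poly_Mapping.single \<mu> (c \<mu>))"

lemma lookup_of_coeffs: "Poly_Mapping.lookup (of_coeffs l c) \<mu> = (if \<mu> \<le> l then c \<mu> else 0)"
  by (auto simp: of_coeffs_def lookup_sum lookup_single when_def finite_atMost_vec)

lemma of_coeffs_polys_le: "of_coeffs l c \<in> polys_le l"
  by (auto simp: polys_le_def in_keys_iff lookup_of_coeffs split: if_splits)

lemma lookup_scaleR_poly_mapping:
  "Poly_Mapping.lookup (r *\<^sub>R p) \<mu> = r * Poly_Mapping.lookup (p :: 'a \<Rightarrow>\<^sub>0 real) \<mu>"
proof -
  have "finite {\<mu>. r * Poly_Mapping.lookup p \<mu> \<noteq> 0}"
    by (rule finite_subset[OF _ finite_keys[of p]]) (auto simp: in_keys_iff)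
  then show ?thesis
    by (simp add: scaleR_poly_mapping_def)
qed

lemma eval_poly_polys_le:
  assumes "p \<in> polys_le l"
  shows "eval_poly p x = (\<Sum>\<mu>\<in>{..l}. of_real (Poly_Mapping.lookup p \<mu>) * (\<Prod>k\<in>UNIV. x $ k ^ (\<mu> $ k)))"
  using assms by (intro eval_poly_superset finite_atMost_vec) (auto simp: polys_le_def)

lemma eval_poly_of_coeffs:
  "eval_poly (of_coeffs l c) x = (\<Sum>\<mu>\<in>{..l}. of_real (c \<mu>) * (\<Prod>k\<in>UNIV. x $ k ^ (\<mu> $ k)))"
  by (simp add: eval_poly_polys_le[OF of_coeffs_polys_le] lookup_of_coeffs)

lemma eval_poly_scaleR: "eval_poly (r *\<^sub>R p) x = of_real r * eval_poly p x"
proof -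
  have "Poly_Mapping.keys (r *\<^sub>R p) \<subseteq> Poly_Mapping.keys p"
    by (auto simp: in_keys_iff lookup_scaleR_poly_mapping)
  then show ?thesis
    unfolding eval_poly_superset[OF finite_keys \<open>Poly_Mapping.keys (r *\<^sub>R p) \<subseteq> _\<close>]
    by (simp add: eval_poly_def lookup_scaleR_poly_mapping sum_distrib_left mult_ac)
qed

lemma polys_le_add: "\<lbrakk>p \<in> polys_le l; q \<in> polys_le l\<rbrakk> \<Longrightarrow> p + q \<in> polys_le l"
  using Poly_Mapping.keys_add[of p q] by (auto simp: polys_le_def)

lemma polys_le_scaleR: "p \<in> polys_le l \<Longrightarrow> r *\<^sub>R p \<in> polys_le l"
  by (auto simp: polys_le_def in_keys_iff lookup_scaleR_poly_mapping)

lemma polys_le_zero: "0 \<in> polys_le l"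
  by (simp add: polys_le_def)

lemma monomial_polys_le: "\<mu> \<le> l \<Longrightarrow> monomial \<mu> \<in> polys_le l"
  by (simp add: monomial_def polys_le_def)

lemma real_stable_scaleR_iff: "r \<noteq> 0 \<Longrightarrow> real_stable (r *\<^sub>R p) \<longleftrightarrow> real_stable p"
  by (auto simp: real_stable_def eval_poly_scaleR)

text \<open>Linearity is available on \<open>polys_le l\<close> only, so the induction also carries
  membership of the partial sums.\<close>

lemma linear_between_expand:
  assumes T: "linear_between (polys_le l) W T" and p: "p \<in> polys_le l"
  shows "T p = (\<Sum>\<mu>\<in>{..l}. Poly_Mapping.lookup p \<mu> *\<^sub>R T (monomial \<mu>))"
proof -
  have "T (0 *\<^sub>R p) = 0 *\<^sub>R T p"
    using T p unfolding linear_between_def by blast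
  then have T0: "T 0 = 0" by simp
  have "(\<Sum>\<mu>\<in>A. c \<mu> *\<^sub>R monomial \<mu>) \<in> polys_le l \<and>
      T (\<Sum>\<mu>\<in>A. c \<mu> *\<^sub>R monomial \<mu>) = (\<Sum>\<mu>\<in>A. c \<mu> *\<^sub>R T (monomial \<mu>))"
    if "finite A" "A \<subseteq> {..l}" for A c
    using that
  proof (induction A rule: finite_induct)
    case (insert \<mu> A)
    have m: "monomial \<mu> \<in> polys_le l" "c \<mu> *\<^sub>R monomial \<mu> \<in> polys_le l"
      using insert.prems by (auto intro: monomial_polys_le polys_le_scaleR)
    have "T (c \<mu> *\<^sub>R monomial \<mu> + (\<Sum>\<mu>\<in>A. c \<mu> *\<^sub>R monomial \<mu>))
        = T (c \<mu> *\<^sub>R monomial \<mu>) + T (\<Sum>\<mu>\<in>A. c \<mu> *\<^sub>R monomial \<mu>)"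
      using T m insert unfolding linear_between_def by blast
    moreover have "T (c \<mu> *\<^sub>R monomial \<mu>) = c \<mu> *\<^sub>R T (monomial \<mu>)"
      using T m unfolding linear_between_def by blast
    ultimately show ?case
      using insert m by (auto intro: polys_le_add)
  qed (auto simp: T0 polys_le_zero)
  from this[OF finite_atMost_vec[of l], of "Poly_Mapping.lookup p"]
  have "T (\<Sum>\<mu>\<in>{..l}. Poly_Mapping.lookup p \<mu> *\<^sub>R monomial \<mu>) =
      (\<Sum>\<mu>\<in>{..l}. Poly_Mapping.lookup p \<mu> *\<^sub>R T (monomial \<mu>))" by simp
  moreover have "(\<Sum>\<mu>\<in>{..l}. Poly_Mapping.lookup p \<mu> *\<^sub>R monomial \<mu>) = p"
  proof (rule poly_mapping_eqI)
    fix \<nu>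
    have "Poly_Mapping.lookup (\<Sum>\<mu>\<in>{..l}. Poly_Mapping.lookup p \<mu> *\<^sub>R monomial \<mu>) \<nu>
        = (if \<nu> \<le> l then Poly_Mapping.lookup p \<nu> else 0)"
      by (auto simp: lookup_sum lookup_scaleR_poly_mapping monomial_def lookup_single when_def
          if_distrib finite_atMost_vec cong: if_cong)
    then show "Poly_Mapping.lookup (\<Sum>\<mu>\<in>{..l}. Poly_Mapping.lookup p \<mu> *\<^sub>R monomial \<mu>) \<nu> = Poly_Mapping.lookup p \<nu>"
      using p by (auto simp: polys_le_def in_keys_iff)
  qed
  ultimately show ?thesis by simp
qed

lemma eval_poly_linear_between:
  assumes "linear_between (polys_le l) W T" "p \<in> polys_le l"
  shows "eval_poly (T p) x =
    (\<Sum>\<mu>\<in>{..l}. of_real (Poly_Mapping.lookup p \<mu>) * eval_poly (T (monomial \<mu>)) x)"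
  by (simp add: linear_between_expand[OF assms] eval_poly_sum eval_poly_scaleR)

section \<open>Interior points of the set of real stable polynomials\<close>

text \<open>The zero \<open>- 1 / w\<close> lies strictly below the real axis, so the factor stays
  away from 0 on the closed upper half-plane and grows linearly there.\<close>

lemma norm_one_plus_mult_ge:
  fixes w :: complex
  assumes "Im w < 0"
  obtains \<delta> where "\<delta> > 0" "\<And>y. Im y \<ge> 0 \<Longrightarrow> \<delta> * (1 + norm y) \<le> norm (1 + w * y)"
proof -
  define u where "u = 1 / w"
  have w: "w \<noteq> 0" using assms by auto
  have b: "Im u > 0"
    using assms w by (simp add: u_def Im_divide divide_neg_pos complex_neq_0)
  \<comment> \<open>From \<open>1 + norm y \<le> norm (y + u) + (1 + norm u)\<close> and
    \<open>Im u \<le> norm (y + u)\<close>.\<close>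
  define M where "M = 1 + (1 + norm u) / Im u"
  have M: "M > 0" using b by (simp add: M_def add_pos_nonneg)
  show ?thesis
  proof (rule that[of "norm w / M"])
    show "norm w / M > 0" using w M by simp
    fix y assume y: "Im y \<ge> 0"
    have "Im u \<le> norm (y + u)"
      using abs_Im_le_cmod[of "y + u"] y by simp
    then have "1 \<le> norm (y + u) / Im u" using b by simp
    then have "(1 + norm u) * 1 \<le> (1 + norm u) * (norm (y + u) / Im u)"
      by (intro mult_left_mono) auto
    moreover have "norm y \<le> norm (y + u) + norm u"
      by (metis add_diff_cancel_right' norm_triangle_ineq4)
    ultimately have "1 + norm y \<le> M * norm (y + u)"
      by (simp add: M_def algebra_simps)
    then have "norm w / M * (1 + norm y) \<le> norm w / M * (M * norm (y + u))"
      using M by (intro mult_left_mono) auto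
    also have "\<dots> = norm (w * (y + u))"
      using M by (simp add: norm_mult)
    also have "w * (y + u) = 1 + w * y"
      using w by (simp add: u_def algebra_simps)
    finally show "norm w / M * (1 + norm y) \<le> norm (1 + w * y)" .
  qed
qed

text \<open>The lower bound has the growth of the largest polynomial in \<open>polys_le l\<close>
  (see \<open>norm_poly_sum_le\<close>), so small perturbations of any kind are absorbed, also at
  infinity.\<close>

lemma norm_prod_one_plus_mult_ge:
  fixes w :: "'n::finite \<times> nat \<Rightarrow> complex"
  assumes "\<And>i. i \<in> polar_index l \<Longrightarrow> Im (w i) < 0"
  obtains \<delta> where "\<delta> > 0" "\<And>y. (\<And>k. Im (y k) \<ge> 0) \<Longrightarrow>
     \<delta> * (\<Prod>k\<in>UNIV. (1 + norm (y k)) ^ (l $ k)) \<le> norm (\<Prod>k\<in>UNIV. \<Prod>j<l $ k. 1 + w (k, j) * y k)"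
proof -
  have "\<exists>\<delta>. \<forall>i\<in>polar_index l. \<delta> i > 0 \<and> (\<forall>y. Im y \<ge> 0 \<longrightarrow> \<delta> i * (1 + norm y) \<le> norm (1 + w i * y))"
    by (intro bchoice ballI) (metis norm_one_plus_mult_ge assms)
  then obtain \<delta> where \<delta>: "\<And>i. i \<in> polar_index l \<Longrightarrow> \<delta> i > 0"
    "\<And>i y. \<lbrakk>i \<in> polar_index l; Im y \<ge> 0\<rbrakk> \<Longrightarrow> \<delta> i * (1 + norm y) \<le> norm (1 + w i * y)"
    by metis
  show ?thesis
  proof (rule that[of "\<Prod>k\<in>UNIV. \<Prod>j<l $ k. \<delta> (k, j)"])
    show "(\<Prod>k\<in>UNIV. \<Prod>j<l $ k. \<delta> (k, j)) > 0"
      using \<delta>(1) by (intro prod_pos) (auto simp: polar_index_def)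
    fix y :: "'n \<Rightarrow> complex" assume y: "\<And>k. Im (y k) \<ge> 0"
    have "(\<Prod>k\<in>UNIV. \<Prod>j<l $ k. \<delta> (k, j)) * (\<Prod>k\<in>UNIV. (1 + norm (y k)) ^ (l $ k))
       = (\<Prod>k\<in>UNIV. \<Prod>j<l $ k. \<delta> (k, j) * (1 + norm (y k)))"
      by (simp add: prod.distrib)
    also have "\<dots> \<le> (\<Prod>k\<in>UNIV. \<Prod>j<l $ k. norm (1 + w (k, j) * y k))"
      using \<delta> y by (intro prod_mono conjI prod_nonneg)
        (auto simp: polar_index_def intro!: mult_nonneg_nonneg less_imp_le[OF \<delta>(1)])
    also have "\<dots> = norm (\<Prod>k\<in>UNIV. \<Prod>j<l $ k. 1 + w (k, j) * y k)"
      by (simp add: prod_norm)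
    finally show "(\<Prod>k\<in>UNIV. \<Prod>j<l $ k. \<delta> (k, j)) * (\<Prod>k\<in>UNIV. (1 + norm (y k)) ^ (l $ k))
       \<le> norm (\<Prod>k\<in>UNIV. \<Prod>j<l $ k. 1 + w (k, j) * y k)" .
  qed
qed

lemma norm_poly_sum_le:
  fixes y :: "'n::finite \<Rightarrow> complex"
  shows "norm (\<Sum>\<mu>\<in>{..l}. c \<mu> * (\<Prod>k\<in>UNIV. y k ^ (\<mu> $ k)))
    \<le> (\<Sum>\<mu>\<in>{..l}. norm (c \<mu>)) * (\<Prod>k\<in>UNIV. (1 + norm (y k)) ^ (l $ k))"
proof -
  have "norm (c \<mu> * (\<Prod>k\<in>UNIV. y k ^ (\<mu> $ k))) \<le> norm (c \<mu>) * (\<Prod>k\<in>UNIV. (1 + norm (y k)) ^ (l $ k))"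
    if "\<mu> \<in> {..l}" for \<mu>
  proof -
    have "norm (y k) ^ (\<mu> $ k) \<le> (1 + norm (y k)) ^ (l $ k)" for k
    proof -
      have "norm (y k) ^ (\<mu> $ k) \<le> (1 + norm (y k)) ^ (\<mu> $ k)"
        by (intro power_mono) auto
      also have "\<dots> \<le> (1 + norm (y k)) ^ (l $ k)"
        using that by (intro power_increasing) (auto simp: less_eq_vec_def)
      finally show ?thesis .
    qed
    then have "(\<Prod>k\<in>UNIV. norm (y k) ^ (\<mu> $ k)) \<le> (\<Prod>k\<in>UNIV. (1 + norm (y k)) ^ (l $ k))"
      by (intro prod_mono) auto
    then show ?thesis
      by (simp add: norm_mult norm_power mult_left_mono flip: prod_norm)
  qed
  then show ?thesis
    unfolding sum_distrib_right by (intro sum_norm_le)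
qed

text \<open>On each line through the region all zeros lie below the real axis, hence closer to the
  conjugate point.\<close>

lemma norm_cnj_less_of_lower_bound:
  fixes c :: "nat ^ 'n::finite \<Rightarrow> complex" and y :: "'n \<Rightarrow> complex" and l :: "nat ^ 'n"
  defines "g \<equiv> \<lambda>y. \<Sum>\<mu>\<in>{..l}. c \<mu> * (\<Prod>k\<in>UNIV. y k ^ (\<mu> $ k))"
  assumes \<delta>: "\<delta> > 0" and k: "l $ k0 > 0"
    and lb: "\<And>y. (\<And>k. Im (y k) \<ge> 0) \<Longrightarrow> \<delta> * (\<Prod>k\<in>UNIV. (1 + norm (y k)) ^ (l $ k)) \<le> norm (g y)"
    and y: "\<And>k. Im (y k) > 0"
  shows "norm (g (\<lambda>k. cnj (y k))) < norm (g y)"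
proof -
  \<comment> \<open>The restriction to the line with base point \<open>Re y\<close> and direction
    \<open>Im y\<close>; it meets \<open>y\<close> at \<open>\<i>\<close> and the conjugate point at
    \<open>- \<i>\<close>.\<close>
  define G where "G = (\<Sum>\<mu>\<in>{..l}. smult (c \<mu>) (\<Prod>k\<in>UNIV. [:of_real (Re (y k)), of_real (Im (y k)):] ^ (\<mu> $ k)))"
  have G: "poly G t = g (\<lambda>k. of_real (Re (y k)) + t * of_real (Im (y k)))" for t
    by (simp add: G_def g_def poly_sum poly_prod)
  have lbG: "\<delta> * (\<Prod>k\<in>UNIV. (1 + norm (of_real (Re (y k)) + t * of_real (Im (y k)))) ^ (l $ k)) \<le> norm (poly G t)"
    if "Im t \<ge> 0" for t
    unfolding G using that y by (intro lb) (simp add: less_imp_le)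
  have "norm (poly G (- \<i>)) < norm (poly G \<i>)"
  proof (rule nonroot_upper_imp_norm_gt)
    show "poly G t \<noteq> 0" if "Im t \<ge> 0" for t
    proof -
      have "\<delta> * (\<Prod>k\<in>UNIV. (1 + norm (of_real (Re (y k)) + t * of_real (Im (y k)))) ^ (l $ k)) > 0"
        using \<delta> by (intro mult_pos_pos prod_pos) (auto simp: add_pos_nonneg)
      then show ?thesis using lbG[OF that] by auto
    qed
    show "degree G > 0"
    proof (rule ccontr)
      assume "\<not> degree G > 0"
      then obtain C where C: "G = [:C:]" by (metis degree_eq_zeroE neq0_conv)
      \<comment> \<open>A real parameter so large that the growth in variable \<open>k0\<close>
        alone makes the lower bound exceed \<open>norm C\<close>.\<close>
      define t where "t = (norm C / \<delta> + \<bar>Re (y k0)\<bar>) / Im (y k0)"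
      let ?N = "\<lambda>k. norm (of_real (Re (y k)) + of_real t * of_real (Im (y k)) :: complex)"
      have "t * Im (y k0) = norm C / \<delta> + \<bar>Re (y k0)\<bar>"
        using y[of k0] by (simp add: t_def)
      then have "norm C / \<delta> \<le> \<bar>Re (y k0) + t * Im (y k0)\<bar>" by linarith
      also have "\<dots> = ?N k0"
        by (metis norm_of_real of_real_add of_real_mult)
      finally have "norm C / \<delta> < 1 + ?N k0" by simp
      also have "\<dots> \<le> (1 + ?N k0) ^ (l $ k0)"
        using k by (intro self_le_power) auto
      also have "\<dots> \<le> (1 + ?N k0) ^ (l $ k0) * (\<Prod>k\<in>UNIV - {k0}. (1 + ?N k) ^ (l $ k))"
      proof -
        have "1 \<le> (\<Prod>k\<in>UNIV - {k0}. (1 + ?N k) ^ (l $ k))"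
          by (intro prod_ge_1 one_le_power) auto
        then have "(1 + ?N k0) ^ (l $ k0) * 1 \<le> (1 + ?N k0) ^ (l $ k0) * (\<Prod>k\<in>UNIV - {k0}. (1 + ?N k) ^ (l $ k))"
          by (intro mult_left_mono) auto
        then show ?thesis by simp
      qed
      also have "\<dots> = (\<Prod>k\<in>UNIV. (1 + ?N k) ^ (l $ k))"
        by (rule prod.remove[symmetric]) auto
      finally have "norm C < \<delta> * (\<Prod>k\<in>UNIV. (1 + ?N k) ^ (l $ k))"
        using \<delta> by (simp add: divide_less_eq mult.commute)
      also have "\<dots> \<le> norm (poly G (of_real t))"
        by (rule lbG) simp
      finally show False by (simp add: C)
    qed
  qed
  moreover have "of_real (Re (y k)) + \<i> * of_real (Im (y k)) = y k"
    "of_real (Re (y k)) + - \<i> * of_real (Im (y k)) = cnj (y k)" for k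
    by (simp_all add: complex_eq_iff)
  ultimately show ?thesis
    unfolding G by simp
qed

lemma cnj_mesym: "cnj (mesym l \<mu> w) = mesym l \<mu> (\<lambda>i. cnj (w i))"
  by (simp add: mesym_def esym_def)

lemma of_real_Re_eq: "complex_of_real (Re z) = (z + cnj z) / 2"
  by (simp add: complex_add_cnj)

text \<open>With \<open>g\<close> the complex polynomial \<zeta> h_w + \<epsilon> p, the real
  polynomial takes the value \<open>(g z + cnj (g (cnj z))) / 2\<close>. Since \<open>g\<close>
  keeps half of the lower bound of \<zeta> h_w, its modulus at \<open>z\<close> exceeds that at the
  conjugate, and the two terms cannot cancel.\<close>

lemma real_stable_perturbation:
  fixes w :: "'n::finite \<times> nat \<Rightarrow> complex"
  assumes w: "\<And>i. i \<in> polar_index l \<Longrightarrow> Im (w i) < 0" and \<zeta>: "\<zeta> \<noteq> 0" and p: "p \<in> polys_le l"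
    and k0: "l $ k0 > 0"
  shows "\<exists>\<epsilon>>0. real_stable (of_coeffs l (\<lambda>\<mu>. Re (\<zeta> * mesym l \<mu> w)) + \<epsilon> *\<^sub>R p)"
proof -
  obtain \<delta> where \<delta>: "\<delta> > 0" and lb: "\<And>y. (\<And>k. Im (y k) \<ge> 0) \<Longrightarrow>
     \<delta> * (\<Prod>k\<in>UNIV. (1 + norm (y k)) ^ (l $ k)) \<le> norm (\<Prod>k\<in>UNIV. \<Prod>j<l $ k. 1 + w (k, j) * y k)"
    by (rule norm_prod_one_plus_mult_ge[where w = w and l = l, OF w]) blast+
  define C where "C = (\<Sum>\<mu>\<in>{..l}. norm (complex_of_real (Poly_Mapping.lookup p \<mu>)))"
  have C: "C \<ge> 0" by (simp add: C_def sum_nonneg)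
  \<comment> \<open>The perturbation may use up half of the lower bound; \<open>C + 1\<close> keeps
    the denominator positive.\<close>
  define \<epsilon> where "\<epsilon> = norm \<zeta> * \<delta> / (2 * (C + 1))"
  have \<epsilon>: "\<epsilon> > 0" using \<delta> \<zeta> C by (simp add: \<epsilon>_def)
  have \<epsilon>C: "\<epsilon> * C \<le> norm \<zeta> * \<delta> / 2"
  proof -
    have "\<epsilon> * C \<le> \<epsilon> * (C + 1)" using \<epsilon> by simp
    also have "\<dots> = norm \<zeta> * \<delta> / 2" using C by (simp add: \<epsilon>_def field_simps)
    finally show ?thesis .
  qed
  define c where "c = (\<lambda>\<mu>. \<zeta> * mesym l \<mu> w + of_real (\<epsilon> * Poly_Mapping.lookup p \<mu>))"
  define g where "g = (\<lambda>y. \<Sum>\<mu>\<in>{..l}. c \<mu> * (\<Prod>k\<in>UNIV. y k ^ (\<mu> $ k)))"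
  have g: "g y = \<zeta> * (\<Prod>k\<in>UNIV. \<Prod>j<l $ k. 1 + w (k, j) * y k)
      + of_real \<epsilon> * (\<Sum>\<mu>\<in>{..l}. of_real (Poly_Mapping.lookup p \<mu>) * (\<Prod>k\<in>UNIV. y k ^ (\<mu> $ k)))" for y
    unfolding prod_one_plus_eq_mesym
    by (simp add: g_def c_def distrib_right sum.distrib sum_distrib_left mult.assoc)
  have glb: "(norm \<zeta> * \<delta> / 2) * (\<Prod>k\<in>UNIV. (1 + norm (y k)) ^ (l $ k)) \<le> norm (g y)"
    if y: "\<And>k. Im (y k) \<ge> 0" for y
  proof -
    let ?P = "\<Prod>k\<in>UNIV. (1 + norm (y k)) ^ (l $ k)"
    let ?h = "\<Prod>k\<in>UNIV. \<Prod>j<l $ k. 1 + w (k, j) * y k"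
    let ?p = "\<Sum>\<mu>\<in>{..l}. of_real (Poly_Mapping.lookup p \<mu>) * (\<Prod>k\<in>UNIV. y k ^ (\<mu> $ k))"
    have P: "?P \<ge> 0" by (intro prod_nonneg) auto
    have "norm (of_real \<epsilon> * ?p) \<le> \<epsilon> * (C * ?P)"
      unfolding norm_mult C_def using \<epsilon> norm_poly_sum_le[of "\<lambda>\<mu>. of_real (Poly_Mapping.lookup p \<mu>)" y l]
      by (simp add: mult_left_mono)
    also have "\<dots> = \<epsilon> * C * ?P" by simp
    also have "\<dots> \<le> norm \<zeta> * \<delta> / 2 * ?P"
      using \<epsilon>C P by (rule mult_right_mono)
    finally have 1: "norm (of_real \<epsilon> * ?p) \<le> norm \<zeta> * \<delta> / 2 * ?P" .
    have "norm \<zeta> * (\<delta> * ?P) \<le> norm \<zeta> * norm ?h"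
      using lb[OF y] by (intro mult_left_mono) auto
    then have 2: "norm \<zeta> * \<delta> * ?P \<le> norm (\<zeta> * ?h)"
      by (simp add: norm_mult mult.assoc)
    have "norm (\<zeta> * ?h) - norm (of_real \<epsilon> * ?p) \<le> norm (g y)"
      unfolding g by (rule norm_diff_ineq)
    with 1 2 show ?thesis by simp
  qed
  have "real_stable (of_coeffs l (\<lambda>\<mu>. Re (\<zeta> * mesym l \<mu> w)) + \<epsilon> *\<^sub>R p)"
    unfolding real_stable_def
  proof (intro disjI2 allI impI)
    fix z :: "complex ^ 'n" assume z: "\<forall>k. 0 < Im (z $ k)"
    have "norm (g (\<lambda>k. cnj (z $ k))) < norm (g (\<lambda>k. z $ k))"
      unfolding g_def
    proof (rule norm_cnj_less_of_lower_bound)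
      show "norm \<zeta> * \<delta> / 2 > 0" using \<zeta> \<delta> by simp
    qed (use glb k0 z in \<open>auto simp: g_def\<close>)
    then have ne: "g (\<lambda>k. z $ k) + cnj (g (\<lambda>k. cnj (z $ k))) \<noteq> 0"
      by (metis add_eq_0_iff complex_mod_cnj less_irrefl norm_minus_cancel)
    have "eval_poly (of_coeffs l (\<lambda>\<mu>. Re (\<zeta> * mesym l \<mu> w)) + \<epsilon> *\<^sub>R p) z
        = (\<Sum>\<mu>\<in>{..l}. of_real (Re (c \<mu>)) * (\<Prod>k\<in>UNIV. z $ k ^ (\<mu> $ k)))"
      by (simp add: eval_poly_add eval_poly_scaleR eval_poly_of_coeffs eval_poly_polys_le[OF p] c_def
          sum_distrib_left distrib_right sum.distrib mult.assoc)
    also have "\<dots> = (\<Sum>\<mu>\<in>{..l}. (c \<mu> * (\<Prod>k\<in>UNIV. z $ k ^ (\<mu> $ k))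
        + cnj (c \<mu> * (\<Prod>k\<in>UNIV. cnj (z $ k) ^ (\<mu> $ k)))) / 2)"
      by (intro sum.cong refl) (simp add: of_real_Re_eq algebra_simps add_divide_distrib)
    also have "\<dots> = (g (\<lambda>k. z $ k) + cnj (g (\<lambda>k. cnj (z $ k)))) / 2"
      by (simp only: g_def cnj_sum sum.distrib sum_divide_distrib[symmetric])
    finally show "eval_poly (of_coeffs l (\<lambda>\<mu>. Re (\<zeta> * mesym l \<mu> w)) + \<epsilon> *\<^sub>R p) z \<noteq> 0"
      using ne by (simp only: divide_eq_0_iff zero_neq_numeral[symmetric] simp_thms)
  qed
  with \<epsilon> show ?thesis by blast
qed

text \<open>Evaluation at a point of the open product of upper half-planes is injective on a space of
  stable polynomials.\<close>

lemma rank_le_2_of_all_stable: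
  fixes T :: "('n::finite) rpoly \<Rightarrow> ('m::finite) rpoly"
  assumes T: "linear_between (polys_le l) W T" and st: "\<And>q. q \<in> polys_le l \<Longrightarrow> real_stable (T q)"
  shows "rank_on (polys_le l) T \<le> 2"
proof -
  define V where "V = T ` polys_le l"
  define ev where "ev = (\<lambda>p :: 'm rpoly. eval_poly p (\<chi> k. \<i>))"
  have lin: "linear ev"
    by (rule linearI) (simp_all add: ev_def eval_poly_add eval_poly_scaleR scaleR_conv_of_real)
  have V: "subspace V"
    unfolding subspace_def
  proof (intro conjI ballI allI)
    show "0 \<in> V"
    proof -
      have "T (0 *\<^sub>R 0) = 0 *\<^sub>R T 0"
        using T polys_le_zero unfolding linear_between_def by blast
      then show ?thesis unfolding V_def using polys_le_zero[of l] by force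
    qed
    fix x assume "x \<in> V"
    then obtain p where p: "p \<in> polys_le l" "x = T p" by (auto simp: V_def)
    show "c *\<^sub>R x \<in> V" for c
    proof -
      have "T (c *\<^sub>R p) = c *\<^sub>R T p"
        using T p unfolding linear_between_def by blast
      then show ?thesis using p polys_le_scaleR[of p l c] unfolding V_def by force
    qed
    fix y assume "y \<in> V"
    then obtain q where q: "q \<in> polys_le l" "y = T q" by (auto simp: V_def)
    have "T (p + q) = T p + T q"
      using T p q unfolding linear_between_def by blast
    then show "x + y \<in> V" using p q polys_le_add[of p l q] unfolding V_def by force
  qed
  obtain B where B: "B \<subseteq> V" "independent B" "card B = dim V"
    using basis_exists by metis
  have sp: "span B \<subseteq> V"
    using B V by (simp add: span_minimal)
  have inj: "inj_on ev (span B)"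
  proof (rule inj_onI)
    fix f g assume fg: "f \<in> span B" "g \<in> span B" "ev f = ev g"
    then have "f - g \<in> V" using sp span_diff by blast
    then have "real_stable (f - g)" using st by (auto simp: V_def)
    moreover have "eval_poly (f - g) (\<chi> k. \<i>) = 0"
      using fg linear_diff[OF lin, of f g] by (simp add: ev_def)
    ultimately show "f = g" unfolding real_stable_def by force
  qed
  have "independent (ev ` B)"
    using linear_independent_injective_image[OF lin B(2) inj] .
  \<comment> \<open>The complex numbers have real dimension 2.\<close>
  then have "card (ev ` B) \<le> 2"
    using independent_bound by fastforce
  moreover have "card (ev ` B) = card B"
    by (intro card_image inj_on_subset[OF inj] span_superset)
  ultimately show ?thesis
    using B by (simp add: rank_on_def V_def)
qed

section \<open>Zeros of the polarized symbol\<close>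

text \<open>The value at \<open>x\<close> of \<open>T\<close> applied coefficientwise to h_w. As a
  polynomial in \<open>w\<close> it is also the polarization of the symbol, the binomials having
  cancelled.\<close>

definition symbol_eval ::
    "nat ^ 'n \<Rightarrow> (('n::finite) rpoly \<Rightarrow> ('m::finite) rpoly) \<Rightarrow> ('n \<times> nat \<Rightarrow> 'a::real_field) \<Rightarrow> 'a ^ 'm \<Rightarrow> 'a" where
  "symbol_eval l T w x = (\<Sum>\<mu>\<in>{..l}. mesym l \<mu> w * eval_poly (T (monomial \<mu>)) x)"

lemma continuous_on_symbol_eval [continuous_intros]:
  fixes w :: "'b::topological_space \<Rightarrow> 'n::finite \<times> nat \<Rightarrow> 'a::{real_field, real_normed_field}"
  assumes "\<And>i. continuous_on A (\<lambda>s. w s i)" "\<And>k. continuous_on A (\<lambda>s. x s $ k)"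
  shows "continuous_on A (\<lambda>s. symbol_eval l T (w s) (x s))"
  unfolding symbol_eval_def mesym_def esym_def eval_poly_def
  by (intro continuous_on_sum continuous_on_mult continuous_on_prod continuous_on_power continuous_on_const assms)

lemma holomorphic_on_symbol_eval [holomorphic_intros]:
  assumes "\<And>i. (\<lambda>s. w s i) holomorphic_on A"
  shows "(\<lambda>s. symbol_eval l T (w s) x) holomorphic_on A"
  unfolding symbol_eval_def mesym_def esym_def using assms
  by (intro holomorphic_intros) auto

context
  fixes l :: "nat ^ 'n::finite" and W :: "'m::finite rpoly set" and T :: "'n rpoly \<Rightarrow> 'm rpoly"
  assumes T: "linear_between (polys_le l) W T"
    and rank: "rank_on (polys_le l) T > 2"
    and stab: "preserves_real_stability l T"
begin

text \<open>Otherwise every input is a constant, hence stable, and so is every image, against the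
  rank. A variable of positive degree makes the comparison with the conjugate point strict.\<close>

lemma degree_bound_nonzero: "\<exists>k. l $ k > 0"
proof (rule ccontr)
  assume "\<not> ?thesis"
  then have l: "l $ k = 0" for k by auto
  have "real_stable (T q)" if q: "q \<in> polys_le l" for q
  proof -
    have \<mu>: "\<mu> = l" if "\<mu> \<le> l" for \<mu>
      using that l by (simp add: vec_eq_iff less_eq_vec_def)
    then have a: "{..l} = {l}" by auto
    have "eval_poly q z = of_real (Poly_Mapping.lookup q l)" for z :: "complex ^ 'n"
      unfolding eval_poly_polys_le[OF q] a using l by simp
    moreover have "q = 0" if "Poly_Mapping.lookup q l = 0"
    proof (rule poly_mapping_eqI)
      fix \<nu>
      show "Poly_Mapping.lookup q \<nu> = Poly_Mapping.lookup 0 \<nu>"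
        using that q \<mu>[of \<nu>] by (cases "\<nu> \<in> Poly_Mapping.keys q") (auto simp: polys_le_def in_keys_iff)
    qed
    ultimately have "real_stable q" unfolding real_stable_def by auto
    then show ?thesis using stab q unfolding preserves_real_stability_def by blast
  qed
  then show False using rank_le_2_of_all_stable[OF T] rank by simp
qed

text \<open>If the image were 0, then for every \<open>q\<close> the stable perturbation by
  \<open>\<epsilon> *\<^sub>R q\<close> would map to \<open>\<epsilon> *\<^sub>R T q\<close>. All
  images would be stable, which the rank excludes.\<close>

lemma image_of_interior_nonzero:
  assumes w: "\<And>i. i \<in> polar_index l \<Longrightarrow> Im (w i) < 0" and \<zeta>: "\<zeta> \<noteq> 0"
  shows "T (of_coeffs l (\<lambda>\<mu>. Re (\<zeta> * mesym l \<mu> w))) \<noteq> 0"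
proof
  let ?F = "of_coeffs l (\<lambda>\<mu>. Re (\<zeta> * mesym l \<mu> w))"
  assume 0: "T ?F = 0"
  obtain k0 where k0: "l $ k0 > 0" using degree_bound_nonzero by blast
  have "real_stable (T q)" if q: "q \<in> polys_le l" for q
  proof -
    obtain \<epsilon> where \<epsilon>: "\<epsilon> > 0" "real_stable (?F + \<epsilon> *\<^sub>R q)"
      using real_stable_perturbation[where w = w and l = l] w \<zeta> q k0 by blast
    have F: "?F \<in> polys_le l" "\<epsilon> *\<^sub>R q \<in> polys_le l"
      using q by (auto intro: of_coeffs_polys_le polys_le_scaleR)
    have "T (?F + \<epsilon> *\<^sub>R q) = T ?F + T (\<epsilon> *\<^sub>R q)" "T (\<epsilon> *\<^sub>R q) = \<epsilon> *\<^sub>R T q"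
      using T F q unfolding linear_between_def by blast+
    then have "T (?F + \<epsilon> *\<^sub>R q) = \<epsilon> *\<^sub>R T q" using 0 by simp
    moreover have "real_stable (T (?F + \<epsilon> *\<^sub>R q))"
      using stab \<epsilon>(2) F polys_le_add unfolding preserves_real_stability_def by blast
    ultimately show ?thesis using \<epsilon>(1) by (simp add: real_stable_scaleR_iff)
  qed
  then show False using rank_le_2_of_all_stable[OF T] rank by simp
qed

text \<open>Equal moduli allow a choice of \<open>\<zeta>\<close> for which the image of the real
  polynomial Re (\<zeta> h_w) vanishes at \<open>x\<close>, although this image is stable and
  non-zero.\<close>

lemma norm_symbol_eval_cnj_neq:
  assumes w: "\<And>i. i \<in> polar_index l \<Longrightarrow> Im (w i) < 0" and x: "\<And>k. Im (x $ k) > 0"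
  shows "norm (symbol_eval l T w x) \<noteq> norm (symbol_eval l T (\<lambda>i. cnj (w i)) x)"
proof
  let ?a = "symbol_eval l T w x" and ?b = "symbol_eval l T (\<lambda>i. cnj (w i)) x"
  assume eq: "norm ?a = norm ?b"
  obtain \<zeta> where \<zeta>: "\<zeta> \<noteq> 0" "\<zeta> * ?a + cnj \<zeta> * ?b = 0"
  proof (cases "?a = 0")
    case True
    moreover from this have "?b = 0" using eq by (metis norm_eq_zero)
    ultimately show ?thesis using that[of 1] by simp
  next
    case False
    \<comment> \<open>For a square root \<open>c\<close> of this unimodular number,
      \<open>c * ?a\<close> and \<open>cnj c * ?b\<close> cancel.\<close>
    define u where "u = - ?b / ?a"
    have "norm ?b \<noteq> 0" using False eq by (metis norm_eq_zero)
    then have u: "norm u = 1" using eq by (simp add: u_def norm_divide)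
    define c where "c = csqrt u"
    have c: "c\<^sup>2 = u" "norm c = 1" using u by (simp_all add: c_def)
    then have cc: "c * cnj c = 1" by (simp flip: complex_norm_square)
    have "c * ?a + cnj c * ?b = (c * cnj c) * c * ?a + cnj c * ?b"
      by (simp add: cc)
    also have "\<dots> = cnj c * (c\<^sup>2 * ?a + ?b)"
      by (simp add: power2_eq_square algebra_simps)
    also have "c\<^sup>2 * ?a + ?b = 0"
      using False by (simp add: c u_def)
    finally show ?thesis using that[of c] c by force
  qed
  let ?F = "of_coeffs l (\<lambda>\<mu>. Re (\<zeta> * mesym l \<mu> w))"
  have "real_stable ?F"
  proof -
    obtain k0 where "l $ k0 > 0" using degree_bound_nonzero by blast
    then show ?thesis
      using real_stable_perturbation[where w = w and l = l, OF w \<zeta>(1) polys_le_zero] by auto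
  qed
  then have "real_stable (T ?F)"
    using stab of_coeffs_polys_le unfolding preserves_real_stability_def by blast
  moreover have "T ?F \<noteq> 0"
    using w \<zeta>(1) by (rule image_of_interior_nonzero)
  ultimately have "eval_poly (T ?F) x \<noteq> 0"
    using x unfolding real_stable_def by blast
  moreover have "eval_poly (T ?F) x = (\<zeta> * ?a + cnj \<zeta> * ?b) / 2"
  proof -
    have "eval_poly (T ?F) x = (\<Sum>\<mu>\<in>{..l}. of_real (Re (\<zeta> * mesym l \<mu> w)) * eval_poly (T (monomial \<mu>)) x)"
      unfolding eval_poly_linear_between[OF T of_coeffs_polys_le]
      by (intro sum.cong refl) (simp only: lookup_of_coeffs atMost_iff if_True)
    also have "\<dots> = (\<Sum>\<mu>\<in>{..l}. (\<zeta> * (mesym l \<mu> w * eval_poly (T (monomial \<mu>)) x)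
        + cnj \<zeta> * (mesym l \<mu> (\<lambda>i. cnj (w i)) * eval_poly (T (monomial \<mu>)) x)) / 2)"
      by (simp only: of_real_Re_eq complex_cnj_mult cnj_mesym) (simp add: algebra_simps add_divide_distrib)
    also have "\<dots> = (\<zeta> * ?a + cnj \<zeta> * ?b) / 2"
      by (simp only: symbol_eval_def sum_distrib_left sum.distrib sum_divide_distrib[symmetric])
    finally show ?thesis .
  qed
  ultimately show False using \<zeta>(2) by simp
qed

text \<open>The difference \<open>D\<close> of the two moduli has no zeros on the convex region
  \<open>R\<close>, hence constant sign by the intermediate value theorem along segments. The larger
  modulus is positive, and its side decides the half-plane.\<close>

lemma symbol_eval_dichotomy:
  "(\<forall>w x. (\<forall>i\<in>polar_index l. Im (w i) < 0) \<and> (\<forall>k. Im (x $ k) > 0) \<longrightarrow> symbol_eval l T w x \<noteq> 0) \<or>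
   (\<forall>w x. (\<forall>i\<in>polar_index l. Im (w i) > 0) \<and> (\<forall>k. Im (x $ k) > 0) \<longrightarrow> symbol_eval l T w x \<noteq> 0)"
proof -
  define D where "D = (\<lambda>w x. norm (symbol_eval l T w x) - norm (symbol_eval l T (\<lambda>i. cnj (w i)) x))"
  define R where "R = (\<lambda>(w :: 'n \<times> nat \<Rightarrow> complex) (x :: complex ^ 'm).
    (\<forall>i\<in>polar_index l. Im (w i) < 0) \<and> (\<forall>k. Im (x $ k) > 0))"
  have D0: "D w x \<noteq> 0" if "R w x" for w x
    using norm_symbol_eval_cnj_neq[of w x] that by (auto simp: D_def R_def)
  have pos: "D w1 x1 > 0" if 0: "R w0 x0" "D w0 x0 > 0" and 1: "R w1 x1" for w0 x0 w1 x1
  proof (rule ccontr)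
    assume neg: "\<not> D w1 x1 > 0"
    define w where "w = (\<lambda>s i. of_real (1 - s) * w1 i + of_real s * w0 i)"
    define x where "x = (\<lambda>s. \<chi> k. of_real (1 - s) * x1 $ k + of_real s * x0 $ k)"
    have "\<exists>s. 0 \<le> s \<and> s \<le> 1 \<and> D (w s) (x s) = 0"
    proof (rule IVT')
      show "continuous_on {0..1} (\<lambda>s. D (w s) (x s))"
        unfolding D_def w_def x_def by (intro continuous_intros)
    qed (use neg 0 in \<open>auto simp: w_def x_def\<close>)
    then obtain s where s: "0 \<le> s" "s \<le> 1" "D (w s) (x s) = 0" by blast
    have "R (w s) (x s)"
    proof -
      have "(1 - s) * a + s * b > 0" if "a > 0" "b > 0" for a b
        using s that by (cases "s = 0") (auto intro!: add_nonneg_pos)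
      moreover have "(1 - s) * a + s * b < 0" if "a < 0" "b < 0" for a b
        using calculation[of "-a" "-b"] that by (simp add: algebra_simps)
      ultimately show ?thesis
        using 0(1) 1 by (auto simp: R_def w_def x_def)
    qed
    with D0 s show False by blast
  qed
  show ?thesis
  proof (cases "\<exists>w x. R w x \<and> D w x > 0")
    case True
    then have "D w x > 0" if "R w x" for w x
      using pos that by blast
    then have "symbol_eval l T w x \<noteq> 0" if "R w x" for w x
      using that by (force simp: D_def)
    then show ?thesis by (auto simp: R_def)
  next
    case False
    then have "D w x < 0" if "R w x" for w x
      using D0 that by (meson linorder_neqE_linordered_idom)
    then have "symbol_eval l T (\<lambda>i. cnj (w i)) x \<noteq> 0" if "R w x" for w x
      using that by (force simp: D_def)
    then have "symbol_eval l T w x \<noteq> 0" if "R (\<lambda>i. cnj (w i)) x" for w x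
      using that by fastforce
    then show ?thesis by (auto simp: R_def)
  qed
qed

text \<open>The real point is approached by adding \<open>\<i> * e\<close> to each coordinate, and
  Hurwitz is applied on the line from \<open>w0\<close> to \<open>w1\<close>. The sign of
  \<open>\<sigma>\<close> selects the upper or the lower half-plane for \<open>w\<close>.\<close>

lemma symbol_eval_real_limit:
  fixes x :: "real ^ 'm" and \<sigma> :: real
  assumes nz: "\<And>w x. \<lbrakk>\<And>i. i \<in> polar_index l \<Longrightarrow> \<sigma> * Im (w i) > 0; \<And>k. Im (x $ k) > 0\<rbrakk>
      \<Longrightarrow> symbol_eval l T w x \<noteq> 0"
    and w0: "\<And>i. i \<in> polar_index l \<Longrightarrow> \<sigma> * Im (w0 i) > 0"
    and w1: "\<And>i. i \<in> polar_index l \<Longrightarrow> \<sigma> * Im (w1 i) > 0"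
    and 0: "symbol_eval l T w0 (\<chi> k. of_real (x $ k)) = 0"
  shows "symbol_eval l T w1 (\<chi> k. of_real (x $ k)) = 0"
proof -
  \<comment> \<open>The second condition always holds; it gives the set the shape of
    \<open>half_planes_line\<close>.\<close>
  define S where "S = {s. \<forall>i\<in>polar_index l. Im (of_real \<sigma> * w0 i + s * (of_real \<sigma> * w1 i - of_real \<sigma> * w0 i)) > 0
     \<and> Im (- \<i> + s * (- \<i> - - \<i>)) < 0}"
  have S: "open S" "connected S"
    unfolding S_def
    by (rule half_planes_line[OF finite_polar_index], rule convex_connected[OF half_planes_line(2)[OF finite_polar_index]])
  have S': "\<sigma> * Im (w0 i + s * (w1 i - w0 i)) > 0" if "s \<in> S" "i \<in> polar_index l" for s i
    using that by (auto simp: S_def algebra_simps)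
  define f where "f = (\<lambda>e s. symbol_eval l T (\<lambda>i. w0 i + s * (w1 i - w0 i)) (\<chi> k. of_real (x $ k) + \<i> * of_real e))"
  have "f 0 1 = 0"
  proof (rule Hurwitz_family[OF S, of f 0])
    show "continuous_on ({0..1} \<times> S) (\<lambda>(e, s). f e s)"
      unfolding f_def case_prod_beta by (intro continuous_intros)
    show "f e holomorphic_on S" for e
      unfolding f_def by (intro holomorphic_intros)
    show "f e s \<noteq> 0" if "0 < e" "s \<in> S" for e s
      unfolding f_def using that by (intro nz S') auto
    show "f 0 0 = 0" using 0 by (simp add: f_def)
  qed (use w0 w1 in \<open>auto simp: S_def\<close>)
  then show ?thesis by (simp add: f_def)
qed

lemma symbol_eval_real_dichotomy:
  fixes x :: "real ^ 'm" and \<sigma> :: real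
  assumes nz: "\<And>w x. \<lbrakk>\<And>i. i \<in> polar_index l \<Longrightarrow> \<sigma> * Im (w i) > 0; \<And>k. Im (x $ k) > 0\<rbrakk>
      \<Longrightarrow> symbol_eval l T w x \<noteq> 0"
  shows "(\<forall>w. (\<forall>i\<in>polar_index l. \<sigma> * Im (w i) > 0) \<longrightarrow> symbol_eval l T w (\<chi> k. of_real (x $ k)) \<noteq> 0) \<or>
    (\<forall>w. (\<forall>i\<in>polar_index l. \<sigma> * Im (w i) > 0) \<longrightarrow> symbol_eval l T w (\<chi> k. complex_of_real (x $ k)) = 0)"
proof (cases "\<exists>w0. (\<forall>i\<in>polar_index l. \<sigma> * Im (w0 i) > 0) \<and> symbol_eval l T w0 (\<chi> k. complex_of_real (x $ k)) = 0")
  case True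
  then obtain w0 where "\<And>i. i \<in> polar_index l \<Longrightarrow> \<sigma> * Im (w0 i) > 0"
    "symbol_eval l T w0 (\<chi> k. complex_of_real (x $ k)) = 0" by blast
  from symbol_eval_real_limit[OF nz this(1) _ this(2)] show ?thesis by simp
qed auto

text \<open>At a real point the polarized symbol has real coefficients, so conjugating
  \<open>w\<close> carries the upper alternative of the dichotomy over to the lower
  half-planes.\<close>

theorem symbol_stable_at_positive:
  fixes x :: "real ^ 'm"
  shows "(\<forall>w. (\<forall>i\<in>polar_index l. Im (w i) < 0) \<longrightarrow> symbol_eval l T w (\<chi> k. of_real (x $ k)) \<noteq> 0) \<or>
    (\<forall>w. (\<forall>i\<in>polar_index l. Im (w i) < 0) \<longrightarrow> symbol_eval l T w (\<chi> k. complex_of_real (x $ k)) = 0)"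
  using symbol_eval_dichotomy
proof
  assume "\<forall>w x. (\<forall>i\<in>polar_index l. Im (w i) < 0) \<and> (\<forall>k. Im (x $ k) > 0) \<longrightarrow> symbol_eval l T w x \<noteq> 0"
  then show ?thesis
    using symbol_eval_real_dichotomy[of "-1" x] by simp
next
  assume "\<forall>w x. (\<forall>i\<in>polar_index l. Im (w i) > 0) \<and> (\<forall>k. Im (x $ k) > 0) \<longrightarrow> symbol_eval l T w x \<noteq> 0"
  then have *: "(\<forall>w. (\<forall>i\<in>polar_index l. Im (w i) > 0) \<longrightarrow> symbol_eval l T w (\<chi> k. of_real (x $ k)) \<noteq> 0) \<or>
    (\<forall>w. (\<forall>i\<in>polar_index l. Im (w i) > 0) \<longrightarrow> symbol_eval l T w (\<chi> k. complex_of_real (x $ k)) = 0)"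
    using symbol_eval_real_dichotomy[of 1 x] by simp
  have "symbol_eval l T (\<lambda>i. cnj (w i)) (\<chi> k. of_real (x $ k)) = cnj (symbol_eval l T w (\<chi> k. of_real (x $ k)))" for w
    by (simp add: symbol_eval_def cnj_mesym eval_poly_def)
  then have c: "symbol_eval l T (\<lambda>i. cnj (w i)) (\<chi> k. of_real (x $ k)) = 0 \<longleftrightarrow> symbol_eval l T w (\<chi> k. of_real (x $ k)) = 0" for w
    by simp
  show ?thesis
    using * c by (metis complex_cnj_cnj cnj.sel(2) neg_0_less_iff_less)
qed

end

section \<open>Capacity\<close>

lemma prod_powr_eq_exp_inner:
  fixes x \<alpha> :: "real ^ 'n::finite"
  assumes "\<And>k. x $ k > 0"
  shows "(\<Prod>k\<in>UNIV. x $ k powr \<alpha> $ k) = exp (\<alpha> \<bullet> (\<chi> k. ln (x $ k)))"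
  using assms by (simp add: powr_def inner_vec_def exp_sum less_imp_neq[symmetric])

lemma prod_powr_pos:
  fixes x \<alpha> :: "real ^ 'n::finite"
  assumes "\<And>k. x $ k > 0"
  shows "(\<Prod>k\<in>UNIV. x $ k powr \<alpha> $ k) > 0"
  using assms by (simp add: prod_powr_eq_exp_inner)

lemma prod_power_eq_powr:
  fixes x :: "real ^ 'n::finite"
  assumes "\<And>k. x $ k > 0"
  shows "(\<Prod>k\<in>UNIV. x $ k ^ (\<mu> $ k)) = (\<Prod>k\<in>UNIV. x $ k powr real_vec \<mu> $ k)"
  using assms by (simp add: real_vec_def powr_realpow)

lemma eval_poly_nonneg:
  fixes x :: "real ^ 'n::finite"
  assumes "\<And>\<mu>. Poly_Mapping.lookup p \<mu> \<ge> 0" "\<And>k. x $ k > 0"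
  shows "eval_poly p x \<ge> 0"
  unfolding eval_poly_def using assms
  by (auto intro!: sum_nonneg mult_nonneg_nonneg prod_nonneg zero_le_power simp: less_imp_le)

lemma Cap_le:
  assumes "\<And>\<mu>. Poly_Mapping.lookup p \<mu> \<ge> 0" "\<And>k. x $ k > 0"
  shows "Cap \<alpha> p \<le> eval_poly p x / (\<Prod>k\<in>UNIV. x $ k powr \<alpha> $ k)"
  unfolding Cap_def
proof (rule cINF_lower)
  show "bdd_below ((\<lambda>x. eval_poly p x / (\<Prod>k\<in>UNIV. x $ k powr \<alpha> $ k)) ` {x. \<forall>k. 0 < x $ k})"
    using assms(1) by (intro bdd_belowI2[of _ 0] divide_nonneg_pos eval_poly_nonneg prod_powr_pos) auto
qed (use assms in auto)

lemma Cap_greatest: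
  assumes "\<And>x. (\<And>k. x $ k > 0) \<Longrightarrow> c \<le> eval_poly p x / (\<Prod>k\<in>UNIV. x $ k powr \<alpha> $ k)"
  shows "c \<le> Cap \<alpha> p"
  unfolding Cap_def
proof (rule cINF_greatest)
  show "{x :: real ^ 'a. \<forall>k. 0 < x $ k} \<noteq> {}"
    by (auto intro!: exI[of _ "\<chi> k. 1"])
qed (use assms in auto)

lemma Cap_mult_le:
  assumes "\<And>\<mu>. Poly_Mapping.lookup p \<mu> \<ge> 0" "\<And>k. x $ k > 0"
  shows "Cap \<alpha> p * (\<Prod>k\<in>UNIV. x $ k powr \<alpha> $ k) \<le> eval_poly p x"
  using Cap_le[OF assms, of \<alpha>] prod_powr_pos[OF assms(2), of \<alpha>] by (simp add: field_simps)

lemma Cap_nonneg: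
  assumes "\<And>\<mu>. Poly_Mapping.lookup p \<mu> \<ge> 0"
  shows "Cap \<alpha> p \<ge> 0"
  using assms by (intro Cap_greatest divide_nonneg_pos eval_poly_nonneg prod_powr_pos) auto

text \<open>In logarithmic coordinates \<open>L\<close> every exponent lies in the half-space
  \<open>L \<bullet> v \<le> ln S\<close>, where \<open>S\<close> is the sum of the monomials; hence
  so does \<open>\<alpha>\<close>. The least non-zero coefficient is then a lower bound for the
  capacity.\<close>

lemma Cap_pos:
  fixes p :: "('n::finite) rpoly"
  assumes nn: "\<And>\<mu>. Poly_Mapping.lookup p \<mu> \<ge> 0" and \<alpha>: "\<alpha> \<in> Newt p"
  shows "Cap \<alpha> p > 0"
proof -
  let ?K = "Poly_Mapping.keys p"
  have ne: "?K \<noteq> {}" using \<alpha> by (auto simp: Newt_def)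
  define c where "c = Min (Poly_Mapping.lookup p ` ?K)"
  have "Poly_Mapping.lookup p \<mu> > 0" if "\<mu> \<in> ?K" for \<mu>
    using nn[of \<mu>] that by (simp add: in_keys_iff less_le)
  then have c0: "c > 0"
    unfolding c_def using ne by (subst Min_gr_iff) auto
  have c: "c \<le> Poly_Mapping.lookup p \<mu>" if "\<mu> \<in> ?K" for \<mu>
    unfolding c_def using that by (intro Min_le) auto
  have "c \<le> Cap \<alpha> p"
  proof (rule Cap_greatest)
    fix x :: "real ^ 'n" assume x: "\<And>k. x $ k > 0"
    define L where "L = (\<chi> k. ln (x $ k))"
    have m: "(\<Prod>k\<in>UNIV. x $ k ^ (\<mu> $ k)) = exp (real_vec \<mu> \<bullet> L)" for \<mu>
      unfolding prod_power_eq_powr[OF x] L_def by (rule prod_powr_eq_exp_inner[OF x])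
    define S where "S = (\<Sum>\<mu>\<in>?K. exp (real_vec \<mu> \<bullet> L))"
    have S0: "S > 0" unfolding S_def using ne by (intro sum_pos) auto
    have "real_vec ` ?K \<subseteq> {v. L \<bullet> v \<le> ln S}"
    proof clarsimp
      fix \<mu> assume "\<mu> \<in> ?K"
      then have "exp (real_vec \<mu> \<bullet> L) \<le> S"
        unfolding S_def by (intro member_le_sum) auto
      then show "L \<bullet> real_vec \<mu> \<le> ln S"
        using S0 by (simp add: ln_ge_iff inner_commute)
    qed
    then have "Newt p \<subseteq> {v. L \<bullet> v \<le> ln S}"
      unfolding Newt_def by (rule hull_minimal) (rule convex_halfspace_le)
    then have "\<alpha> \<bullet> L \<le> ln S" using \<alpha> by (auto simp: inner_commute)
    then have "exp (\<alpha> \<bullet> L) \<le> S"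
      using S0 by (simp add: ln_ge_iff)
    then have "c * exp (\<alpha> \<bullet> L) \<le> c * S" using c0 by simp
    also have "\<dots> \<le> eval_poly p x"
      unfolding S_def eval_poly_def m sum_distrib_left using c by (intro sum_mono mult_right_mono) auto
    finally show "c \<le> eval_poly p x / (\<Prod>k\<in>UNIV. x $ k powr \<alpha> $ k)"
      unfolding prod_powr_eq_exp_inner[OF x] L_def[symmetric] by (simp add: le_divide_eq)
  qed
  with c0 show ?thesis by simp
qed

section \<open>The constant of the bound\<close>

lemma self_pow_divide_power:
  assumes "0 \<le> a" "N > 0"
  shows "self_pow (a / real N) ^ N = self_pow a / real N powr a"
proof (cases "a = 0")
  case False
  then have "((a / real N) powr (a / real N)) ^ N = (a / real N) powr (a / real N * real N)"
    using assms by (simp add: powr_powr flip: powr_realpow)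
  also have "\<dots> = a powr a / real N powr a"
    using assms by (simp add: powr_divide)
  finally show ?thesis using False assms by (simp add: self_pow_def)
qed (use assms in \<open>simp add: self_pow_def\<close>)

text \<open>The \<open>N\<close> copies of one variable, contracted with exponent
  \<open>a / N\<close> each, together lose exactly the factor of that variable in the final
  constant.\<close>

lemma contraction_const_power:
  assumes "0 \<le> a" "a \<le> real N"
  shows "contraction_const (a / real N) ^ N = self_pow a * self_pow (real N - a) / self_pow (real N)"
proof (cases "N = 0")
  case False
  have "1 - a / real N = (real N - a) / real N"
    using False by (simp add: field_simps)
  then have "contraction_const (a / real N) ^ N =
      (self_pow a / real N powr a) * (self_pow (real N - a) / real N powr (real N - a))"
    using False assms by (simp add: contraction_const_def power_mult_distrib self_pow_divide_power)
  also have "\<dots> = self_pow a * self_pow (real N - a) / (real N powr a * real N powr (real N - a))"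
    by simp
  also have "real N powr a * real N powr (real N - a) = self_pow (real N)"
    using False by (simp add: self_pow_def flip: powr_add)
  finally show ?thesis .
qed (use assms in \<open>simp add: self_pow_def\<close>)

lemma contraction_const_pos: "\<lbrakk>0 \<le> t; t \<le> 1\<rbrakk> \<Longrightarrow> contraction_const t > 0"
  by (simp add: contraction_const_def self_pow_pos)

text \<open>For \<open>t\<close> strictly between 0 and 1 this is weighted AM-GM for
  \<open>1 / (1 - t)\<close> and \<open>s / t\<close>, whose weighted mean is
  \<open>1 + s\<close>.\<close>

lemma powr_le_one_plus_mult_contraction_const:
  assumes "0 \<le> t" "t \<le> 1" "s > 0"
  shows "s powr t \<le> (1 + s) * contraction_const t"
proof -
  consider "t = 0" | "t = 1" | "0 < t" "t < 1" using assms by linarith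
  then show ?thesis
  proof cases
    case 3
    have "(1 / (1 - t)) powr (1 - t) * (s / t) powr t \<le> (1 - t) * (1 / (1 - t)) + t * (s / t)"
      using 3 assms by (intro Youngs_inequality_0) auto
    then have "(1 / (1 - t)) powr (1 - t) * (s / t) powr t \<le> 1 + s"
      using 3 by simp
    moreover have "(1 / (1 - t)) powr (1 - t) * (s / t) powr t = s powr t / contraction_const t"
      using 3 assms by (simp add: powr_divide contraction_const_def self_pow_def)
    ultimately show ?thesis
      using contraction_const_pos[OF assms(1,2)] by (simp add: divide_le_eq)
  qed (use assms in \<open>auto simp: contraction_const_def self_pow_def\<close>)
qed

lemma powr_le_one_plus_power:
  assumes "0 \<le> a" "a \<le> real N" "s > 0"
  shows "s powr a \<le> (1 + s) ^ N * (self_pow a * self_pow (real N - a) / self_pow (real N))"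
proof (cases "N = 0")
  case False
  then have t: "0 \<le> a / real N" "a / real N \<le> 1" using assms by auto
  have "s powr a = (s powr (a / real N)) ^ N"
    using False assms by (simp add: powr_powr flip: powr_realpow)
  also have "\<dots> \<le> ((1 + s) * contraction_const (a / real N)) ^ N"
    using powr_le_one_plus_mult_contraction_const[OF t assms(3)] by (intro power_mono) auto
  finally show ?thesis
    using contraction_const_power[OF assms(1,2)] by (simp add: power_mult_distrib)
qed (use assms in \<open>simp add: self_pow_def\<close>)

definition capacity_const :: "nat ^ 'n \<Rightarrow> real ^ 'n \<Rightarrow> real" where
  "capacity_const l \<alpha> = self_power \<alpha> * self_power (real_vec l - \<alpha>) / self_power (real_vec (l :: nat ^ 'n::finite))"

lemma capacity_const_eq_prod:
  "capacity_const l \<alpha> =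
    (\<Prod>k\<in>UNIV. self_pow (\<alpha> $ k) * self_pow (real (l $ k) - \<alpha> $ k) / self_pow (real (l $ k)))"
  by (simp add: capacity_const_def self_power_def self_pow_def real_vec_def prod.distrib prod_dividef cong: if_cong)

lemma capacity_const_pos:
  assumes "0 \<le> \<alpha>" "\<alpha> \<le> real_vec l"
  shows "capacity_const l \<alpha> > 0"
  unfolding capacity_const_eq_prod using assms
  by (intro prod_pos) (auto simp: less_eq_vec_def real_vec_def self_pow_pos)

lemma prod_polar_index:
  fixes l :: "nat ^ 'n::finite"
  shows "(\<Prod>i\<in>polar_index l. f i) = (\<Prod>k\<in>UNIV. \<Prod>j<l $ k. f (k, j))"
  unfolding polar_index_def by (subst prod.Sigma) auto

lemma prod_contraction_const_polar_index:
  assumes "0 \<le> \<alpha>" "\<alpha> \<le> real_vec l"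
  shows "(\<Prod>i\<in>polar_index l. contraction_const (\<alpha> $ fst i / real (l $ fst i))) = capacity_const l \<alpha>"
  unfolding prod_polar_index capacity_const_eq_prod
proof (rule prod.cong[OF refl])
  fix k
  have "0 \<le> \<alpha> $ k" "\<alpha> $ k \<le> real (l $ k)"
    using assms by (auto simp: less_eq_vec_def real_vec_def)
  then show "(\<Prod>j<l $ k. contraction_const (\<alpha> $ fst (k, j) / real (l $ fst (k, j)))) =
      self_pow (\<alpha> $ k) * self_pow (real (l $ k) - \<alpha> $ k) / self_pow (real (l $ k))"
    by (simp add: contraction_const_power)
qed

lemma prod_vec_append_powr:
  fixes z :: "real ^ 'n::finite" and x :: "real ^ 'm::finite"
  shows "(\<Prod>i\<in>UNIV. vec_append z x $ i powr (vec_append \<alpha> \<beta> $ i)) =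
    (\<Prod>k\<in>UNIV. z $ k powr (\<alpha> $ k)) * (\<Prod>k\<in>UNIV. x $ k powr (\<beta> $ k))"
proof -
  have "(\<Prod>i\<in>(UNIV :: ('n + 'm) set). vec_append z x $ i powr (vec_append \<alpha> \<beta> $ i)) =
    (\<Prod>i\<in>UNIV <+> UNIV. vec_append z x $ i powr (vec_append \<alpha> \<beta> $ i))"
    by simp
  also have "\<dots> = (\<Prod>k\<in>UNIV. z $ k powr (\<alpha> $ k)) * (\<Prod>k\<in>UNIV. x $ k powr (\<beta> $ k))"
    by (subst prod.Plus) (simp_all add: vec_append_def)
  finally show ?thesis .
qed

lemma vec_append_pos:
  assumes "\<And>k. z $ k > (0::real)" "\<And>k. x $ k > 0"
  shows "vec_append z x $ i > 0"
  using assms by (cases i) (auto simp: vec_append_def)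

lemma vec_append_split: "vec_append (\<chi> k. v $ Inl k) (\<chi> k. v $ Inr k) = v"
  by (simp add: vec_append_def vec_eq_iff split: sum.split)

text \<open>A variable of degree 0 gets the value \<open>1 powr 0 = 1\<close>, so the point is
  always positive.\<close>

definition geom_means :: "nat ^ 'n \<Rightarrow> ('n \<times> nat \<Rightarrow> real) \<Rightarrow> real ^ ('n::finite)" where
  "geom_means l y = (\<chi> k. (\<Prod>j<l $ k. y (k, j)) powr (1 / real (l $ k)))"

lemma geom_means_pos:
  assumes "\<And>i. i \<in> polar_index l \<Longrightarrow> y i > 0"
  shows "geom_means l y $ k > 0"
proof -
  have "(\<Prod>j<l $ k. y (k, j)) > 0"
    using assms by (intro prod_pos) (auto simp: polar_index_def)
  then show ?thesis
    unfolding geom_means_def vec_lambda_beta powr_gt_zero by (rule less_imp_neq[symmetric])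
qed

lemma prod_polar_index_powr:
  fixes l :: "nat ^ 'n::finite"
  assumes "\<And>i. i \<in> polar_index l \<Longrightarrow> y i > 0"
  shows "(\<Prod>i\<in>polar_index l. y i powr (\<alpha> $ fst i / real (l $ fst i))) = (\<Prod>k\<in>UNIV. geom_means l y $ k powr \<alpha> $ k)"
  unfolding prod_polar_index
proof (rule prod.cong[OF refl])
  fix k
  have "(\<Prod>j<l $ k. y (k, j) powr (\<alpha> $ k / real (l $ k))) = (\<Prod>j<l $ k. y (k, j)) powr (\<alpha> $ k / real (l $ k))"
    by (rule prod_powr_distrib[symmetric])
  then show "(\<Prod>j<l $ k. y (k, j) powr (\<alpha> $ fst (k, j) / real (l $ fst (k, j)))) = geom_means l y $ k powr \<alpha> $ k"
    by (simp add: geom_means_def powr_powr)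
qed

section \<open>Extremal polynomials\<close>

text \<open>The product of the powers \<open>(1 + z $ k * x $ k) ^ (l $ k)\<close>, given by
  coefficients so that \<open>T\<close> can be applied monomial by monomial.\<close>

definition product_poly :: "nat ^ 'n \<Rightarrow> real ^ 'n \<Rightarrow> ('n::finite) rpoly" where
  "product_poly l z = of_coeffs l (\<lambda>\<mu>. real (multi_choose l \<mu>) * (\<Prod>k\<in>UNIV. z $ k ^ (\<mu> $ k)))"

lemma eval_product_poly:
  "eval_poly (product_poly l z) y = (\<Prod>k\<in>UNIV. (1 + of_real (z $ k) * y $ k) ^ (l $ k))"
proof -
  have "(1 + of_real (z $ k) * y $ k) ^ (l $ k) =
      (\<Sum>m\<le>l $ k. of_nat (l $ k choose m) * of_real (z $ k) ^ m * y $ k ^ m)" for k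
    unfolding add.commute[of 1] binomial_ring by (simp add: power_mult_distrib mult_ac)
  then show ?thesis
    by (simp add: product_poly_def eval_poly_of_coeffs prod_sum_atMost_vec prod.distrib multi_choose_def)
qed

lemma product_poly_nonneg:
  assumes "\<And>k. z $ k > 0"
  shows "product_poly l z \<in> nonneg_polys_le l"
proof -
  have "real (multi_choose l \<mu>) * (\<Prod>k\<in>UNIV. z $ k ^ (\<mu> $ k)) \<ge> 0" for \<mu>
    using assms by (intro mult_nonneg_nonneg prod_nonneg zero_le_power ballI) (auto simp: less_imp_le)
  then show ?thesis
    by (auto simp: nonneg_polys_le_def product_poly_def of_coeffs_polys_le lookup_of_coeffs)
qed

lemma product_poly_stable:
  assumes "\<And>k. z $ k > 0"
  shows "real_stable (product_poly l z)"
proof -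
  have "1 + of_real (z $ k) * y \<noteq> 0" if "Im y > 0" for y :: complex and k
  proof
    assume "1 + of_real (z $ k) * y = 0"
    then have "Im (1 + of_real (z $ k) * y) = 0" by simp
    with that assms[of k] show False by simp
  qed
  then show ?thesis by (simp add: real_stable_def eval_product_poly)
qed

text \<open>The box from 0 to \<open>l\<close> is a scaled image of the unit cube, hence the hull of
  its vertices, and all these vertices are exponents of the polynomial.\<close>

lemma Newt_product_poly:
  fixes l :: "nat ^ 'n::finite"
  assumes z: "\<And>k. z $ k > 0" and \<alpha>: "0 \<le> \<alpha>" "\<alpha> \<le> real_vec l"
  shows "\<alpha> \<in> Newt (product_poly l z)"
proof -
  have keys: "{..l} \<subseteq> Poly_Mapping.keys (product_poly l z)"
  proof
    fix \<mu> assume \<mu>: "\<mu> \<in> {..l}"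
    have "(\<Prod>k\<in>UNIV. z $ k ^ (\<mu> $ k)) > 0" using z by (intro prod_pos) auto
    then have "real (multi_choose l \<mu>) * (\<Prod>k\<in>UNIV. z $ k ^ (\<mu> $ k)) > 0"
      using \<mu> multi_choose_pos[of \<mu> l] by (intro mult_pos_pos) auto
    also have "real (multi_choose l \<mu>) * (\<Prod>k\<in>UNIV. z $ k ^ (\<mu> $ k)) = Poly_Mapping.lookup (product_poly l z) \<mu>"
      using \<mu> by (simp add: product_poly_def lookup_of_coeffs)
    finally show "\<mu> \<in> Poly_Mapping.keys (product_poly l z)"
      by (simp add: in_keys_iff)
  qed
  define f where "f = (\<lambda>v :: real ^ 'n. \<chi> k. real (l $ k) * v $ k)"
  have lin: "linear f"
    by (rule linearI) (simp_all add: f_def vec_eq_iff algebra_simps)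
  let ?V = "{x :: real ^ 'n. \<forall>i\<in>Basis. x \<bullet> i = 0 \<or> x \<bullet> i = 1}"
  \<comment> \<open>Where \<open>l $ k = 0\<close> the quotient is 0 by convention, and
    \<open>\<alpha> $ k\<close> is 0 too, so \<open>f t = \<alpha>\<close> holds there as
    well.\<close>
  define t where "t = (\<chi> k. \<alpha> $ k / real (l $ k))"
  have a: "0 \<le> \<alpha> $ k" "\<alpha> $ k \<le> real (l $ k)" for k
    using \<alpha> by (auto simp: less_eq_vec_def real_vec_def)
  have "(One :: real ^ 'n) \<bullet> i = 1" if "i \<in> Basis" for i
    using that by (simp add: inner_sum_left sum.If_cases inner_Basis)
  moreover have "0 \<le> t \<bullet> i \<and> t \<bullet> i \<le> 1" if "i \<in> Basis" for i
    using that a by (auto simp: Basis_vec_def inner_axis t_def divide_le_eq)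
  ultimately have "t \<in> cbox 0 One"
    by (simp add: mem_box)
  then have "f t \<in> f ` (convex hull ?V)"
    using unit_interval_convex_hull by blast
  also have "f ` (convex hull ?V) = convex hull (f ` ?V)"
    by (rule convex_hull_linear_image[OF lin])
  also have "\<dots> \<subseteq> Newt (product_poly l z)"
    unfolding Newt_def
  proof (rule hull_mono)
    show "f ` ?V \<subseteq> real_vec ` Poly_Mapping.keys (product_poly l z)"
    proof (rule image_subsetI)
      fix v assume "v \<in> ?V"
      then have v: "v $ k = 0 \<or> v $ k = 1" for k
        by (auto simp: Basis_vec_def inner_axis)
      define \<mu> where "\<mu> = (\<chi> k. if v $ k = 0 then 0 else l $ k)"
      have "\<mu> \<le> l" by (simp add: \<mu>_def less_eq_vec_def)
      moreover have "f v = real_vec \<mu>"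
        using v by (auto simp: f_def real_vec_def \<mu>_def vec_eq_iff)
      ultimately show "f v \<in> real_vec ` Poly_Mapping.keys (product_poly l z)"
        using keys by auto
    qed
  qed
  also have "f t = \<alpha>"
  proof -
    have "real (l $ k) * (\<alpha> $ k / real (l $ k)) = \<alpha> $ k" for k
      using a[of k] by (cases "l $ k = 0") auto
    then show ?thesis by (simp add: f_def t_def vec_eq_iff)
  qed
  finally show ?thesis .
qed

text \<open>Follows factor by factor from \<open>powr_le_one_plus_power\<close>. Bounding the
  denominator of the capacity ratio from below gives the upper bound for the infimum.\<close>

lemma Cap_product_poly_ge:
  fixes l :: "nat ^ 'n::finite"
  assumes z: "\<And>k. z $ k > 0" and \<alpha>: "0 \<le> \<alpha>" "\<alpha> \<le> real_vec l"
  shows "(\<Prod>k\<in>UNIV. z $ k powr \<alpha> $ k) / capacity_const l \<alpha> \<le> Cap \<alpha> (product_poly l z)"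
proof (rule Cap_greatest)
  fix x :: "real ^ 'n" assume x: "\<And>k. x $ k > 0"
  have a: "0 \<le> \<alpha> $ k" "\<alpha> $ k \<le> real (l $ k)" for k
    using \<alpha> by (auto simp: less_eq_vec_def real_vec_def)
  have "(\<Prod>k\<in>UNIV. z $ k powr \<alpha> $ k) * (\<Prod>k\<in>UNIV. x $ k powr \<alpha> $ k) = (\<Prod>k\<in>UNIV. (z $ k * x $ k) powr \<alpha> $ k)"
    unfolding prod.distrib[symmetric] by (intro prod.cong refl powr_mult[symmetric])
  also have "\<dots> \<le> (\<Prod>k\<in>UNIV. (1 + z $ k * x $ k) ^ (l $ k) *
      (self_pow (\<alpha> $ k) * self_pow (real (l $ k) - \<alpha> $ k) / self_pow (real (l $ k))))"
    using z x a by (intro prod_mono conjI powr_le_one_plus_power) auto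
  also have "\<dots> = eval_poly (product_poly l z) x * capacity_const l \<alpha>"
    unfolding eval_product_poly capacity_const_eq_prod prod.distrib[symmetric] by simp
  finally show "(\<Prod>k\<in>UNIV. z $ k powr \<alpha> $ k) / capacity_const l \<alpha>
      \<le> eval_poly (product_poly l z) x / (\<Prod>k\<in>UNIV. x $ k powr \<alpha> $ k)"
    using capacity_const_pos[OF \<alpha>] prod_powr_pos[OF x, of \<alpha>] by (simp add: divide_le_eq le_divide_eq mult.commute)
qed

section \<open>The capacity bound and its tightness\<close>

context
  fixes l :: "nat ^ 'n::finite" and \<gamma> :: "nat ^ 'm::finite" and T :: "'n rpoly \<Rightarrow> 'm rpoly"
  assumes T: "linear_between (polys_le l) (polys_le \<gamma>) T"
    and nonneg: "preserves_nonneg l \<gamma> T"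
begin

lemma lookup_image_nonneg: "p \<in> nonneg_polys_le l \<Longrightarrow> Poly_Mapping.lookup (T p) \<nu> \<ge> 0"
  using nonneg by (auto simp: preserves_nonneg_def nonneg_polys_le_def)

lemma monomial_nonneg_polys_le: "\<mu> \<le> l \<Longrightarrow> monomial \<mu> \<in> nonneg_polys_le l"
  by (simp add: nonneg_polys_le_def monomial_polys_le) (simp add: monomial_def lookup_single when_def)

lemma eval_image_monomial_nonneg:
  fixes x :: "real ^ 'm"
  shows "\<lbrakk>\<mu> \<le> l; \<And>k. x $ k > 0\<rbrakk> \<Longrightarrow> eval_poly (T (monomial \<mu>)) x \<ge> 0"
  by (intro eval_poly_nonneg lookup_image_nonneg monomial_nonneg_polys_le)

lemma lookup_Symb_nonneg: "Poly_Mapping.lookup (Symb l T) \<mu> \<ge> 0"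
  unfolding Symb_def lookup_sum lookup_single
  by (intro sum_nonneg) (auto simp: when_def lookup_image_nonneg monomial_nonneg_polys_le)

text \<open>The unpolarized symbol is evaluated at the geometric means of the copies; since the
  images of monomials are non-negative, each term is dominated by its polarization.\<close>

lemma Cap_Symb_le_symbol_eval:
  assumes z: "\<And>i. i \<in> polar_index l \<Longrightarrow> z i > 0" and x: "\<And>k. x $ k > 0"
  shows "Cap (vec_append \<alpha> \<beta>) (Symb l T) * ((\<Prod>k\<in>UNIV. geom_means l z $ k powr \<alpha> $ k) * (\<Prod>k\<in>UNIV. x $ k powr \<beta> $ k))
    \<le> symbol_eval l T z x"
proof -
  have "Cap (vec_append \<alpha> \<beta>) (Symb l T) * ((\<Prod>k\<in>UNIV. geom_means l z $ k powr \<alpha> $ k) * (\<Prod>k\<in>UNIV. x $ k powr \<beta> $ k))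
    \<le> eval_poly (Symb l T) (vec_append (geom_means l z) x)"
    unfolding prod_vec_append_powr[symmetric] using x
    by (intro Cap_mult_le lookup_Symb_nonneg vec_append_pos geom_means_pos z) auto
  also have "\<dots> = (\<Sum>\<mu>\<in>{..l}. real (multi_choose l \<mu>) * (\<Prod>k\<in>UNIV. geom_means l z $ k ^ (\<mu> $ k)) * eval_poly (T (monomial \<mu>)) x)"
    by (rule eval_Symb)
  also have "\<dots> \<le> symbol_eval l T z x"
    unfolding symbol_eval_def
  proof (intro sum_mono mult_right_mono)
    fix \<mu> assume "\<mu> \<in> {..l}"
    then show "real (multi_choose l \<mu>) * (\<Prod>k\<in>UNIV. geom_means l z $ k ^ (\<mu> $ k)) \<le> mesym l \<mu> z"
      unfolding geom_means_def using mesym_ge_geometric_mean[of l z \<mu>] z by simp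
    show "eval_poly (T (monomial \<mu>)) x \<ge> 0"
      using \<open>\<mu> \<in> {..l}\<close> x by (intro eval_image_monomial_nonneg) auto
  qed
  finally show ?thesis .
qed

lemma Cap_le_polarization:
  assumes p: "p \<in> nonneg_polys_le l" and y: "\<And>i. i \<in> polar_index l \<Longrightarrow> y i > 0"
  shows "Cap \<alpha> p * (\<Prod>k\<in>UNIV. geom_means l y $ k powr \<alpha> $ k)
    \<le> (\<Sum>\<mu>\<in>{..l}. Poly_Mapping.lookup p \<mu> / real (multi_choose l \<mu>) * mesym l \<mu> y)"
proof -
  have p': "p \<in> polys_le l" "\<And>\<mu>. Poly_Mapping.lookup p \<mu> \<ge> 0"
    using p by (auto simp: nonneg_polys_le_def)
  have "Cap \<alpha> p * (\<Prod>k\<in>UNIV. geom_means l y $ k powr \<alpha> $ k) \<le> eval_poly p (geom_means l y)"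
    by (intro Cap_mult_le p' geom_means_pos y)
  also have "\<dots> \<le> (\<Sum>\<mu>\<in>{..l}. Poly_Mapping.lookup p \<mu> / real (multi_choose l \<mu>) * mesym l \<mu> y)"
    unfolding eval_poly_polys_le[OF p'(1)]
  proof (rule sum_mono)
    fix \<mu> assume \<mu>: "\<mu> \<in> {..l}"
    then have mc: "real (multi_choose l \<mu>) > 0" using multi_choose_pos by auto
    have "Poly_Mapping.lookup p \<mu> / real (multi_choose l \<mu>) * (real (multi_choose l \<mu>) * (\<Prod>k\<in>UNIV. geom_means l y $ k ^ (\<mu> $ k)))
      \<le> Poly_Mapping.lookup p \<mu> / real (multi_choose l \<mu>) * mesym l \<mu> y"
      using mesym_ge_geometric_mean[of l y \<mu>] y \<mu> p'(2)
      by (intro mult_left_mono) (auto simp: geom_means_def)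
    then show "of_real (Poly_Mapping.lookup p \<mu>) * (\<Prod>k\<in>UNIV. geom_means l y $ k ^ (\<mu> $ k))
      \<le> Poly_Mapping.lookup p \<mu> / real (multi_choose l \<mu>) * mesym l \<mu> y"
      using mc by simp
  qed
  finally show ?thesis .
qed

text \<open>The first factor is a coefficient of the polarized \<open>p\<close>, the second one of
  the polarized symbol, whose binomial has cancelled. On the diagonal the
  \<open>multi_choose l \<mu>\<close> sets of multidegree \<open>\<mu>\<close> make up for the
  division.\<close>

definition pairing_coeff :: "'n rpoly \<Rightarrow> real ^ 'm \<Rightarrow> ('n \<times> nat) set \<Rightarrow> ('n \<times> nat) set \<Rightarrow> real" where
  "pairing_coeff p x S U = Poly_Mapping.lookup p (mdeg S) / real (multi_choose l (mdeg S))
     * eval_poly (T (monomial (mdeg U))) x"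

lemma pairing_poly_pairing_coeff:
  fixes y z :: "'n \<times> nat \<Rightarrow> 'a::real_field"
  shows "pairing_poly (polar_index l) (pairing_coeff p x) y z =
    (\<Sum>\<mu>\<in>{..l}. of_real (Poly_Mapping.lookup p \<mu>) / of_nat (multi_choose l \<mu>) * mesym l \<mu> y)
     * symbol_eval l T z (\<chi> k. of_real (x $ k))"
proof -
  have ev: "eval_poly q (\<chi> k. (of_real (x $ k) :: 'a)) = of_real (eval_poly q x)" for q
    by (simp add: eval_poly_def)
  have "pairing_poly (polar_index l) (pairing_coeff p x) y z =
    (\<Sum>S\<in>Pow (polar_index l). of_real (Poly_Mapping.lookup p (mdeg S)) / of_nat (multi_choose l (mdeg S)) * (\<Prod>i\<in>S. y i))
    * (\<Sum>U\<in>Pow (polar_index l). of_real (eval_poly (T (monomial (mdeg U))) x) * (\<Prod>i\<in>U. z i))"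
    unfolding pairing_poly_def pairing_coeff_def sum_product
    by (intro sum.cong refl) (simp add: mult_ac)
  also have "\<dots> = (\<Sum>\<mu>\<in>{..l}. of_real (Poly_Mapping.lookup p \<mu>) / of_nat (multi_choose l \<mu>) * mesym l \<mu> y)
     * symbol_eval l T z (\<chi> k. of_real (x $ k))"
    unfolding symbol_eval_def ev
      sum_polar_index_mesym[where G = "\<lambda>\<mu>. of_real (Poly_Mapping.lookup p \<mu>) / of_nat (multi_choose l \<mu>)" and \<zeta> = y]
      sum_polar_index_mesym[where G = "\<lambda>\<mu>. of_real (eval_poly (T (monomial \<mu>)) x)" and \<zeta> = z]
    by (simp add: mult.commute)
  finally show ?thesis .
qed

lemma sum_pairing_coeff_diag:
  assumes p: "p \<in> polys_le l"
  shows "(\<Sum>S\<in>Pow (polar_index l). pairing_coeff p x S S) = eval_poly (T p) x"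
proof -
  have "(\<Sum>S\<in>Pow (polar_index l). pairing_coeff p x S S) = (\<Sum>S\<in>Pow (polar_index l).
      Poly_Mapping.lookup p (mdeg S) / real (multi_choose l (mdeg S)) * eval_poly (T (monomial (mdeg S))) x * (\<Prod>i\<in>S. 1))"
    by (simp add: pairing_coeff_def)
  also have "\<dots> = (\<Sum>\<mu>\<in>{..l}. Poly_Mapping.lookup p \<mu> / real (multi_choose l \<mu>)
      * eval_poly (T (monomial \<mu>)) x * mesym l \<mu> (\<lambda>_. 1))"
    by (rule sum_polar_index_mesym)
  also have "\<dots> = (\<Sum>\<mu>\<in>{..l}. Poly_Mapping.lookup p \<mu> * eval_poly (T (monomial \<mu>)) x)"
    using multi_choose_pos[where l = l] by (intro sum.cong refl) (simp add: mesym_one)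
  also have "\<dots> = eval_poly (T p) x"
    by (simp add: eval_poly_linear_between[OF T p])
  finally show ?thesis .
qed

lemma mdeg_le: "S \<subseteq> polar_index l \<Longrightarrow> mdeg S \<le> l"
proof -
  assume S: "S \<subseteq> polar_index l"
  have "card {j. (k, j) \<in> S} \<le> card {..<l $ k}" for k
    using S by (intro card_mono) (auto simp: polar_index_def)
  then show ?thesis by (simp add: mdeg_def less_eq_vec_def)
qed

text \<open>Both polarizations are bounded below by capacities at geometric means;
  \<open>pairing_capacity_bound\<close> with exponent \<open>\<alpha> $ k / l $ k\<close> for each
  copy then bounds the diagonal sum, which is the value of \<open>T p\<close> at
  \<open>x\<close>.\<close>

theorem eval_image_ge:
  assumes rank: "rank_on (polys_le l) T > 2" and stab: "preserves_real_stability l T"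
    and \<alpha>: "0 \<le> \<alpha>" "\<alpha> \<le> real_vec l"
    and p: "p \<in> nonneg_polys_le l" "real_stable p" "p \<noteq> 0" and x: "\<And>k. x $ k > 0"
  shows "capacity_const l \<alpha> * Cap (vec_append \<alpha> \<beta>) (Symb l T) * Cap \<alpha> p * (\<Prod>k\<in>UNIV. x $ k powr \<beta> $ k)
    \<le> eval_poly (T p) x"
proof -
  let ?I = "polar_index l" and ?c = "pairing_coeff p x"
  let ?t = "\<lambda>i. \<alpha> $ fst i / real (l $ fst i)"
  define K where "K = Cap \<alpha> p * (Cap (vec_append \<alpha> \<beta>) (Symb l T) * (\<Prod>k\<in>UNIV. x $ k powr \<beta> $ k))"
  have p': "p \<in> polys_le l" "\<And>\<mu>. Poly_Mapping.lookup p \<mu> \<ge> 0"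
    using p by (auto simp: nonneg_polys_le_def)
  have "K * (\<Prod>i\<in>?I. contraction_const (?t i)) \<le> (\<Sum>S\<in>Pow ?I. ?c S S)"
  proof (rule pairing_capacity_bound[where c = ?c])
    show "finite ?I" by (rule finite_polar_index)
    show "?c S U \<ge> 0" if "S \<subseteq> ?I" "U \<subseteq> ?I" for S U
      unfolding pairing_coeff_def using that x
      by (intro mult_nonneg_nonneg divide_nonneg_nonneg p' eval_image_monomial_nonneg mdeg_le) auto
    show "0 \<le> ?t i \<and> ?t i \<le> 1" if "i \<in> ?I" for i
      using \<alpha> that by (auto simp: polar_index_def less_eq_vec_def real_vec_def divide_le_eq)
    have P: "(\<Sum>\<mu>\<in>{..l}. of_real (Poly_Mapping.lookup p \<mu>) / of_nat (multi_choose l \<mu>) * mesym l \<mu> y) \<noteq> 0"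
      if "\<forall>i\<in>?I. Im (y i) > 0" for y :: "'n \<times> nat \<Rightarrow> complex"
    proof (rule polarization_nonzero)
      fix v :: "'n \<Rightarrow> complex" assume "\<And>k. Im (v k) > 0"
      then have "eval_poly p (\<chi> k. v k) \<noteq> 0"
        using p by (simp add: real_stable_def)
      then show "(\<Sum>\<mu>\<in>{..l}. of_real (Poly_Mapping.lookup p \<mu>) * (\<Prod>k\<in>UNIV. v k ^ (\<mu> $ k))) \<noteq> 0"
        by (simp add: eval_poly_polys_le[OF p'(1)])
    qed (use that in auto)
    \<comment> \<open>The pairing is a product: the polarization of \<open>p\<close> has no zeros
      for \<open>y\<close> in the upper half-planes, and the polarized symbol has none, or vanishes
      identically, for \<open>z\<close> in the lower ones.\<close>
    show "opposite_stable ?I ?c"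
      using symbol_stable_at_positive[OF T rank stab, of x] P
      unfolding opposite_stable_def pairing_poly_pairing_coeff by (elim disjE) simp_all
    fix y z :: "'n \<times> nat \<Rightarrow> real" assume yz: "\<And>i. i \<in> ?I \<Longrightarrow> y i > 0 \<and> z i > 0"
    have "(\<Prod>i\<in>?I. (y i * z i) powr ?t i) = (\<Prod>i\<in>?I. y i powr ?t i) * (\<Prod>i\<in>?I. z i powr ?t i)"
      unfolding prod.distrib[symmetric] by (intro prod.cong refl powr_mult)
    also have "\<dots> = (\<Prod>k\<in>UNIV. geom_means l y $ k powr \<alpha> $ k) * (\<Prod>k\<in>UNIV. geom_means l z $ k powr \<alpha> $ k)"
      using yz by (simp add: prod_polar_index_powr)
    finally have "K * (\<Prod>i\<in>?I. (y i * z i) powr ?t i) =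
      (Cap \<alpha> p * (\<Prod>k\<in>UNIV. geom_means l y $ k powr \<alpha> $ k)) *
      (Cap (vec_append \<alpha> \<beta>) (Symb l T) * ((\<Prod>k\<in>UNIV. geom_means l z $ k powr \<alpha> $ k) * (\<Prod>k\<in>UNIV. x $ k powr \<beta> $ k)))"
      by (simp add: K_def mult_ac)
    also have "\<dots> \<le> (\<Sum>\<mu>\<in>{..l}. Poly_Mapping.lookup p \<mu> / real (multi_choose l \<mu>) * mesym l \<mu> y) * symbol_eval l T z x"
    proof (rule mult_mono')
      show "Cap \<alpha> p * (\<Prod>k\<in>UNIV. geom_means l y $ k powr \<alpha> $ k)
        \<le> (\<Sum>\<mu>\<in>{..l}. Poly_Mapping.lookup p \<mu> / real (multi_choose l \<mu>) * mesym l \<mu> y)"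
        using p(1) yz by (intro Cap_le_polarization) auto
      show "Cap (vec_append \<alpha> \<beta>) (Symb l T) * ((\<Prod>k\<in>UNIV. geom_means l z $ k powr \<alpha> $ k) * (\<Prod>k\<in>UNIV. x $ k powr \<beta> $ k))
        \<le> symbol_eval l T z x"
        using yz x by (intro Cap_Symb_le_symbol_eval) auto
    qed (intro mult_nonneg_nonneg prod_nonneg Cap_nonneg p' lookup_Symb_nonneg powr_ge_zero)+
    also have "\<dots> = pairing_poly ?I ?c y z"
      unfolding pairing_poly_pairing_coeff by simp
    finally show "K * (\<Prod>i\<in>?I. (y i * z i) powr ?t i) \<le> pairing_poly ?I ?c y z" .
  qed
  then show ?thesis
    unfolding prod_contraction_const_polar_index[OF \<alpha>] sum_pairing_coeff_diag[OF p'(1)]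
    by (simp add: K_def mult_ac)
qed

theorem Cap_image_ge:
  assumes rank: "rank_on (polys_le l) T > 2" and stab: "preserves_real_stability l T"
    and \<alpha>: "0 \<le> \<alpha>" "\<alpha> \<le> real_vec l"
    and p: "p \<in> nonneg_polys_le l" "real_stable p" "\<alpha> \<in> Newt p"
  shows "capacity_const l \<alpha> * Cap (vec_append \<alpha> \<beta>) (Symb l T) \<le> Cap \<beta> (T p) / Cap \<alpha> p"
proof -
  have C: "Cap \<alpha> p > 0"
    using p by (intro Cap_pos) (auto simp: nonneg_polys_le_def)
  have p0: "p \<noteq> 0" using p(3) by (auto simp: Newt_def)
  have "capacity_const l \<alpha> * Cap (vec_append \<alpha> \<beta>) (Symb l T) * Cap \<alpha> p \<le> Cap \<beta> (T p)"
  proof (rule Cap_greatest)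
    fix x :: "real ^ 'm" assume x: "\<And>k. x $ k > 0"
    show "capacity_const l \<alpha> * Cap (vec_append \<alpha> \<beta>) (Symb l T) * Cap \<alpha> p
        \<le> eval_poly (T p) x / (\<Prod>k\<in>UNIV. x $ k powr \<beta> $ k)"
      using eval_image_ge[OF rank stab \<alpha> p(1,2) p0 x, of \<beta>] prod_powr_pos[OF x, of \<beta>]
      by (simp add: le_divide_eq)
  qed
  then show ?thesis using C by (simp add: le_divide_eq)
qed

text \<open>The coefficients of \<open>product_poly l z\<close> are exactly the weights of the
  images of monomials in the symbol.\<close>

lemma eval_image_product_poly:
  "eval_poly (T (product_poly l z)) x = eval_poly (Symb l T) (vec_append z x)" for x :: "real ^ 'm"
proof -
  have pp: "product_poly l z \<in> polys_le l"
    by (simp add: product_poly_def of_coeffs_polys_le)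
  show ?thesis
    unfolding eval_poly_linear_between[OF T pp] eval_Symb
    by (intro sum.cong refl) (simp add: product_poly_def lookup_of_coeffs)
qed

lemma Cap_image_product_poly_le:
  assumes z: "\<And>k. z $ k > 0" and x: "\<And>k. x $ k > 0" and \<alpha>: "0 \<le> \<alpha>" "\<alpha> \<le> real_vec l"
  shows "Cap \<beta> (T (product_poly l z)) / Cap \<alpha> (product_poly l z) \<le>
    capacity_const l \<alpha> * (eval_poly (Symb l T) (vec_append z x)
      / ((\<Prod>k\<in>UNIV. z $ k powr \<alpha> $ k) * (\<Prod>k\<in>UNIV. x $ k powr \<beta> $ k)))"
proof -
  have nn: "\<And>\<nu>. Poly_Mapping.lookup (T (product_poly l z)) \<nu> \<ge> 0"
    using z by (intro lookup_image_nonneg product_poly_nonneg)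
  have "Cap \<beta> (T (product_poly l z)) / Cap \<alpha> (product_poly l z) \<le>
    (eval_poly (T (product_poly l z)) x / (\<Prod>k\<in>UNIV. x $ k powr \<beta> $ k)) / ((\<Prod>k\<in>UNIV. z $ k powr \<alpha> $ k) / capacity_const l \<alpha>)"
  proof (rule frac_le)
    show "0 \<le> eval_poly (T (product_poly l z)) x / (\<Prod>k\<in>UNIV. x $ k powr \<beta> $ k)"
      using nn x by (intro divide_nonneg_pos eval_poly_nonneg prod_powr_pos)
    show "Cap \<beta> (T (product_poly l z)) \<le> eval_poly (T (product_poly l z)) x / (\<Prod>k\<in>UNIV. x $ k powr \<beta> $ k)"
      using nn x by (rule Cap_le)
    show "0 < (\<Prod>k\<in>UNIV. z $ k powr \<alpha> $ k) / capacity_const l \<alpha>"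
      using prod_powr_pos[OF z] capacity_const_pos[OF \<alpha>] by simp
  qed (rule Cap_product_poly_ge[OF z \<alpha>])
  then show ?thesis
    by (simp add: eval_image_product_poly mult_ac)
qed

end

theorem corollary4p13:
  fixes l :: "nat ^ 'n::finite" and \<gamma> :: "nat ^ 'm::finite"
    and T :: "'n rpoly \<Rightarrow> 'm rpoly"
    and \<alpha> :: "real ^ 'n" and \<beta> :: "real ^ 'm"
  assumes "linear_between (polys_le l) (polys_le \<gamma>) T"
    and "rank_on (polys_le l) T > 2"
    and "preserves_nonneg l \<gamma> T"
    and "preserves_real_stability l T"
    and "0 \<le> \<alpha>" and "\<alpha> \<le> real_vec l"
    and "0 \<le> \<beta>"
  shows "(\<forall>p\<in>nonneg_polys_le l. real_stable p \<and> \<alpha> \<in> Newt p \<longrightarrow>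
            Cap \<beta> (T p) / Cap \<alpha> p
              \<ge> self_power \<alpha> * self_power (real_vec l - \<alpha>) / self_power (real_vec l)
                  * Cap (vec_append \<alpha> \<beta>) (Symb l T))
       \<and> (INF p\<in>{p \<in> nonneg_polys_le l. real_stable p \<and> \<alpha> \<in> Newt p}.
            Cap \<beta> (T p) / Cap \<alpha> p)
           = self_power \<alpha> * self_power (real_vec l - \<alpha>) / self_power (real_vec l)
               * Cap (vec_append \<alpha> \<beta>) (Symb l T)"
  unfolding capacity_const_def[symmetric]
proof (intro conjI ballI impI)
  note T = assms(1,3) and \<alpha> = assms(5,6)
  let ?R = "capacity_const l \<alpha> * Cap (vec_append \<alpha> \<beta>) (Symb l T)"
  let ?A = "{p \<in> nonneg_polys_le l. real_stable p \<and> \<alpha> \<in> Newt p}"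
  let ?r = "\<lambda>p. Cap \<beta> (T p) / Cap \<alpha> p"
  have lower: "?R \<le> ?r p" if "p \<in> ?A" for p
    using that by (intro Cap_image_ge[OF T assms(2,4) \<alpha>]) auto
  then show "?R \<le> ?r p" if "p \<in> nonneg_polys_le l" "real_stable p \<and> \<alpha> \<in> Newt p" for p
    using that by auto
  have mem: "product_poly l z \<in> ?A" if "\<And>k. z $ k > 0" for z
    using that by (simp add: product_poly_nonneg product_poly_stable Newt_product_poly \<alpha>)
  have bdd: "bdd_below (?r ` ?A)"
    using lower by (rule bdd_belowI2)
  have c: "capacity_const l \<alpha> > 0" using \<alpha> by (rule capacity_const_pos)
  \<comment> \<open>Each positive point \<open>(z, x)\<close> supplies a competitor
    \<open>product_poly l z\<close>, so the infimum lies below every quotient that defines the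
    capacity of the symbol.\<close>
  have "(INF p\<in>?A. ?r p) / capacity_const l \<alpha> \<le> Cap (vec_append \<alpha> \<beta>) (Symb l T)"
  proof (rule Cap_greatest)
    fix v :: "real ^ ('n + 'm)" assume v: "\<And>k. v $ k > 0"
    define z where "z = (\<chi> k. v $ Inl k)"
    define x where "x = (\<chi> k. v $ Inr k)"
    have zx: "\<And>k. z $ k > 0" "\<And>k. x $ k > 0" "vec_append z x = v"
      using v by (simp_all add: z_def x_def vec_append_split)
    have "(INF p\<in>?A. ?r p) \<le> ?r (product_poly l z)"
      using bdd mem[OF zx(1)] by (rule cINF_lower)
    also have "\<dots> \<le> capacity_const l \<alpha> * (eval_poly (Symb l T) v / (\<Prod>i\<in>UNIV. v $ i powr vec_append \<alpha> \<beta> $ i))"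
      using Cap_image_product_poly_le[OF T zx(1,2) \<alpha>, of \<beta>]
      unfolding prod_vec_append_powr[symmetric] zx(3) .
    finally show "(INF p\<in>?A. ?r p) / capacity_const l \<alpha>
        \<le> eval_poly (Symb l T) v / (\<Prod>i\<in>UNIV. v $ i powr vec_append \<alpha> \<beta> $ i)"
      using c by (simp add: divide_le_eq mult.commute)
  qed
  then have "(INF p\<in>?A. ?r p) \<le> ?R"
    using c by (simp add: divide_le_eq mult.commute)
  moreover have "?R \<le> (INF p\<in>?A. ?r p)"
  proof (rule cINF_greatest)
    show "?A \<noteq> {}" using mem[of "\<chi> k. 1"] by auto
  qed (rule lower)
  ultimately show "(INF p\<in>?A. ?r p) = ?R" by (rule order.antisym)
qed

end
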